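(* Let $\psi$ be a Ma-Minda function, let $K\ge 1$, $k=(K-1)/(K+1)$, and let $h(z)=f(z)+\overline{g(z)}=z+\sum_{m=2}^{\infty}a_mz^m+\overline{\sum_{m=1}^{\infty}b_mz^m}$ be a sense-preserving $K$-quasiconformal harmonic mapping on the unit disk $\mathbb{D}$ with $f\in\mathcal{S}^*(\psi)$. Let $h_1(z)=f_1(z)+\overline{g_1(z)}=z+\sum_{m=2}^{\infty}c_mz^m+\overline{\sum_{m=1}^{\infty}d_mz^m}$ be a harmonic function with $h_1\prec h$, and put $c_1=1$. Then $$\sum_{m=1}^{\infty}(|c_m|+|d_m|)r^m\le d(f(0),\partial f(\mathbb{D}))$$ holds for all $0\le r\le r^*=\min\{r_0,\tfrac13\}$, where $r_0$ is the unique root in $(0,1)$ of $$\frac{2K}{K+1}\hat f_0(r)=-f_0(-1).$$ Moreover, if $\hat f_0=f_0$ and $r^*=r_0$, the result is sharp: for $h=h_1=p$ with $p(z)=f_0(z)+k\overline{f_0(z)}$, equality holds at $r=r_0$, so the radius cannot be increased.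
   Context: $\mathbb{D}=\{|z|<1\}$. $\mathcal{A}$ is the class of analytic functions $f(z)=z+\sum_{m\ge2}a_mz^m$ on $\mathbb{D}$. A Ma-Minda function is an analytic univalent function $\psi$ on $\mathbb{D}$ with $\Re\psi>0$, $\psi(0)=1$, $\psi'(0)>0$, and $\psi(\mathbb{D})$ symmetric about the real axis. A function $u$ (analytic or harmonic) is subordinate to $v$, written $u\prec v$, if $u=v\circ w$ for a Schwarz function $w$ (analytic $w:\mathbb{D}\to\mathbb{D}$ with $w(0)=0$). $\mathcal{S}^*(\psi)=\{f\in\mathcal{A}: zf'(z)/f(z)\prec\psi(z)\}$. A harmonic function on $\mathbb{D}$ is written $h=f+\overline g$ with $f,g$ analytic and $g(0)=0$. It is sense-preserving if $|f'|^2-|g'|^2>0$ in $\mathbb{D}$. For $K\ge1$, a sense-preserving $K$-quasiconformal harmonic mapping is a harmonic, sense-preserving homeomorphism $h=f+\overline g$ of $\mathbb{D}$ onto its image whose dilatation satisfies $|g'/f'|\le k=(K-1)/(K+1)$ in $\mathbb{D}$. $f_0\in\mathcal{A}$ is defined by $zf_0'(z)/f_0(z)=\psi(z)$; if $f_0(z)=z+\sum_{m\ge2}t_mz^m$, then $\hat f_0(r)=r+\sum_{m\ge2}|t_m|r^m$. The value $f_0(-1)$ means $\lim_{r\to1^-}f_0(-r)$. $d(f(0),\partial f(\mathbb{D}))$ is the Euclidean distance from $f(0)$ to the boundary of $f(\mathbb{D})$. *)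

theory Defs
  imports "HOL-Complex_Analysis.Complex_Analysis"
begin

abbreviation unit_disk :: "complex set" (\<open>\<D>\<close>)
  where "\<D> \<equiv> ball 0 1"

abbreviation coeff0 :: "(complex \<Rightarrow> complex) \<Rightarrow> nat \<Rightarrow> complex"
  where "coeff0 f m \<equiv> fps_nth (fps_expansion f 0) m"

definition class_A :: "(complex \<Rightarrow> complex) set"
  where "class_A = {f. f holomorphic_on \<D> \<and> f 0 = 0 \<and> deriv f 0 = 1}"

definition ma_minda :: "(complex \<Rightarrow> complex) \<Rightarrow> bool"
  where "ma_minda \<psi> \<longleftrightarrow>
    \<psi> holomorphic_on \<D> \<and> inj_on \<psi> \<D> \<and>
    (\<forall>z\<in>\<D>. Re (\<psi> z) > 0) \<and>
    \<psi> 0 = 1 \<and> deriv \<psi> 0 \<in> \<real> \<and> Re (deriv \<psi> 0) > 0 \<and>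
    cnj ` (\<psi> ` \<D>) = \<psi> ` \<D>"

definition schwarz_function :: "(complex \<Rightarrow> complex) \<Rightarrow> bool"
  where "schwarz_function w \<longleftrightarrow> w holomorphic_on \<D> \<and> w ` \<D> \<subseteq> \<D> \<and> w 0 = 0"

definition subordinate :: "(complex \<Rightarrow> complex) \<Rightarrow> (complex \<Rightarrow> complex) \<Rightarrow> bool"
  (infix \<open>\<prec>\<^sub>s\<close> 50)
  where "u \<prec>\<^sub>s v \<longleftrightarrow> (\<exists>w. schwarz_function w \<and> (\<forall>z\<in>\<D>. u z = v (w z)))"

text \<open>
  The quotient \<open>z f'(z) / f(z)\<close> has a removable singularity at \<open>0\<close>, with value \<open>1\<close> for
  \<open>f\<close> in \<^const>\<open>class_A\<close>. At any further zero of \<open>f\<close> the expression below is \<open>0\<close>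
  (division by zero), a value that a function of positive real part does not take; hence
  no separate condition \<open>f z \<noteq> 0\<close> is needed where the quotient is compared with \<open>\<psi>\<close>.
\<close>
definition log_deriv_quotient :: "(complex \<Rightarrow> complex) \<Rightarrow> complex \<Rightarrow> complex"
  where "log_deriv_quotient f z = (if z = 0 then 1 else z * deriv f z / f z)"

definition starlike_class :: "(complex \<Rightarrow> complex) \<Rightarrow> (complex \<Rightarrow> complex) set"
  where "starlike_class \<psi> = {f \<in> class_A. log_deriv_quotient f \<prec>\<^sub>s \<psi>}"

text \<open>
  A harmonic function on the disk is given by its pair \<open>(f, g)\<close> of analytic parts, which is
  unique because of the normalisation \<open>g 0 = 0\<close>.
\<close>
definition harmonic_parts :: "(complex \<Rightarrow> complex) \<Rightarrow> (complex \<Rightarrow> complex) \<Rightarrow> bool"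
  where "harmonic_parts f g \<longleftrightarrow> f holomorphic_on \<D> \<and> g holomorphic_on \<D> \<and> g 0 = 0"

definition harmonic_map :: "(complex \<Rightarrow> complex) \<Rightarrow> (complex \<Rightarrow> complex) \<Rightarrow> complex \<Rightarrow> complex"
  where "harmonic_map f g z = f z + cnj (g z)"

definition sense_preserving :: "(complex \<Rightarrow> complex) \<Rightarrow> (complex \<Rightarrow> complex) \<Rightarrow> bool"
  where "sense_preserving f g \<longleftrightarrow> (\<forall>z\<in>\<D>. (cmod (deriv f z))\<^sup>2 - (cmod (deriv g z))\<^sup>2 > 0)"

definition qc_harmonic_mapping ::
    "real \<Rightarrow> (complex \<Rightarrow> complex) \<Rightarrow> (complex \<Rightarrow> complex) \<Rightarrow> bool"
  where "qc_harmonic_mapping K f g \<longleftrightarrow>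
    harmonic_parts f g \<and> sense_preserving f g \<and>
    (\<exists>h'. homeomorphism \<D> (harmonic_map f g ` \<D>) (harmonic_map f g) h') \<and>
    (\<forall>z\<in>\<D>. cmod (deriv g z / deriv f z) \<le> (K - 1) / (K + 1))"

text \<open>
  The function \<open>f\<^sub>0\<close> attached to \<open>\<psi>\<close>. It is determined on the disk only, so everything below
  uses just its values there.
\<close>
definition is_extremal :: "(complex \<Rightarrow> complex) \<Rightarrow> (complex \<Rightarrow> complex) \<Rightarrow> bool"
  where "is_extremal \<psi> f\<^sub>0 \<longleftrightarrow> f\<^sub>0 \<in> class_A \<and> (\<forall>z\<in>\<D>. log_deriv_quotient f\<^sub>0 z = \<psi> z)"

definition hat :: "(complex \<Rightarrow> complex) \<Rightarrow> real \<Rightarrow> real"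
  where "hat f r = r + (\<Sum>m. cmod (coeff0 f (m + 2)) * r ^ (m + 2))"

definition value_at_minus_one :: "(complex \<Rightarrow> complex) \<Rightarrow> complex"
  where "value_at_minus_one f = Lim (at_left (1::real)) (\<lambda>r. f (- complex_of_real r))"

text \<open>
  The sum over \<open>m \<ge> 1\<close> is shifted by one. For functions analytic on the disk and
  \<open>0 \<le> r < 1\<close>, the only case used, the series converges.
\<close>
definition bohr_sum :: "(complex \<Rightarrow> complex) \<Rightarrow> (complex \<Rightarrow> complex) \<Rightarrow> real \<Rightarrow> real"
  where "bohr_sum f g r =
    (\<Sum>m. (cmod (coeff0 f (Suc m)) + cmod (coeff0 g (Suc m))) * r ^ Suc m)"

definition boundary_dist :: "(complex \<Rightarrow> complex) \<Rightarrow> real"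
  where "boundary_dist f = infdist (f 0) (frontier (f ` \<D>))"

end

theory Submission
  imports Defs
begin

text \<open>
  Since \<open>f\<^sub>1\<close> and \<open>f\<close> both have derivative 1 at 0, the Schwarz lemma forces \<open>h\<^sub>1 = h\<close>, and since
  \<open>\<bar>g'\<bar> \<le> k \<bar>f'\<bar>\<close>, Bohr's inequality reduces the claim to a bound on the coefficients of \<open>f\<close>:
  \<open>(1 + k) (\<Sum> \<bar>a\<^sub>m\<bar> r\<^sup>m)\<close> is at most \<open>d(0, \<partial>f(\<D>))\<close>.

  Write \<open>f(z) = z exp (G z)\<close> and \<open>f\<^sub>0(z) = z exp (F z)\<close> with \<open>z G'(z) = \<psi>(w(z)) - 1\<close> and
  \<open>z F'(z) = \<psi>(z) - 1\<close>. The Ma-Minda functions considered here need not have a starlike range, so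
  \<open>f(z)/z\<close> need not be subordinate to \<open>f\<^sub>0(z)/z\<close>. Instead both sides are compared through
  \<open>a = \<bar>w'(0)\<bar>\<close>. With \<open>B = \<psi>'(0)\<close>, the distance of \<open>0\<close> to the boundary is at least
  \<open>- f\<^sub>0(-1) exp ((1 - a) B / 6)\<close>: at a point where \<open>\<bar>f\<bar>\<close> is minimal on a circle, \<open>w\<close> is real, so only
  the monotonicity of \<open>\<psi>\<close> on the real axis enters. On the other side, the majorant series of \<open>f\<close> at
  \<open>r \<le> 1/3\<close> is at most that of \<open>f\<^sub>0\<close> times the same factor \<open>exp ((1 - a) B / 6)\<close>, by writing
  \<open>exp (G z) = exp (F (w'(0) z)) exp (G z - F (w'(0) z))\<close>.
\<close>

section \<open>Majorant series\<close>

text \<open>Symmetry replaces starlikeness of the range: \<open>Psi\<close> = \<psi> - 1 is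
  typically real, and Rogosinski's transform makes (1 - z^2) \<open>Psi z\<close> / z a function of
  nonnegative real part. Both the coefficient bound n B and the lower bound for \<psi>' on (-1, 0]
  come from it, with the Koebe function z / (1 - z)^2 as the model. All exponents are kept linear in
  1 - a, so that they can be compared for all a at once. On the boundary side the gain comes from
  the Schwarz lemma, which is strict for a < 1; summed over all radii it is (1 - a) B / 6. On the
  majorant side the passage from exp (F z) to exp (F (w'(0) z)) saves something, and this pays for a
  part of the remainder G z - F (w'(0) z); what is left is again at most (1 - a) B / 6. The
  remainder is estimated by Bohr's theorem for w(z) / z, a second origin of the radius 1/3 besides
  the dilatation g' / f'.\<close>

definition majorant :: "(complex \<Rightarrow> complex) \<Rightarrow> real \<Rightarrow> real"
  where "majorant f s = (\<Sum>n. cmod (coeff0 f n) * s ^ n)"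

lemma fps_expansion_disk:
  assumes "f holomorphic_on \<D>"
  shows "f has_fps_expansion fps_expansion f 0"
  using assms by (intro has_fps_expansion_fps_expansion[of \<D>]) auto

lemma coeff_0: "coeff0 f 0 = f 0"
  by (simp add: fps_expansion_def)

lemma coeff_1: "coeff0 f (Suc 0) = deriv f 0"
  by (simp add: fps_expansion_def)

lemma coeff_cong:
  assumes "\<And>z. z \<in> \<D> \<Longrightarrow> f z = g z"
  shows "coeff0 f n = coeff0 g n"
proof -
  have "\<forall>\<^sub>F z in nhds 0. f z = g z"
    using assms eventually_nhds_in_open[of \<D> "0::complex"] by (auto elim!: eventually_mono)
  then show ?thesis
    by (metis fps_expansion_cong)
qed

lemma coeff_add:
  assumes "f holomorphic_on \<D>" "g holomorphic_on \<D>"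
  shows "coeff0 (\<lambda>z. f z + g z) n = coeff0 f n + coeff0 g n"
  using fps_expansion_eqI[OF has_fps_expansion_add[OF fps_expansion_disk[OF assms(1)]
        fps_expansion_disk[OF assms(2)]]] by simp

lemma coeff_diff:
  assumes "f holomorphic_on \<D>" "g holomorphic_on \<D>"
  shows "coeff0 (\<lambda>z. f z - g z) n = coeff0 f n - coeff0 g n"
  using fps_expansion_eqI[OF has_fps_expansion_diff[OF fps_expansion_disk[OF assms(1)]
        fps_expansion_disk[OF assms(2)]]] by simp

lemma coeff_cmult:
  assumes "f holomorphic_on \<D>"
  shows "coeff0 (\<lambda>z. c * f z) n = c * coeff0 f n"
  using fps_expansion_eqI[OF has_fps_expansion_cmult_left[OF fps_expansion_disk[OF assms(1)], of c]] by simp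

lemma coeff_const: "coeff0 (\<lambda>z. c) n = (if n = 0 then c else 0)"
  using fps_expansion_eqI[OF has_fps_expansion_const[of c]] by simp

lemma coeff_mult:
  assumes "f holomorphic_on \<D>" "g holomorphic_on \<D>"
  shows "coeff0 (\<lambda>z. f z * g z) n = (\<Sum>i\<le>n. coeff0 f i * coeff0 g (n - i))"
  using fps_expansion_eqI[OF has_fps_expansion_mult[OF fps_expansion_disk[OF assms(1)]
        fps_expansion_disk[OF assms(2)]]] by (simp add: fps_mult_nth atLeast0AtMost)

lemma coeff_times_z:
  assumes "f holomorphic_on \<D>"
  shows "coeff0 (\<lambda>z. z * f z) n = (if n = 0 then 0 else coeff0 f (n - 1))"
  using fps_expansion_eqI[OF has_fps_expansion_mult[OF has_fps_expansion_fps_X fps_expansion_disk[OF assms(1)]]]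
  by simp

lemma coeff_deriv:
  assumes "f holomorphic_on \<D>"
  shows "coeff0 (deriv f) n = of_nat (Suc n) * coeff0 f (Suc n)"
  using fps_expansion_eqI[OF has_fps_expansion_deriv[OF fps_expansion_disk[OF assms(1)]]] by simp

lemma coeff_scale:
  assumes "f holomorphic_on \<D>" "cmod c \<le> 1"
  shows "coeff0 (\<lambda>z. f (c * z)) n = c ^ n * coeff0 f n"
proof -
  have 1: "(\<lambda>z. c * z) has_fps_expansion fps_const c * fps_X"
    by (intro fps_expansion_intros)
  have "(f \<circ> (\<lambda>z. c * z)) has_fps_expansion (fps_expansion f 0 oo (fps_const c * fps_X))"
    by (rule has_fps_expansion_compose[OF fps_expansion_disk[OF assms(1)] 1]) simp
  from fps_expansion_eqI[OF this] show ?thesis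
    by (simp add: o_def)
qed

lemma power_series_disk:
  assumes "f holomorphic_on \<D>" "z \<in> \<D>"
  shows "(\<lambda>n. coeff0 f n * z ^ n) sums f z"
  using holomorphic_power_series[OF assms] by (simp add: fps_expansion_def)

section \<open>The majorant as a function of the radius\<close>

lemma summable_majorant:
  assumes "f holomorphic_on \<D>" "\<bar>s\<bar> < 1"
  shows "summable (\<lambda>n. cmod (coeff0 f n) * s ^ n)"
proof -
  \<comment> \<open>A radius strictly between \<bar>s\<bar> and 1: convergence there forces absolute
    convergence at s.\<close>
  define t where "t = (\<bar>s\<bar> + 1) / 2"
  have t: "\<bar>s\<bar> < t" "t < 1" "0 \<le> t" using assms(2) by (auto simp: t_def)
  have "summable (\<lambda>n. coeff0 f n * (of_real t :: complex) ^ n)"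
    using power_series_disk[OF assms(1), of "of_real t"] t by (simp add: sums_iff)
  then have "summable (\<lambda>n. norm (coeff0 f n * of_real s ^ n))"
    by (rule powser_insidea) (use t in auto)
  then have "summable (\<lambda>n. norm (cmod (coeff0 f n) * s ^ n))"
    by (simp add: norm_mult norm_power abs_mult power_abs)
  then show ?thesis by (rule summable_norm_cancel)
qed

lemma majorant_nonneg:
  assumes "f holomorphic_on \<D>" "0 \<le> s" "s < 1"
  shows "0 \<le> majorant f s"
  unfolding majorant_def
  by (rule suminf_nonneg) (use summable_majorant[OF assms(1), of s] assms in auto)

lemma majorant_cong:
  assumes "\<And>z. z \<in> \<D> \<Longrightarrow> f z = g z"
  shows "majorant f s = majorant g s"
  unfolding majorant_def using coeff_cong[OF assms] by simp

lemma majorant_leI: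
  assumes "\<And>N. (\<Sum>n<N. cmod (coeff0 f n) * s ^ n) \<le> C" "0 \<le> s"
  shows "majorant f s \<le> C"
  unfolding majorant_def
proof (rule suminf_le_const)
  show "summable (\<lambda>n. cmod (coeff0 f n) * s ^ n)"
  proof (rule bounded_imp_summable)
    show "(\<Sum>k\<le>n. cmod (coeff0 f k) * s ^ k) \<le> C" for n
      using assms(1)[of "Suc n"] by (simp only: lessThan_Suc_atMost)
  qed (use assms(2) in auto)
qed (rule assms(1))

lemma sum_le_majorant:
  assumes "f holomorphic_on \<D>" "0 \<le> s" "s < 1"
  shows "(\<Sum>n<N. cmod (coeff0 f n) * s ^ n) \<le> majorant f s"
  unfolding majorant_def
  by (rule sum_le_suminf) (use summable_majorant[OF assms(1), of s] assms in auto)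

lemma majorant_mult:
  assumes "f holomorphic_on \<D>" "g holomorphic_on \<D>" "0 \<le> s" "s < 1"
  shows "majorant (\<lambda>z. f z * g z) s \<le> majorant f s * majorant g s"
proof -
  let ?a = "\<lambda>n. cmod (coeff0 f n) * s ^ n" and ?b = "\<lambda>n. cmod (coeff0 g n) * s ^ n"
  have s: "summable (\<lambda>n. norm (?a n))" "summable (\<lambda>n. norm (?b n))"
    using summable_majorant[OF assms(1), of s] summable_majorant[OF assms(2), of s] assms(3,4) by auto
  have "majorant f s * majorant g s = (\<Sum>n. \<Sum>i\<le>n. ?a i * ?b (n - i))"
    unfolding majorant_def using Cauchy_product[OF s] by simp
  moreover have "majorant (\<lambda>z. f z * g z) s \<le> (\<Sum>n. \<Sum>i\<le>n. ?a i * ?b (n - i))"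
    unfolding majorant_def
  proof (rule suminf_le)
    show "summable (\<lambda>n. \<Sum>i\<le>n. ?a i * ?b (n - i))"
      using summable_Cauchy_product[OF s] by simp
    show "summable (\<lambda>n. cmod (coeff0 (\<lambda>z. f z * g z) n) * s ^ n)"
      by (rule summable_majorant) (use assms in \<open>auto intro!: holomorphic_intros\<close>)
    fix n
    have "cmod (coeff0 (\<lambda>z. f z * g z) n) * s ^ n \<le>
        (\<Sum>i\<le>n. cmod (coeff0 f i * coeff0 g (n - i))) * s ^ n"
      unfolding coeff_mult[OF assms(1,2)] using assms(3) by (intro mult_right_mono norm_sum) auto
    also have "\<dots> = (\<Sum>i\<le>n. ?a i * ?b (n - i))"
      unfolding sum_distrib_right
    proof (rule sum.cong)
      fix i assume "i \<in> {..n}"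
      then have "s ^ n = s ^ i * s ^ (n - i)" by (simp flip: power_add)
      then show "cmod (coeff0 f i * coeff0 g (n - i)) * s ^ n = ?a i * ?b (n - i)"
        by (simp add: norm_mult)
    qed simp
    finally show "cmod (coeff0 (\<lambda>z. f z * g z) n) * s ^ n \<le> (\<Sum>i\<le>n. ?a i * ?b (n - i))" .
  qed
  ultimately show ?thesis by simp
qed

lemma majorant_add:
  assumes "f holomorphic_on \<D>" "g holomorphic_on \<D>" "0 \<le> s" "s < 1"
  shows "majorant (\<lambda>z. f z + g z) s \<le> majorant f s + majorant g s"
  unfolding majorant_def coeff_add[OF assms(1,2)]
proof (subst suminf_add)
  have s: "\<bar>s\<bar> < 1" using assms by simp
  show 1: "summable (\<lambda>n. cmod (coeff0 f n) * s ^ n)" "summable (\<lambda>n. cmod (coeff0 g n) * s ^ n)"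
    using summable_majorant assms s by blast+
  show "(\<Sum>n. cmod (coeff0 f n + coeff0 g n) * s ^ n) \<le> (\<Sum>n. cmod (coeff0 f n) * s ^ n + cmod (coeff0 g n) * s ^ n)"
  proof (rule suminf_le)
    show "summable (\<lambda>n. cmod (coeff0 f n + coeff0 g n) * s ^ n)"
      unfolding coeff_add[OF assms(1,2), symmetric]
      by (rule summable_majorant) (use assms s in \<open>auto intro!: holomorphic_intros\<close>)
    show "summable (\<lambda>n. cmod (coeff0 f n) * s ^ n + cmod (coeff0 g n) * s ^ n)"
      using 1 by (rule summable_add)
  qed (use assms in \<open>auto intro!: mult_right_mono norm_triangle_ineq simp flip: distrib_right\<close>)
qed

lemma majorant_cmult:
  assumes "f holomorphic_on \<D>" "0 \<le> s" "s < 1"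
  shows "majorant (\<lambda>z. c * f z) s = cmod c * majorant f s"
  unfolding majorant_def coeff_cmult[OF assms(1)]
  using suminf_mult[OF summable_majorant[OF assms(1), of s], of "cmod c"] assms by (simp add: norm_mult mult.assoc)

lemma majorant_times_z:
  assumes "f holomorphic_on \<D>" "0 \<le> s" "s < 1"
  shows "majorant (\<lambda>z. z * f z) s = s * majorant f s"
proof -
  let ?g = "\<lambda>n. cmod (coeff0 (\<lambda>z. z * f z) n) * s ^ n"
  have hol: "(\<lambda>z. z * f z) holomorphic_on \<D>" by (intro holomorphic_intros assms)
  have "majorant (\<lambda>z. z * f z) s = (\<Sum>n. ?g (Suc n)) + ?g 0"
    using suminf_split_head[OF summable_majorant[OF hol, of s]] assms by (simp add: majorant_def)
  also have "\<dots> = (\<Sum>n. s * (cmod (coeff0 f n) * s ^ n))"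
    using assms(1) by (simp add: coeff_times_z mult_ac)
  also have "\<dots> = s * majorant f s"
    unfolding majorant_def by (rule suminf_mult) (use assms summable_majorant[OF assms(1), of s] in auto)
  finally show ?thesis .
qed

text \<open>Negative s is included so that the two-sided derivative exists at s = 0, where the
  monotonicity arguments start.\<close>

lemma majorant_has_derivative:
  assumes "f holomorphic_on \<D>" "\<bar>s\<bar> < 1"
  shows "(majorant f has_real_derivative majorant (deriv f) s) (at s)"
proof -
  have 1: "summable (\<lambda>n. cmod (coeff0 f n) * ((\<bar>s\<bar> + 1) / 2) ^ n)"
    by (rule summable_majorant) (use assms in auto)
  have "((\<lambda>x. \<Sum>n. cmod (coeff0 f n) * x ^ n) has_real_derivative
      (\<Sum>n. diffs (\<lambda>n. cmod (coeff0 f n)) n * s ^ n)) (at s)"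
    using termdiffs_strong[OF 1] assms(2) by auto
  moreover have "diffs (\<lambda>n. cmod (coeff0 f n)) = (\<lambda>n. cmod (coeff0 (deriv f) n))"
    unfolding coeff_deriv[OF assms(1)] by (simp add: diffs_def norm_mult del: of_nat_Suc)
  ultimately show ?thesis
    by (simp add: majorant_def[abs_def])
qed

lemma majorant_0: "majorant f 0 = cmod (f 0)"
  unfolding majorant_def by (subst powser_zero) (simp add: coeff_0)

text \<open>
  \<open>exp D\<close> solves \<open>y' = D' y\<close>, so the majorant of \<open>exp D\<close> is a subsolution of the same
  equation for the majorants.
\<close>
lemma majorant_exp:
  assumes D: "D holomorphic_on \<D>" "D 0 = 0" and r: "0 \<le> r" "r < 1"
  shows "majorant (\<lambda>z. exp (D z)) r \<le> exp (majorant D r)"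
proof -
  have e: "(\<lambda>z. exp (D z)) holomorphic_on \<D>" by (intro holomorphic_intros D)
  have dD: "deriv D holomorphic_on \<D>" by (intro holomorphic_intros D) auto
  have de: "majorant (deriv (\<lambda>z. exp (D z))) s \<le> majorant (deriv D) s * majorant (\<lambda>z. exp (D z)) s"
    if "0 \<le> s" "s < 1" for s
  proof -
    have "deriv (\<lambda>z. exp (D z)) z = deriv D z * exp (D z)" if "z \<in> \<D>" for z
    proof (rule DERIV_imp_deriv)
      have "(D has_field_derivative deriv D z) (at z)"
        using D(1) that holomorphic_derivI open_ball by blast
      then show "((\<lambda>z. exp (D z)) has_field_derivative deriv D z * exp (D z)) (at z)"
        by (auto intro!: derivative_eq_intros)
    qed
    then have "majorant (deriv (\<lambda>z. exp (D z))) s = majorant (\<lambda>z. deriv D z * exp (D z)) s"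
      by (rule majorant_cong)
    also have "\<dots> \<le> majorant (deriv D) s * majorant (\<lambda>z. exp (D z)) s"
      using dD e that by (rule majorant_mult)
    finally show ?thesis .
  qed
  have "majorant (\<lambda>z. exp (D z)) r * exp (- majorant D r) \<le>
      majorant (\<lambda>z. exp (D z)) 0 * exp (- majorant D 0)"
  proof (rule DERIV_nonpos_imp_nonincreasing[OF r(1)])
    fix s assume s: "0 \<le> s" "s \<le> r"
    have *: "((\<lambda>s. majorant (\<lambda>z. exp (D z)) s * exp (- majorant D s)) has_real_derivative
       (majorant (deriv (\<lambda>z. exp (D z))) s - majorant (deriv D) s * majorant (\<lambda>z. exp (D z)) s)
         * exp (- majorant D s)) (at s)"
      using s r by (auto intro!: derivative_eq_intros majorant_has_derivative[OF e] majorant_has_derivative[OF D(1)]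
          simp: algebra_simps)
    have "(majorant (deriv (\<lambda>z. exp (D z))) s - majorant (deriv D) s * majorant (\<lambda>z. exp (D z)) s)
         * exp (- majorant D s) \<le> 0"
      using de[of s] s r by (intro mult_nonpos_nonneg) auto
    with * show "\<exists>y. ((\<lambda>s. majorant (\<lambda>z. exp (D z)) s * exp (- majorant D s)) has_real_derivative y) (at s) \<and> y \<le> 0"
      by blast
  qed
  then show ?thesis
    by (simp add: majorant_0 D(2) exp_minus field_simps)
qed

text \<open>The sum can stop at n because w^i vanishes to order i at 0.\<close>

lemma coeff_compose:
  assumes "f holomorphic_on \<D>" "w holomorphic_on \<D>" "w 0 = 0"
  shows "coeff0 (\<lambda>z. f (w z)) n = (\<Sum>i\<le>n. coeff0 f i * coeff0 (\<lambda>z. w z ^ i) n)"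
proof -
  have "(f \<circ> w) has_fps_expansion (fps_expansion f 0 oo fps_expansion w 0)"
    by (rule has_fps_expansion_compose[OF fps_expansion_disk fps_expansion_disk])
      (use assms in \<open>auto simp: coeff_0\<close>)
  moreover have "fps_expansion (\<lambda>z. w z ^ i) 0 = fps_expansion w 0 ^ i" for i
    by (intro fps_expansion_eqI fps_expansion_intros fps_expansion_disk assms)
  ultimately show ?thesis
    using fps_expansion_eqI[of "f \<circ> w"] by (simp add: o_def fps_compose_nth atLeast0AtMost)
qed

text \<open>A mean value estimate for powers on the level of majorants, by the splitting u (u^i -
  v^i) + (u - v) v^i. The bounds for the powers themselves are carried along because the induction
  step uses the one for v^i.\<close>

lemma majorant_power_diff:
  assumes hol: "u holomorphic_on \<D>" "v holomorphic_on \<D>" and s: "0 \<le> s" "s < 1"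
    and le: "majorant u s \<le> s" "majorant v s \<le> s" and d: "majorant (\<lambda>z. u z - v z) s \<le> d"
  shows "majorant (\<lambda>z. u z ^ i) s \<le> s ^ i \<and> majorant (\<lambda>z. v z ^ i) s \<le> s ^ i \<and>
     majorant (\<lambda>z. u z ^ i - v z ^ i) s \<le> of_nat i * s ^ (i - 1) * d"
proof (induction i)
  case 0
  have "majorant (\<lambda>z. 1) s = 1" "majorant (\<lambda>z. 0) s = 0"
    unfolding majorant_def coeff_const by (subst suminf_finite[of "{0}"]; simp)+
  then show ?case by simp
next
  case (Suc i)
  note h = hol s
  have 1: "majorant (\<lambda>z. u z ^ Suc i) s \<le> s ^ Suc i" if "u holomorphic_on \<D>" "majorant u s \<le> s" 
    "majorant (\<lambda>z. u z ^ i) s \<le> s ^ i" for u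
  proof -
    have "majorant (\<lambda>z. u z * u z ^ i) s \<le> majorant u s * majorant (\<lambda>z. u z ^ i) s"
      using that s by (intro majorant_mult holomorphic_intros)
    also have "\<dots> \<le> s * s ^ i"
      using that s by (intro mult_mono majorant_nonneg holomorphic_intros) auto
    finally show ?thesis by simp
  qed
  have d0: "0 \<le> d"
    using majorant_nonneg[OF holomorphic_on_diff[OF hol(1,2)] s] d by linarith
  have "majorant (\<lambda>z. u z ^ Suc i - v z ^ Suc i) s
      = majorant (\<lambda>z. u z * (u z ^ i - v z ^ i) + (u z - v z) * v z ^ i) s"
    by (simp add: algebra_simps)
  also have "\<dots> \<le> majorant (\<lambda>z. u z * (u z ^ i - v z ^ i)) s + majorant (\<lambda>z. (u z - v z) * v z ^ i) s"
    using h by (intro majorant_add holomorphic_intros)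
  also have "\<dots> \<le> majorant u s * majorant (\<lambda>z. u z ^ i - v z ^ i) s + majorant (\<lambda>z. u z - v z) s * majorant (\<lambda>z. v z ^ i) s"
    using h by (intro add_mono majorant_mult holomorphic_intros)
  also have "\<dots> \<le> s * (of_nat i * s ^ (i - 1) * d) + d * s ^ i"
    using h Suc le d d0 by (intro add_mono mult_mono majorant_nonneg holomorphic_intros) auto
  \<comment> \<open>The exponent i - 1 is truncated at i = 0, where its factor i is 0; hence the
    case distinction.\<close>
  also have "\<dots> = of_nat (Suc i) * s ^ (Suc i - 1) * d"
    by (cases i) (auto simp: algebra_simps)
  finally show ?case using 1[OF h(1) le(1)] 1[OF h(2) le(2)] Suc by auto
qed

text \<open>The mean value inequality for f(u) - f(v) in terms of majorants: termwise, the
  difference is the sum of f_i (u^i - v^i). Working with partial sums keeps every interchange of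
  summation finite.\<close>

lemma majorant_compose_diff:
  assumes hol: "f holomorphic_on \<D>" "u holomorphic_on \<D>" "v holomorphic_on \<D>"
    and z: "u 0 = 0" "v 0 = 0" and img: "u ` \<D> \<subseteq> \<D>" "v ` \<D> \<subseteq> \<D>"
    and s: "0 \<le> s" "s < 1"
    and le: "majorant u s \<le> s" "majorant v s \<le> s" and d: "majorant (\<lambda>z. u z - v z) s \<le> d"
  shows "majorant (\<lambda>z. f (u z) - f (v z)) s \<le> majorant (deriv f) s * d"
proof (rule majorant_leI)
  fix N
  define e where "e i = (\<lambda>z. u z ^ i - v z ^ i)" for i :: nat
  have he: "e i holomorphic_on \<D>" for i unfolding e_def by (intro holomorphic_intros hol)
  have c: "coeff0 (\<lambda>z. f (u z) - f (v z)) n = (\<Sum>i\<le>n. coeff0 f i * coeff0 (e i) n)" for n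
  proof -
    have "(\<lambda>z. f (u z)) holomorphic_on \<D>" "(\<lambda>z. f (v z)) holomorphic_on \<D>"
      using holomorphic_on_compose_gen[OF hol(2) hol(1) img(1)]
        holomorphic_on_compose_gen[OF hol(3) hol(1) img(2)] by (auto simp: o_def)
    then show ?thesis
      unfolding e_def using hol z
      by (simp add: coeff_diff coeff_compose holomorphic_on_power sum_subtractf right_diff_distrib)
  qed
  have d0: "0 \<le> d"
    using majorant_nonneg[OF holomorphic_on_diff[OF hol(2,3)] s] d by linarith
  have "(\<Sum>n<N. cmod (coeff0 (\<lambda>z. f (u z) - f (v z)) n) * s ^ n)
      \<le> (\<Sum>n<N. (\<Sum>i<N. cmod (coeff0 f i) * cmod (coeff0 (e i) n)) * s ^ n)"
  proof (intro sum_mono mult_right_mono)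
    fix n assume n: "n \<in> {..<N}"
    have "cmod (coeff0 (\<lambda>z. f (u z) - f (v z)) n) \<le> (\<Sum>i\<le>n. cmod (coeff0 f i * coeff0 (e i) n))"
      unfolding c by (rule norm_sum)
    also have "\<dots> \<le> (\<Sum>i<N. cmod (coeff0 f i * coeff0 (e i) n))"
      using n by (intro sum_mono2) auto
    finally show "cmod (coeff0 (\<lambda>z. f (u z) - f (v z)) n) \<le> (\<Sum>i<N. cmod (coeff0 f i) * cmod (coeff0 (e i) n))"
      by (simp add: norm_mult)
  qed (use s in auto)
  also have "\<dots> = (\<Sum>i<N. cmod (coeff0 f i) * (\<Sum>n<N. cmod (coeff0 (e i) n) * s ^ n))"
    unfolding sum_distrib_right sum_distrib_left by (subst sum.swap) (simp add: mult.assoc)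
  also have "\<dots> \<le> (\<Sum>i<N. cmod (coeff0 f i) * (of_nat i * s ^ (i - 1) * d))"
  proof (intro sum_mono mult_left_mono)
    fix i
    have "(\<Sum>n<N. cmod (coeff0 (e i) n) * s ^ n) \<le> majorant (e i) s"
      using he s by (intro sum_le_majorant)
    also have "\<dots> \<le> of_nat i * s ^ (i - 1) * d"
      using majorant_power_diff[OF hol(2,3) s le d, of i] by (simp add: e_def)
    finally show "(\<Sum>n<N. cmod (coeff0 (e i) n) * s ^ n) \<le> of_nat i * s ^ (i - 1) * d" .
  qed auto
  also have "\<dots> = (\<Sum>i<N. cmod (coeff0 f i) * (of_nat i * s ^ (i - 1))) * d"
    by (simp add: sum_distrib_right mult.assoc)
  also have "\<dots> \<le> majorant (deriv f) s * d"
  proof (rule mult_right_mono[OF _ d0])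
    \<comment> \<open>One more term on the right, so that the index shift of the derivative leaves
      exactly N terms.\<close>
    have "(\<Sum>i<N. cmod (coeff0 f i) * (of_nat i * s ^ (i - 1)))
      \<le> (\<Sum>i<Suc N. cmod (coeff0 f i) * (of_nat i * s ^ (i - 1)))"
      using s by (intro sum_mono2) auto
    also have "\<dots> = (\<Sum>i<N. cmod (coeff0 (deriv f) i) * s ^ i)"
      by (subst sum.lessThan_Suc_shift) (simp add: coeff_deriv[OF hol(1)] norm_mult mult_ac del: of_nat_Suc)
    also have "\<dots> \<le> majorant (deriv f) s"
      by (rule sum_le_majorant) (use hol s in \<open>auto intro!: holomorphic_intros\<close>)
    finally show "(\<Sum>i<N. cmod (coeff0 f i) * (of_nat i * s ^ (i - 1))) \<le> majorant (deriv f) s" .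
  qed
  finally show "(\<Sum>n<N. cmod (coeff0 (\<lambda>z. f (u z) - f (v z)) n) * s ^ n) \<le> majorant (deriv f) s * d" .
qed (use s in auto)

section \<open>Positive real part and bounded functions\<close>

text \<open>Caratheodory's inequality, read off Fourier coefficients: on the circle of radius r, cnj
  h contributes nothing to the frequency n > 0, so h may be replaced by h + cnj h = 2 Re h. Hence
  |h_n| r^n is at most the mean of 2 Re h, which is 2 Re (h 0).\<close>

lemma caratheodory_coeff:
  assumes h: "h holomorphic_on \<D>" and re: "\<And>z. z \<in> \<D> \<Longrightarrow> 0 \<le> Re (h z)" and n: "0 < n"
  shows "cmod (coeff0 h n) \<le> 2 * Re (h 0)"
proof -
  have main: "cmod (coeff0 h n) * r ^ n \<le> 2 * Re (h 0)" if r: "0 < r" "r < 1" for r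
  proof -
    define c where "c t = of_real r * exp (2 * of_real pi * \<i> * of_real t)" for t :: real
    have nc: "cmod (c t) = r" for t using r by (simp add: c_def norm_mult norm_exp_eq_Re)
    have c0: "c t \<noteq> 0" for t using r by (simp add: c_def)
    have cD: "c t \<in> \<D>" for t using nc r by simp
    have cb: "cball 0 r \<subseteq> \<D>" using r by auto
    have par: "((\<lambda>t. F (c t) * c t) has_integral i / (2 * pi * \<i>)) {0..1}"
      if "(F has_contour_integral i) (circlepath 0 r)" for F i
    proof -
      have "((\<lambda>t. F (circlepath 0 r t) * vector_derivative (circlepath 0 r) (at t within {0..1}))
          has_integral i) {0..1}"
        using that by (simp add: has_contour_integral_def)
      then have "((\<lambda>t. F (c t) * c t * (2 * pi * \<i>)) has_integral i) {0..1}"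
      proof (rule has_integral_eq[rotated])
        fix t :: real assume "t \<in> {0..1}"
        then show "F (circlepath 0 r t) * vector_derivative (circlepath 0 r) (at t within {0..1})
            = F (c t) * c t * (2 * pi * \<i>)"
          by (subst vector_derivative_circlepath01) (auto simp: circlepath c_def)
      qed
      from has_integral_mult_left[OF this, of "1 / (2 * pi * \<i>)"] show ?thesis
        by simp
    qed
    have coef: "((\<lambda>t. h (c t) / c t ^ m) has_integral coeff0 h m) {0..1}" for m
    proof -
      have "((\<lambda>u. h u / (u - 0) ^ Suc m) has_contour_integral
          (2 * pi * \<i>) / fact m * (deriv ^^ m) h 0) (circlepath 0 r)"
        by (rule Cauchy_has_contour_integral_higher_derivative_circlepath)
          (use h cb r in \<open>auto intro: holomorphic_on_imp_continuous_on holomorphic_on_subset\<close>)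
      from par[OF this] show ?thesis
        using c0 by (simp add: fps_expansion_def)
    qed
    \<comment> \<open>Cauchy's theorem; its conjugate is the vanishing Fourier coefficient of cnj
      h.\<close>
    have "((\<lambda>u. h u * u ^ (n - 1)) has_contour_integral 0) (circlepath 0 r)"
      by (rule Cauchy_theorem_convex_simple[of _ \<D>])
        (use h r in \<open>auto intro!: holomorphic_intros\<close>)
    from par[OF this] have "((\<lambda>t. h (c t) * c t ^ n) has_integral 0) {0..1}"
      using n by (simp add: mult.assoc flip: power_Suc2)
    then have J: "((\<lambda>t. cnj (h (c t) * c t ^ n)) has_integral cnj 0) {0..1}"
      using has_integral_linear[OF _ bounded_linear_cnj, unfolded o_def] by blast
    \<comment> \<open>On the circle the conjugate of c t is r^2 / c t, which moves the power of c t
      into the denominator.\<close>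
    have eq: "cnj (h (c t) * c t ^ n) * (1 / of_real r ^ (2 * n)) = cnj (h (c t)) / c t ^ n" for t
    proof -
      have "cnj (c t) * c t = of_real (r ^ 2)"
        using complex_norm_square[of "c t"] nc[of t] by (simp add: mult.commute)
      then have "cnj (c t) = of_real (r ^ 2) / c t" using c0[of t] by (simp add: field_simps)
      then show ?thesis
        using r c0[of t] by (simp add: power_divide power_mult)
    qed
    have "((\<lambda>t. cnj (h (c t)) / c t ^ n) has_integral 0) {0..1}"
      using has_integral_mult_left[OF J, of "1 / of_real r ^ (2 * n)"] unfolding eq by simp
    from has_integral_add[OF coef[of n] this]
    have I1: "((\<lambda>t. of_real (2 * Re (h (c t))) / c t ^ n) has_integral coeff0 h n) {0..1}"
      by (simp add: complex_add_cnj flip: add_divide_distrib)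
    have "((\<lambda>t. Re (h (c t) / c t ^ 0)) has_integral Re (coeff0 h 0)) {0..1}"
      by (rule has_integral_Re[OF coef])
    from has_integral_mult_left[OF this, of "2 / r ^ n"]
    have I2: "((\<lambda>t. 2 * Re (h (c t)) / r ^ n) has_integral 2 * Re (h 0) / r ^ n) {0..1}"
      by (simp add: coeff_0 mult_ac)
    have "norm (integral {0..1} (\<lambda>t. of_real (2 * Re (h (c t))) / c t ^ n))
        \<le> integral {0..1} (\<lambda>t. 2 * Re (h (c t)) / r ^ n)"
      by (rule integral_norm_bound_integral)
        (use I1 I2 re cD nc in \<open>auto simp: norm_divide norm_mult norm_power\<close>)
    then show ?thesis
      unfolding integral_unique[OF I1] integral_unique[OF I2] using r by (simp add: field_simps)
  qed
  have "((\<lambda>r. cmod (coeff0 h n) * r ^ n) \<longlongrightarrow> cmod (coeff0 h n) * 1 ^ n) (at_left 1)"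
    by (intro tendsto_intros)
  moreover have "\<forall>\<^sub>F r in at_left (1::real). cmod (coeff0 h n) * r ^ n \<le> 2 * Re (h 0)"
    using eventually_at_left_real[of 0 1] by (auto elim!: eventually_mono intro: main)
  ultimately have "cmod (coeff0 h n) * 1 ^ n \<le> 2 * Re (h 0)"
    by (rule tendsto_upperbound) simp
  then show ?thesis by simp
qed

lemma unimodular_rotation:
  obtains u :: complex where "cmod u = 1" "u * x = of_real (cmod x)"
proof (cases "x = 0")
  case True
  then show ?thesis using that[of 1] by simp
next
  case False
  then show ?thesis
    using that[of "cnj x / cmod x"] complex_norm_square[of x]
    by (auto simp: norm_divide field_simps power2_eq_square)
qed

text \<open>Caratheodory's inequality for c - u \<phi>, where u rotates \<phi> 0 onto the
  nonnegative axis. For c = 1 the sharp bound is 1 - |\<phi> 0|^2; the bound here is linear in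
  |\<phi> 0|, the form in which the factor 1 - a enters later.\<close>

lemma bounded_coeff:
  assumes \<phi>: "\<phi> holomorphic_on \<D>" "\<And>z. z \<in> \<D> \<Longrightarrow> cmod (\<phi> z) \<le> c" and n: "0 < n"
  shows "cmod (coeff0 \<phi> n) \<le> 2 * (c - cmod (\<phi> 0))"
proof -
  obtain u where u: "cmod u = 1" "u * \<phi> 0 = of_real (cmod (\<phi> 0))"
    by (rule unimodular_rotation)
  define h where "h z = of_real c - u * \<phi> z" for z
  have "cmod (coeff0 h n) \<le> 2 * Re (h 0)"
  proof (rule caratheodory_coeff[OF _ _ n])
    show "h holomorphic_on \<D>" unfolding h_def by (intro holomorphic_intros \<phi>)
    fix z assume "z \<in> \<D>"
    then have "Re (u * \<phi> z) \<le> c"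
      using \<phi>(2)[of z] u(1) complex_Re_le_cmod[of "u * \<phi> z"] by (simp add: norm_mult)
    then show "0 \<le> Re (h z)" by (simp add: h_def)
  qed
  moreover have "coeff0 h n = - u * coeff0 \<phi> n"
    unfolding h_def using \<phi>(1) n by (simp add: coeff_diff coeff_cmult coeff_const holomorphic_on_mult)
  ultimately show ?thesis
    using u by (simp add: norm_mult h_def)
qed

lemma majorant_minus_const_le:
  assumes \<phi>: "\<phi> holomorphic_on \<D>" "\<And>z. z \<in> \<D> \<Longrightarrow> cmod (\<phi> z) \<le> c" and s: "0 \<le> s" "s < 1"
  shows "majorant (\<lambda>z. \<phi> z - \<phi> 0) s \<le> 2 * (c - cmod (\<phi> 0)) * (s / (1 - s))"
proof -
  let ?h = "\<lambda>z. \<phi> z - \<phi> 0"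
  have hol: "?h holomorphic_on \<D>" by (intro holomorphic_intros \<phi>)
  have sm: "summable (\<lambda>n. cmod (coeff0 ?h n) * s ^ n)"
    by (rule summable_majorant[OF hol]) (use s in auto)
  have g: "(\<lambda>n. 2 * (c - cmod (\<phi> 0)) * s * s ^ n) sums (2 * (c - cmod (\<phi> 0)) * s * (1 / (1 - s)))"
    using s by (intro sums_mult geometric_sums) auto
  have "majorant ?h s = (\<Sum>n. cmod (coeff0 ?h (Suc n)) * s ^ Suc n)"
    unfolding majorant_def using suminf_split_head[OF sm] by (simp add: coeff_0)
  also have "\<dots> \<le> (\<Sum>n. 2 * (c - cmod (\<phi> 0)) * s * s ^ n)"
  proof (rule suminf_le)
    fix n
    have "cmod (coeff0 ?h (Suc n)) \<le> 2 * (c - cmod (\<phi> 0))"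
      using bounded_coeff[OF \<phi>, of "Suc n"] \<phi>(1) by (simp add: coeff_diff coeff_const)
    then show "cmod (coeff0 ?h (Suc n)) * s ^ Suc n \<le> 2 * (c - cmod (\<phi> 0)) * s * s ^ n"
      using mult_right_mono[of _ _ "s ^ Suc n"] s by (simp add: mult.assoc)
  next
    show "summable (\<lambda>n. cmod (coeff0 ?h (Suc n)) * s ^ Suc n)"
      using sm by (subst summable_Suc_iff)
  qed (use g in \<open>simp add: sums_iff\<close>)
  finally show ?thesis using g by (simp add: sums_iff)
qed

lemma majorant_const: "majorant (\<lambda>z. c) s = cmod c"
  unfolding majorant_def coeff_const by (subst suminf_finite[of "{0}"]) auto

text \<open>Bohr's theorem. At s = 1/3 the ratio s / (1 - s) is 1/2, so the tail contributes at most
  the defect c - |\<phi> 0|.\<close>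

lemma bohr_bounded:
  assumes \<phi>: "\<phi> holomorphic_on \<D>" "\<And>z. z \<in> \<D> \<Longrightarrow> cmod (\<phi> z) \<le> c" and s: "0 \<le> s" "s \<le> 1/3"
  shows "majorant \<phi> s \<le> c"
proof -
  have "majorant \<phi> s = majorant (\<lambda>z. (\<phi> z - \<phi> 0) + \<phi> 0) s" by simp
  also have "\<dots> \<le> majorant (\<lambda>z. \<phi> z - \<phi> 0) s + majorant (\<lambda>z. \<phi> 0) s"
    by (rule majorant_add) (use s \<phi> in \<open>auto intro!: holomorphic_intros\<close>)
  also have "\<dots> \<le> 2 * (c - cmod (\<phi> 0)) * (s / (1 - s)) + cmod (\<phi> 0)"
    using majorant_minus_const_le[OF \<phi>] s by (simp add: majorant_const)
  also have "\<dots> \<le> 2 * (c - cmod (\<phi> 0)) * (1 / 2) + cmod (\<phi> 0)"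
    using s \<phi>(2)[of 0] by (intro add_mono mult_left_mono) (auto simp: field_simps)
  also have "\<dots> = c" by (simp add: field_simps)
  finally show ?thesis .
qed

text \<open>The Cayley transform (h - h 0) / (h + cnj (h 0)) maps into the disk and vanishes at 0,
  so the Schwarz lemma applies. This takes a strictly positive real part, hence the shift by e at
  the end.\<close>

lemma harnack:
  assumes h: "h holomorphic_on \<D>" and re: "\<And>z. z \<in> \<D> \<Longrightarrow> 0 \<le> Re (h z)" and z: "z \<in> \<D>"
  shows "Re (h 0) * ((1 - cmod z) / (1 + cmod z)) \<le> Re (h z)"
proof -
  have main: "Re (h 0) * ((1 - cmod z) / (1 + cmod z)) \<le> Re (h z)"
    if h: "h holomorphic_on \<D>" and re: "\<And>z. z \<in> \<D> \<Longrightarrow> 0 < Re (h z)" for h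
  proof -
    define c where "c = h 0"
    have c: "0 < Re c" using re[of 0] by (simp add: c_def)
    define s where "s z = (h z - c) / (h z + cnj c)" for z
    have nz: "h z + cnj c \<noteq> 0" if "z \<in> \<D>" for z
      using re[OF that] c by (auto simp: complex_eq_iff)
    have "cmod (s z) \<le> cmod z"
    proof (rule Schwarz_Lemma)
      show "s holomorphic_on \<D>"
        unfolding s_def using nz by (auto intro!: holomorphic_intros h)
      show "s 0 = 0" by (simp add: s_def c_def)
      fix z :: complex assume "cmod z < 1"
      then have z: "z \<in> \<D>" by simp
      have "(cmod (h z - c))\<^sup>2 < (cmod (h z + cnj c))\<^sup>2"
        using mult_pos_pos[OF re[OF z] c] unfolding cmod_power2
        by (simp add: power2_eq_square algebra_simps)
      then have "cmod (h z - c) < cmod (h z + cnj c)"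
        by (rule power2_less_imp_less) simp
      then show "cmod (s z) < 1"
        using nz[OF z] by (simp add: s_def norm_divide)
    qed (use z in auto)
    then have "cmod (h z - c) \<le> cmod z * cmod (h z + cnj c)"
      using nz[OF z] by (simp add: s_def norm_divide field_simps)
    then have "(cmod (h z - c))\<^sup>2 \<le> (cmod z * cmod (h z + cnj c))\<^sup>2"
      by (intro power_mono) auto
    then have *: "(Re (h z) - Re c)\<^sup>2 + (Im (h z) - Im c)\<^sup>2 \<le>
        (cmod z)\<^sup>2 * ((Re (h z) + Re c)\<^sup>2 + (Im (h z) - Im c)\<^sup>2)"
      unfolding power_mult_distrib cmod_power2 by simp
    \<comment> \<open>Numerator and denominator have the same imaginary part, so |z| < 1 lets it
      drop out in favour of the real parts.\<close>
    have "(cmod z)\<^sup>2 * (Im (h z) - Im c)\<^sup>2 \<le> 1 * (Im (h z) - Im c)\<^sup>2"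
      using z by (intro mult_right_mono) (auto simp: power_le_one)
    with * have "(Re (h z) - Re c)\<^sup>2 \<le> (cmod z * (Re (h z) + Re c))\<^sup>2"
      unfolding power_mult_distrib distrib_left[of "(cmod z)\<^sup>2"] by linarith
    then have "\<bar>Re (h z) - Re c\<bar> \<le> cmod z * (Re (h z) + Re c)"
      using re[OF z] c by (simp add: abs_le_square_iff abs_mult flip: abs_le_square_iff)
    then have "Re c * (1 - cmod z) \<le> Re (h z) * (1 + cmod z)"
      by (simp add: algebra_simps)
    moreover have "0 < 1 + cmod z" by (simp add: add_pos_nonneg)
    ultimately show ?thesis by (simp add: c_def field_simps)
  qed
  define q where "q = (1 - cmod z) / (1 + cmod z)"
  have q: "0 \<le> q" using z by (simp add: q_def)
  show ?thesis
  proof (rule field_le_epsilon)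
    fix e :: real assume e: "0 < e"
    have "Re (h 0 + of_real e) * q \<le> Re (h z + of_real e)"
      unfolding q_def using re e by (intro main holomorphic_intros h) (simp add: add_nonneg_pos)
    moreover have "Re (h 0) * q \<le> Re (h 0 + of_real e) * q"
      using q e by (intro mult_right_mono) auto
    ultimately show "Re (h 0) * ((1 - cmod z) / (1 + cmod z)) \<le> Re (h z) + e"
      unfolding q_def by simp
  qed
qed

text \<open>The Schwarz-Pick inequality for the half-plane: a disk automorphism carrying 0 to x has
  derivative 1 - x^2 at 0, and Caratheodory's inequality bounds the first coefficient of the
  composition.\<close>

lemma deriv_positive_real_part:
  assumes P: "P holomorphic_on \<D>" and re: "\<And>z. z \<in> \<D> \<Longrightarrow> 0 \<le> Re (P z)" and x: "\<bar>x\<bar> < 1"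
  shows "cmod (deriv P (of_real x)) * (1 - x\<^sup>2) \<le> 2 * Re (P (of_real x))"
proof -
  define m where "m = Moebius_function 0 (- of_real x)"
  have x': "cmod (- of_real x) < 1" using x by simp
  have m: "m holomorphic_on \<D>" "m ` \<D> \<subseteq> \<D>" "m 0 = of_real x"
    using Moebius_function_holomorphic[OF x', of 0] Moebius_function_norm_lt_1[OF x', of _ 0]
    by (auto simp: m_def Moebius_function_of_zero)
  have hol: "(\<lambda>z. P (m z)) holomorphic_on \<D>"
    using holomorphic_on_compose_gen[OF m(1) P m(2)] by (simp add: o_def)
  have m': "m = (\<lambda>z. (z + of_real x) / (1 + of_real x * z))"
    by (simp add: m_def Moebius_function_def fun_eq_iff)
  have "(m has_field_derivative (1 - (of_real x)\<^sup>2)) (at 0)"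
    unfolding m' by (auto intro!: derivative_eq_intros simp: power2_eq_square)
  moreover have "(P has_field_derivative deriv P (of_real x)) (at (m 0))"
    using P x m(3) by (auto intro!: holomorphic_derivI[of P \<D>])
  ultimately have "((\<lambda>z. P (m z)) has_field_derivative deriv P (of_real x) * (1 - (of_real x)\<^sup>2)) (at 0)"
    by (rule DERIV_chain2[rotated])
  then have "deriv (\<lambda>z. P (m z)) 0 = deriv P (of_real x) * (1 - (of_real x)\<^sup>2)"
    by (rule DERIV_imp_deriv)
  moreover have "cmod (coeff0 (\<lambda>z. P (m z)) 1) \<le> 2 * Re (P (m 0))"
    by (rule caratheodory_coeff[OF hol]) (use re m(2) in \<open>auto simp: image_subset_iff\<close>)
  moreover have "cmod (1 - (of_real x)\<^sup>2) = 1 - x\<^sup>2"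
  proof -
    have "x\<^sup>2 < 1" using x by (simp add: abs_square_less_1)
    then have "cmod (of_real (1 - x\<^sup>2)) = 1 - x\<^sup>2" by (simp only: norm_of_real)
    then show ?thesis by simp
  qed
  ultimately show ?thesis
    by (simp add: coeff_1 m(3) norm_mult)
qed

section \<open>Schwarz functions\<close>

lemma schwarz_functionD:
  assumes "schwarz_function w"
  shows "w holomorphic_on \<D>" "w 0 = 0" "z \<in> \<D> \<Longrightarrow> w z \<in> \<D>" "cmod z < 1 \<Longrightarrow> cmod (w z) < 1"
  using assms unfolding schwarz_function_def by (auto simp: image_subset_iff)

lemma schwarz_rigid:
  assumes w: "schwarz_function w" and d: "deriv w 0 = 1" and z: "z \<in> \<D>"
  shows "w z = z"
proof -
  obtain \<alpha> where \<alpha>: "\<And>z. cmod z < 1 \<Longrightarrow> w z = \<alpha> * z"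
    using Schwarz_Lemma(3)[OF schwarz_functionD(1,2,4)[OF w], of 0] d by auto
  have "((\<lambda>z. \<alpha> * z) has_field_derivative \<alpha>) (at 0)"
    by (auto intro!: derivative_eq_intros)
  then have "(w has_field_derivative \<alpha>) (at 0)"
    by (rule has_field_derivative_transform_within_open[of _ _ _ \<D>]) (use \<alpha> in auto)
  then have "\<alpha> = 1" using d by (simp add: DERIV_imp_deriv)
  then show ?thesis using \<alpha>[of z] z by simp
qed

lemma schwarz_factor:
  assumes "schwarz_function w"
  obtains \<phi> where "\<phi> holomorphic_on \<D>" "\<And>z. z \<in> \<D> \<Longrightarrow> w z = z * \<phi> z" "\<phi> 0 = deriv w 0"
    "\<And>z. z \<in> \<D> \<Longrightarrow> cmod (\<phi> z) \<le> 1"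
proof -
  note w = schwarz_functionD(1,2,4)[OF assms]
  obtain \<phi> where \<phi>: "\<phi> holomorphic_on \<D>" "\<And>z. cmod z < 1 \<Longrightarrow> w z = z * \<phi> z" "deriv w 0 = \<phi> 0"
    using Schwarz3[OF w(1,2)] by blast
  have "cmod (\<phi> z) \<le> 1" if "z \<in> \<D>" for z
  proof (cases "z = 0")
    case True
    then show ?thesis using Schwarz_Lemma(2)[OF w, of 0] \<phi>(3) by simp
  next
    case False
    then show ?thesis
      using Schwarz_Lemma(1)[OF w, of z] \<phi>(2)[of z] that by (simp add: norm_mult)
  qed
  then show thesis using that \<phi> by auto
qed

text \<open>The Schwarz lemma with its defect. Harnack's inequality is applied to 1 - u \<phi> with
  \<phi> = w / z, where u is chosen for the point z itself: Re (u \<phi>) equals |\<phi>| there and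
  is at most |\<phi>| elsewhere, in particular at 0.\<close>

lemma schwarz_bound:
  assumes w: "schwarz_function w" and z: "z \<in> \<D>"
  shows "cmod (w z) \<le> cmod z * (1 - (1 - cmod (deriv w 0)) * ((1 - cmod z) / (1 + cmod z)))"
proof -
  obtain \<phi> where \<phi>: "\<phi> holomorphic_on \<D>" "\<And>z. z \<in> \<D> \<Longrightarrow> w z = z * \<phi> z" "\<phi> 0 = deriv w 0"
    "\<And>z. z \<in> \<D> \<Longrightarrow> cmod (\<phi> z) \<le> 1"
    using schwarz_factor[OF w] by blast
  obtain u where u: "cmod u = 1" "u * \<phi> z = of_real (cmod (\<phi> z))"
    by (rule unimodular_rotation)
  have le: "Re (u * \<phi> y) \<le> cmod (\<phi> y)" for y
    using complex_Re_le_cmod[of "u * \<phi> y"] u by (simp add: norm_mult)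
  have "Re (1 - u * \<phi> 0) * ((1 - cmod z) / (1 + cmod z)) \<le> Re (1 - u * \<phi> z)"
  proof (rule harnack[OF _ _ z])
    show "(\<lambda>z. 1 - u * \<phi> z) holomorphic_on \<D>" by (intro holomorphic_intros \<phi>)
    show "0 \<le> Re (1 - u * \<phi> y)" if "y \<in> \<D>" for y
      using le[of y] \<phi>(4)[OF that] by simp
  qed
  moreover have "(1 - cmod (\<phi> 0)) * ((1 - cmod z) / (1 + cmod z)) \<le>
      Re (1 - u * \<phi> 0) * ((1 - cmod z) / (1 + cmod z))"
    using le[of 0] z by (intro mult_right_mono) auto
  ultimately have "cmod (\<phi> z) \<le> 1 - (1 - cmod (deriv w 0)) * ((1 - cmod z) / (1 + cmod z))"
    using u(2) \<phi>(3) by simp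
  then show ?thesis
    using \<phi>(2)[OF z] by (simp add: norm_mult mult_left_mono)
qed

section \<open>Ma-Minda functions\<close>

lemma Re_has_derivative_along:
  assumes "(f has_field_derivative d) (at (\<gamma> t))" "(\<gamma> has_vector_derivative v) (at t)"
  shows "((\<lambda>t. Re (f (\<gamma> t))) has_real_derivative Re (d * v)) (at t)"
  using bounded_linear.has_vector_derivative[OF bounded_linear_Re
      field_vector_diff_chain_at[OF assms(2,1)]]
  by (simp add: o_def mult.commute has_real_derivative_iff_has_vector_derivative)

lemma Re_has_derivative_real:
  assumes "(f has_field_derivative d) (at (of_real x))"
  shows "((\<lambda>x. Re (f (of_real x))) has_real_derivative Re d) (at x)"
  by (rule Re_has_derivative_along[of f d of_real x 1, simplified, OF assms])
    (auto intro!: derivative_eq_intros simp: has_vector_derivative_def scaleR_conv_of_real)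

lemma koebe_has_derivative:
  fixes x :: real
  assumes "x \<noteq> 1"
  shows "((\<lambda>x. x / (1 - x)\<^sup>2) has_real_derivative (1 + x) / (1 - x) ^ 3) (at x)"
proof -
  have "((\<lambda>x. (1 - x)\<^sup>2) has_real_derivative - 2 * (1 - x)) (at x)"
    by (auto intro!: derivative_eq_intros)
  from DERIV_divide[OF DERIV_ident this]
  have "((\<lambda>x. x / (1 - x)\<^sup>2) has_real_derivative
      (1 * (1 - x)\<^sup>2 - x * (- 2 * (1 - x))) / ((1 - x)\<^sup>2 * (1 - x)\<^sup>2)) (at x)"
    using assms by simp
  moreover have "1 * (1 - x)\<^sup>2 - x * (- 2 * (1 - x)) = (1 - x) * (1 + x)"
    "(1 - x)\<^sup>2 * (1 - x)\<^sup>2 = (1 - x) * (1 - x) ^ 3" by algebra+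
  ultimately show ?thesis using assms by simp
qed

locale ma_minda_function =
  fixes \<psi> :: "complex \<Rightarrow> complex"
  assumes ma_minda: "ma_minda \<psi>"
begin

definition B :: real where "B = Re (deriv \<psi> 0)"

definition Psi :: "complex \<Rightarrow> complex" where "Psi z = \<psi> z - 1"

lemma psi:
  shows hol: "\<psi> holomorphic_on \<D>" and inj: "inj_on \<psi> \<D>" and pos: "z \<in> \<D> \<Longrightarrow> 0 < Re (\<psi> z)"
    and psi_0: "\<psi> 0 = 1" and deriv_psi_0: "deriv \<psi> 0 = of_real B" and B_pos: "0 < B"
    and symmetric: "cnj ` (\<psi> ` \<D>) = \<psi> ` \<D>"
  using ma_minda by (auto simp: ma_minda_def B_def complex_is_Real_iff complex_eq_iff)

lemma hol_Psi: "Psi holomorphic_on \<D>"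
  unfolding Psi_def by (intro holomorphic_intros hol)

lemma Psi_0: "Psi 0 = 0" by (simp add: Psi_def psi_0)

lemma psi_deriv: "z \<in> \<D> \<Longrightarrow> (\<psi> has_field_derivative deriv \<psi> z) (at z)"
  using holomorphic_derivI[OF hol] by auto

lemma deriv_Psi: "z \<in> \<D> \<Longrightarrow> deriv Psi z = deriv \<psi> z"
  unfolding Psi_def by (rule DERIV_imp_deriv) (auto intro!: derivative_eq_intros psi_deriv)

text \<open>
  \<open>\<psi>\<close> and \<open>cnj \<circ> \<psi> \<circ> cnj\<close> map onto the same domain, so they differ by an automorphism of the
  disk that fixes 0 and has derivative 1 there.
\<close>
lemma psi_cnj:
  assumes z: "z \<in> \<D>"
  shows "\<psi> (cnj z) = cnj (\<psi> z)"
proof -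
  obtain g where g: "g holomorphic_on \<psi> ` \<D>" "\<And>z. z \<in> \<D> \<Longrightarrow> deriv \<psi> z * deriv g (\<psi> z) = 1"
    "\<And>z. z \<in> \<D> \<Longrightarrow> g (\<psi> z) = z"
    using holomorphic_has_inverse[OF hol open_ball inj] by blast
  have opn: "open (\<psi> ` \<D>)"
    by (rule open_mapping_thm3[OF hol open_ball inj])
  define c where "c z = cnj (\<psi> (cnj z))" for z
  have cD: "c z \<in> \<psi> ` \<D>" if "z \<in> \<D>" for z
  proof -
    have "cnj z \<in> \<D>" using that by simp
    then have "c z \<in> cnj ` (\<psi> ` \<D>)" unfolding c_def by blast
    then show ?thesis by (simp add: symmetric)
  qed
  have c_deriv: "(c has_field_derivative cnj (deriv \<psi> (cnj z))) (at z)" if "z \<in> \<D>" for z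
  proof -
    have "(\<psi> has_field_derivative deriv \<psi> (cnj z)) (at (cnj z))"
      using that by (intro psi_deriv) simp
    then show ?thesis
      using has_field_derivative_cnj_cnj[of \<psi> "deriv \<psi> (cnj z)" z] by (simp add: c_def[abs_def] o_def)
  qed
  have hc: "c holomorphic_on \<D>"
    using c_deriv holomorphic_on_open[OF open_ball] by blast
  define v where "v z = g (c z)" for z
  have v: "schwarz_function v"
    unfolding schwarz_function_def
  proof (intro conjI subsetI)
    show "v holomorphic_on \<D>"
      unfolding v_def using holomorphic_on_compose_gen[OF hc g(1)] cD by (auto simp: o_def image_subset_iff)
    show "v 0 = 0" using g(3)[of 0] by (simp add: v_def c_def psi_0)
    fix x assume "x \<in> v ` \<D>"
    then obtain z where "z \<in> \<D>" "x = v z" by blast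
    moreover obtain y where "y \<in> \<D>" "c z = \<psi> y" using cD[OF \<open>z \<in> \<D>\<close>] by auto
    ultimately show "x \<in> \<D>" using g(3) by (simp add: v_def)
  qed
  have "deriv v 0 = 1"
  proof (rule DERIV_imp_deriv)
    have "(g has_field_derivative deriv g 1) (at (c 0))"
      using holomorphic_derivI[OF g(1) opn, of 1] psi_0 by (auto simp: c_def intro!: image_eqI[of _ _ 0])
    moreover have "(c has_field_derivative of_real B) (at 0)"
      using c_deriv[of 0] by (simp add: deriv_psi_0)
    ultimately have "((\<lambda>z. g (c z)) has_field_derivative deriv g 1 * of_real B) (at 0)"
      by (rule DERIV_chain2)
    moreover have "deriv g 1 * of_real B = 1"
      using g(2)[of 0] by (simp add: psi_0 deriv_psi_0 mult.commute)
    ultimately show "(v has_field_derivative 1) (at 0)" by (simp add: v_def[abs_def])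
  qed
  then have "v (cnj z) = cnj z" using schwarz_rigid[OF v] z by simp
  moreover obtain y where "y \<in> \<D>" "c (cnj z) = \<psi> y" using cD[of "cnj z"] z by auto
  ultimately show ?thesis using g(3)[of y] by (simp add: v_def c_def)
qed

section \<open>\<open>Psi\<close> as a typically real function\<close>

lemma real_of_psi_real:
  assumes "z \<in> \<D>" "Im (\<psi> z) = 0"
  shows "Im z = 0"
proof -
  have "\<psi> (cnj z) = \<psi> z" using assms psi_cnj[of z] by (simp add: complex_eq_iff)
  then have "cnj z = z" using inj assms(1) by (auto simp: inj_on_def)
  then show ?thesis by (simp add: complex_eq_iff)
qed

text \<open>Im \<psi> has no zero on the upper half disk, which is connected, and it is positive on
  the imaginary axis just above 0 because \<psi>'(0) = B > 0.\<close>

lemma Im_psi_pos: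
  assumes z: "z \<in> \<D>" "0 < Im z"
  shows "0 < Im (\<psi> z)"
proof (rule ccontr)
  assume "\<not> 0 < Im (\<psi> z)"
  have "((\<lambda>t. Re (- \<i> * \<psi> (\<i> * of_real t))) has_real_derivative Re (- \<i> * of_real B * \<i>)) (at 0)"
  proof (rule Re_has_derivative_along[where f = "\<lambda>z. - \<i> * \<psi> z"])
    show "((\<lambda>z. - \<i> * \<psi> z) has_field_derivative - \<i> * of_real B) (at (\<i> * of_real 0))"
      using psi_deriv[of 0] by (auto intro!: derivative_eq_intros simp: deriv_psi_0)
    show "((\<lambda>t. \<i> * of_real t) has_vector_derivative \<i>) (at (0::real))"
      by (auto intro!: derivative_eq_intros simp: has_vector_derivative_def scaleR_conv_of_real mult.commute)
  qed
  then have "((\<lambda>t. Im (\<psi> (\<i> * of_real t))) has_real_derivative B) (at 0)" by simp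
  from DERIV_pos_inc_right[OF this B_pos] obtain d where d: "0 < d" "\<And>h. 0 < h \<Longrightarrow> h < d \<Longrightarrow> 0 < Im (\<psi> (\<i> * of_real h))"
    by (auto simp: psi_0)
  define h where "h = min (d / 2) (1 / 2)"
  define y where "y = \<i> * of_real h"
  have h: "0 < h" "h < d" "h < 1" using d by (auto simp: h_def)
  have y: "y \<in> \<D>" "0 < Im y" "0 < Im (\<psi> y)" using h d(2)[of h] by (auto simp: y_def norm_mult)
  let ?U = "\<D> \<inter> {z. 0 < Im z}"
  have "connected ((\<lambda>z. Im (\<psi> z)) ` ?U)"
    by (intro connected_continuous_image continuous_intros convex_connected convex_Int convex_ball convex_halfspace_Im_gt
        holomorphic_on_imp_continuous_on holomorphic_on_subset[OF hol]) auto
  moreover have "Im (\<psi> z) \<in> (\<lambda>z. Im (\<psi> z)) ` ?U" "Im (\<psi> y) \<in> (\<lambda>z. Im (\<psi> z)) ` ?U"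
    using z y by auto
  ultimately have "0 \<in> (\<lambda>z. Im (\<psi> z)) ` ?U"
    using \<open>\<not> 0 < Im (\<psi> z)\<close> y(3) by (meson connectedD_interval less_imp_le not_less)
  then show False using real_of_psi_real by force
qed

lemma Im_psi_sign:
  assumes z: "z \<in> \<D>"
  shows "0 \<le> Im z * Im (\<psi> z)"
proof -
  have "Im (\<psi> z) = 0" if "Im z = 0"
  proof -
    have "cnj z = z" using that by (simp add: complex_eq_iff)
    then have "cnj (\<psi> z) = \<psi> z" using psi_cnj[OF z] by simp
    then show ?thesis by (simp add: complex_eq_iff)
  qed
  moreover have "Im (\<psi> z) < 0" if "Im z < 0"
    using Im_psi_pos[of "cnj z"] psi_cnj[OF z] z that by simp
  ultimately show ?thesis
    using Im_psi_pos[OF z] by (cases "Im z" "0::real" rule: linorder_cases) (auto simp: zero_le_mult_iff less_imp_le)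
qed

definition Q :: "complex \<Rightarrow> complex" where "Q z = (if z = 0 then deriv Psi 0 else Psi z / z)"

text \<open>Rogosinski's transform: it takes typically real functions to functions of nonnegative
  real part. With B z / (1 - z)^2 in the place of \<open>Psi\<close> it is B (1 + z) / (1 - z), the
  extremal case of the inequalities of Harnack and Caratheodory.\<close>

definition P :: "complex \<Rightarrow> complex" where "P z = (1 - z\<^sup>2) * Q z"

lemma hol_Q: "Q holomorphic_on \<D>"
  by (rule pole_theorem_open_0[OF hol_Psi, of 0]) (auto simp: Q_def Psi_0)

lemma Psi_Q: "Psi z = z * Q z" by (simp add: Q_def Psi_0)

lemma hol_P: "P holomorphic_on \<D>"
  unfolding P_def by (intro holomorphic_intros hol_Q)

lemma P_0: "P 0 = of_real B" by (simp add: P_def Q_def deriv_Psi deriv_psi_0)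

text \<open>
  On the unit circle \<open>(1 - z\<^sup>2) / z = - 2 \<i> Im z\<close>, so there the real part of \<open>(1 - z\<^sup>2) Psi (R z) / z\<close>
  is \<open>2 Im z Im (Psi (R z))\<close>.
\<close>
lemma Re_P_nonneg:
  assumes z: "z \<in> \<D>"
  shows "0 \<le> Re (P z)"
proof -
  \<comment> \<open>Dilation by R makes the function holomorphic up to the unit circle, where the
    sign of its real part is known; R tends to 1 at the end.\<close>
  have main: "0 \<le> Re ((1 - z\<^sup>2) * Q (of_real R * z))" if R: "0 < R" "R < 1" for R
  proof -
    \<comment> \<open>Negated, since the maximum principle bounds a real part from above.\<close>
    define f where "f y = - ((1 - y\<^sup>2) * Q (of_real R * y))" for y
    have RD: "of_real R * y \<in> \<D>" if "y \<in> cball 0 1" for y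
    proof -
      have "R * cmod y \<le> R * 1" using that R by (intro mult_left_mono) auto
      then have "R * cmod y < 1" using R by linarith
      then show ?thesis using R by (simp add: norm_mult)
    qed
    have holf: "f holomorphic_on cball 0 1"
    proof -
      have "Q \<circ> (\<lambda>y. of_real R * y) holomorphic_on cball 0 1"
        using RD by (intro holomorphic_on_compose_gen[OF _ hol_Q] holomorphic_intros) blast
      then show ?thesis unfolding f_def by (auto intro!: holomorphic_intros simp: o_def)
    qed
    have "Re (f z) \<le> 0"
    proof (rule maximum_real_frontier[of f "cball 0 1"])
      show "f holomorphic_on interior (cball 0 1)"
        using holf by (rule holomorphic_on_subset) auto
      show "continuous_on (closure (cball 0 1)) f"
        using holf by (simp add: holomorphic_on_imp_continuous_on)
      fix y :: complex assume "y \<in> frontier (cball 0 1)"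
      then have y: "cmod y = 1" by simp
      then have y0: "y \<noteq> 0" by auto
      have "1 = y * cnj y" using complex_norm_square[of y] y by simp
      then have "1 - y\<^sup>2 = y * (- (2 * \<i> * of_real (Im y)))"
        by (simp add: power2_eq_square complex_eq_iff algebra_simps)
      then have "f y = 2 * \<i> * of_real (Im y) * (Psi (of_real R * y) / of_real R)"
        using y0 R unfolding f_def by (simp add: Psi_Q)
      then have "Re (f y) = - (2 * Im y * Im (\<psi> (of_real R * y)) / R)"
        using R by (simp add: Psi_def)
      moreover have "0 \<le> R * (Im y * Im (\<psi> (of_real R * y)))"
        using Im_psi_sign[of "of_real R * y"] RD[of y] y by (simp add: mult.assoc)
      ultimately show "Re (f y) \<le> 0" using R by (simp add: zero_le_mult_iff mult.assoc)
    qed (use z in auto)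
    then show ?thesis by (simp add: f_def)
  qed
  have "((\<lambda>R. Re ((1 - z\<^sup>2) * Q (of_real R * z))) \<longlongrightarrow> Re ((1 - z\<^sup>2) * Q (of_real 1 * z))) (at_left 1)"
  proof -
    have "isCont Q (of_real 1 * z)"
      using hol_Q z by (auto intro!: holomorphic_on_imp_continuous_on[THEN continuous_on_interior])
    then have "((\<lambda>R. Q (of_real R * z)) \<longlongrightarrow> Q (of_real 1 * z)) (at_left (1::real))"
      by (rule isCont_tendsto_compose) (intro tendsto_intros)
    then show ?thesis by (intro tendsto_intros)
  qed
  moreover have "\<forall>\<^sub>F R in at_left (1::real). 0 \<le> Re ((1 - z\<^sup>2) * Q (of_real R * z))"
    by (rule eventually_mono[OF eventually_at_left_real[OF zero_less_one]]) (rule main; simp)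
  ultimately have "0 \<le> Re ((1 - z\<^sup>2) * Q (of_real 1 * z))"
    by (rule tendsto_lowerbound) simp
  then show ?thesis by (simp add: P_def)
qed

lemma coeff_Psi_le_2: "cmod (coeff0 Psi n) \<le> 2"
proof (cases "n = 0")
  case True
  then show ?thesis by (simp add: coeff_0 Psi_0)
next
  case False
  then show ?thesis
    using caratheodory_coeff[OF hol, of n] pos psi_0 hol
    by (simp add: Psi_def[abs_def] coeff_diff coeff_const less_imp_le)
qed

text \<open>From Q = P + z^2 Q the coefficients satisfy Q_n = P_n + Q_(n-2), and |P_n| <= 2 B by
  Caratheodory's inequality; so the factor n + 1 grows by 2 in steps of 2.\<close>

lemma coeff_Q_le: "cmod (coeff0 Q n) \<le> real (Suc n) * B"
proof (induction n rule: less_induct)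
  case (less n)
  have P: "coeff0 P n = coeff0 Q n - (if n < 2 then 0 else coeff0 Q (n - 2))" for n
  proof -
    have "P = (\<lambda>z. Q z - z * (z * Q z))" by (simp add: P_def fun_eq_iff power2_eq_square algebra_simps)
    then show ?thesis
      using hol_Q by (auto simp: coeff_diff coeff_times_z holomorphic_on_mult numeral_2_eq_2)
  qed
  have le: "cmod (coeff0 P n) \<le> 2 * B" if "0 < n" for n
    using caratheodory_coeff[OF hol_P Re_P_nonneg that] by (simp add: P_0)
  consider "n = 0" | "n = 1" | m where "n = Suc (Suc m)" 
    by (metis One_nat_def not0_implies_Suc)
  then show ?case
  proof cases
    case 1
    then show ?thesis using P_0 B_pos by (simp add: coeff_0 P_def)
  next
    case 2
    then show ?thesis using P[of 1] le[of 1] by simp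
  next
    case 3
    have "cmod (coeff0 Q n) \<le> cmod (coeff0 P n) + cmod (coeff0 Q m)"
      using P[of n] 3 norm_triangle_ineq[of "coeff0 P n" "coeff0 Q m"] by simp
    then show ?thesis
      using le[of n] less.IH[of m] 3 by (simp add: algebra_simps)
  qed
qed

lemma coeff_Psi_le: "cmod (coeff0 Psi n) \<le> real n * B"
proof -
  have "coeff0 Psi n = coeff0 (\<lambda>z. z * Q z) n" by (simp add: Psi_Q[abs_def])
  then show ?thesis using coeff_Q_le[of "n - 1"] hol_Q by (cases n) (auto simp: coeff_times_z)
qed

lemma coeff_Psi_1: "cmod (coeff0 Psi (Suc 0)) = B"
  using B_pos by (simp add: coeff_1 deriv_Psi deriv_psi_0)

lemma B_le_2: "B \<le> 2"
  using coeff_Psi_le_2[of "Suc 0"] coeff_Psi_1 by simp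

text \<open>\<open>Psi\<close> is real on the real diameter, so taking the real part only changes
  the type.\<close>

definition R :: "real \<Rightarrow> real" where "R x = Re (Psi (of_real x))"

lemma R_has_derivative:
  assumes "\<bar>x\<bar> < 1"
  shows "(R has_real_derivative Re (deriv \<psi> (of_real x))) (at x)"
proof -
  have "(Psi has_field_derivative deriv \<psi> (of_real x)) (at (of_real x))"
    unfolding Psi_def using assms by (auto intro!: derivative_eq_intros psi_deriv)
  from Re_has_derivative_real[OF this] show ?thesis by (simp add: R_def[abs_def])
qed

lemma Re_P_real: "Re (P (of_real x)) = (1 - x\<^sup>2) * Re (Q (of_real x))"
proof -
  have "P (of_real x) = of_real (1 - x\<^sup>2) * Q (of_real x)" by (simp add: P_def)
  then show ?thesis
    by (simp only: times_complex.sel Re_complex_of_real Im_complex_of_real mult_zero_left diff_zero)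
qed

lemma R_nonneg:
  assumes "0 \<le> x" "x < 1"
  shows "0 \<le> R x"
proof -
  have "0 \<le> Re (P (of_real x))" using Re_P_nonneg[of "of_real x"] assms by simp
  moreover have "x\<^sup>2 < 1" using assms by (simp add: power_less_one_iff abs_square_less_1)
  ultimately have "0 \<le> Re (Q (of_real x))" by (simp add: Re_P_real zero_le_mult_iff)
  then show ?thesis using assms by (simp add: R_def Psi_Q)
qed

text \<open>With q = Re P one has R x = x q x / (1 - x^2). The half-plane Schwarz-Pick inequality
  |q'| (1 - x^2) <= 2 q gives R' >= q / (1 - x)^2 for x <= 0, and Harnack's inequality bounds q from
  below. For B x / (1 - x)^2 both are equalities.\<close>

lemma R_deriv_ge:
  assumes x: "-1 < x" "x \<le> 0"
  shows "B * ((1 + x) / (1 - x) ^ 3) \<le> Re (deriv \<psi> (of_real x))"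
proof -
  define q where "q y = Re (P (of_real y))" for y :: real
  define q' where "q' = Re (deriv P (of_real x))"
  have xD: "of_real x \<in> \<D>" "\<bar>x\<bar> < 1" using x by auto
  have x2: "x\<^sup>2 < 1" using xD by (simp add: abs_square_less_1)
  have R_eq: "R y = y * q y / (1 - y\<^sup>2)" if "\<bar>y\<bar> < 1" for y
  proof -
    have "q y = (1 - y\<^sup>2) * Re (Q (of_real y))"
      unfolding q_def by (rule Re_P_real)
    moreover have "y\<^sup>2 < 1" using that by (simp add: abs_square_less_1)
    ultimately show ?thesis by (simp add: R_def Psi_Q)
  qed
  have "(P has_field_derivative deriv P (of_real x)) (at (of_real x))"
    using holomorphic_derivI[OF hol_P] xD by auto
  from Re_has_derivative_real[OF this] have "(q has_real_derivative q') (at x)"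
    by (simp add: q_def[abs_def] q'_def)
  from DERIV_mult[OF DERIV_ident this]
  have "((\<lambda>y. y * q y) has_real_derivative q x + x * q') (at x)" by (simp add: mult.commute)
  moreover have "((\<lambda>y. 1 - y\<^sup>2) has_real_derivative - 2 * x) (at x)"
    by (auto intro!: derivative_eq_intros)
  ultimately have "((\<lambda>y. y * q y / (1 - y\<^sup>2)) has_real_derivative
      ((q x + x * q') * (1 - x\<^sup>2) - x * q x * (- 2 * x)) / ((1 - x\<^sup>2) * (1 - x\<^sup>2))) (at x)"
    using x2 by (intro DERIV_divide) auto
  then have "(R has_real_derivative
      ((q x + x * q') * (1 - x\<^sup>2) - x * q x * (- 2 * x)) / ((1 - x\<^sup>2) * (1 - x\<^sup>2))) (at x)"
    by (rule has_field_derivative_transform_within_open[of _ _ _ "{-1<..<1}"]) (use x R_eq in auto)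
  then have eq: "Re (deriv \<psi> (of_real x)) =
      ((q x + x * q') * (1 - x\<^sup>2) + x * q x * (2 * x)) / (1 - x\<^sup>2)\<^sup>2"
    using DERIV_unique[OF R_has_derivative[OF xD(2)]] by (simp add: power2_eq_square[of "1 - x\<^sup>2"])
  have q0: "B * ((1 + x) / (1 - x)) \<le> q x"
    using harnack[OF hol_P Re_P_nonneg xD(1)] x by (simp add: P_0 q_def)
  have "\<bar>q'\<bar> * (1 - x\<^sup>2) \<le> cmod (deriv P (of_real x)) * (1 - x\<^sup>2)"
    unfolding q'_def using x2 by (intro mult_right_mono abs_Re_le_cmod) auto
  also have "\<dots> \<le> 2 * q x"
    unfolding q_def by (rule deriv_positive_real_part[OF hol_P Re_P_nonneg xD(2)])
  finally have "q' * (1 - x\<^sup>2) \<le> 2 * q x"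
    using x2 by (smt (verit) mult_right_mono)
  \<comment> \<open>Multiplication by x <= 0 turns the upper bound on q' into a lower bound on x
    q'.\<close>
  then have "x * (2 * q x) \<le> x * (q' * (1 - x\<^sup>2))"
    using x by (intro mult_left_mono_neg) auto
  then have "q x * (1 + x)\<^sup>2 \<le> (q x + x * q') * (1 - x\<^sup>2) + x * q x * (2 * x)"
    by (simp add: algebra_simps power2_eq_square)
  then have "q x * (1 + x)\<^sup>2 / (1 - x\<^sup>2)\<^sup>2 \<le> ((q x + x * q') * (1 - x\<^sup>2) + x * q x * (2 * x)) / (1 - x\<^sup>2)\<^sup>2"
    by (intro divide_right_mono) auto
  also have "\<dots> = Re (deriv \<psi> (of_real x))"
    by (simp add: eq)
  also have "q x * (1 + x)\<^sup>2 / (1 - x\<^sup>2)\<^sup>2 = q x / (1 - x)\<^sup>2"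
  proof -
    have "(1 - x\<^sup>2)\<^sup>2 = (1 - x)\<^sup>2 * (1 + x)\<^sup>2" by (simp add: power2_eq_square algebra_simps)
    then show ?thesis using x by simp
  qed
  finally have "q x / (1 - x)\<^sup>2 \<le> Re (deriv \<psi> (of_real x))" .
  moreover have "B * ((1 + x) / (1 - x)) / (1 - x)\<^sup>2 \<le> q x / (1 - x)\<^sup>2"
    using q0 by (intro divide_right_mono) auto
  ultimately show ?thesis by (simp add: power3_eq_cube power2_eq_square mult.assoc)
qed

text \<open>Integrating \<open>R_deriv_ge\<close> compares R with B times the Koebe function on
  [-t, -u]. Since t / (1 + t)^2 is concave on [0, 1], its chord over [u, t] is at least as steep as
  its tangent at t, whose slope is (1 - t) / (1 + t)^3.\<close>

lemma R_diff_ge: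
  assumes u: "0 \<le> u" "u \<le> t" "t < 1"
  shows "R (- t) + B * (t - u) * ((1 - t) / (1 + t) ^ 3) \<le> R (- u)"
proof -
  have "R (- t) - B * (- t / (1 - (- t))\<^sup>2) \<le> R (- u) - B * (- u / (1 - (- u))\<^sup>2)"
  proof (rule DERIV_nonneg_imp_nondecreasing[where f = "\<lambda>x. R x - B * (x / (1 - x)\<^sup>2)"])
    fix x assume x: "- t \<le> x" "x \<le> - u"
    then have x1: "- 1 < x" "x \<le> 0" "\<bar>x\<bar> < 1" "1 - x \<noteq> 0" using u by auto
    have "((\<lambda>x. R x - B * (x / (1 - x)\<^sup>2)) has_real_derivative
        Re (deriv \<psi> (of_real x)) - B * ((1 + x) / (1 - x) ^ 3)) (at x)"
      using x1(4) by (intro DERIV_diff DERIV_cmult R_has_derivative x1 koebe_has_derivative) simp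
    then show "\<exists>y. ((\<lambda>x. R x - B * (x / (1 - x)\<^sup>2)) has_real_derivative y) (at x) \<and> 0 \<le> y"
      using R_deriv_ge[OF x1(1,2)] by force
  qed (use u in auto)
  then have 1: "R (- t) + B * (t / (1 + t)\<^sup>2 - u / (1 + u)\<^sup>2) \<le> R (- u)"
    by (simp add: algebra_simps)
  have "(t - u) * ((1 - t) / (1 + t) ^ 3) \<le> t / (1 + t)\<^sup>2 - u / (1 + u)\<^sup>2"
  proof -
    have tu: "t * u \<le> 1" "t * u \<le> u" using u mult_le_one[of t u] mult_right_mono[of t 1 u] by auto
    have "0 \<le> (t - u) * (2 + u - t * u)"
      using u tu by (intro mult_nonneg_nonneg) auto
    also have "\<dots> = (1 - t * u) * (1 + t) - (1 - t) * (1 + u)\<^sup>2"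
      by (simp add: algebra_simps power2_eq_square)
    finally have "(1 - t) / (1 + t) \<le> (1 - t * u) / (1 + u)\<^sup>2"
      using u by (simp add: field_simps)
    then have "((t - u) / (1 + t)\<^sup>2) * ((1 - t) / (1 + t)) \<le> ((t - u) / (1 + t)\<^sup>2) * ((1 - t * u) / (1 + u)\<^sup>2)"
      using u by (intro mult_left_mono) auto
    also have "\<dots> = (t * (1 + u)\<^sup>2 - (1 + t)\<^sup>2 * u) / ((1 + t)\<^sup>2 * (1 + u)\<^sup>2)"
      by (simp add: algebra_simps power2_eq_square)
    also have "\<dots> = t / (1 + t)\<^sup>2 - u / (1 + u)\<^sup>2"
      using u by (simp add: diff_frac_eq mult.commute)
    finally show ?thesis by (simp add: power3_eq_cube power2_eq_square mult.assoc)
  qed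
  then have "B * ((t - u) * ((1 - t) / (1 + t) ^ 3)) \<le> B * (t / (1 + t)\<^sup>2 - u / (1 + u)\<^sup>2)"
    using B_pos by (intro mult_left_mono) auto
  with 1 show ?thesis by (simp add: mult.assoc)
qed

end

section \<open>Growth\<close>

lemma primitive_over_z:
  assumes q: "q holomorphic_on \<D>" "q 0 = 0"
  shows "\<exists>G. G holomorphic_on \<D> \<and> G 0 = 0 \<and> (\<forall>z\<in>\<D>. z * deriv G z = q z)"
proof -
  obtain h where h: "h holomorphic_on \<D>" "\<And>z. cmod z < 1 \<Longrightarrow> q z = z * h z"
    using Schwarz3[OF q] by blast
  obtain G where G: "\<And>z. z \<in> \<D> \<Longrightarrow> (G has_field_derivative h z) (at z)"
    using holomorphic_convex_primitive'[OF convex_ball open_ball h(1)]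
    by (metis at_within_open open_ball)
  show ?thesis
  proof (intro exI conjI ballI)
    have d: "((\<lambda>z. G z - G 0) has_field_derivative h z) (at z)" if "z \<in> \<D>" for z
      using G[OF that] by (auto intro!: derivative_eq_intros)
    then show "(\<lambda>z. G z - G 0) holomorphic_on \<D>"
      using holomorphic_on_open[OF open_ball] by blast
    show "z * deriv (\<lambda>z. G z - G 0) z = q z" if "z \<in> \<D>" for z
      using DERIV_imp_deriv[OF d[OF that]] h(2)[of z] that by simp
  qed simp
qed

text \<open>With f = z h, the function h exp (- G) has derivative 0 off the origin, and continuity
  at the origin makes it constant. Positivity of the quotient rules out further zeros of f, where
  division by zero would give the value 0.\<close>

lemma exp_representation:
  assumes f: "f \<in> class_A" and G: "G holomorphic_on \<D>" "G 0 = 0"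
    and l: "\<And>z. z \<in> \<D> \<Longrightarrow> log_deriv_quotient f z = 1 + z * deriv G z"
    and pos: "\<And>z. z \<in> \<D> \<Longrightarrow> 0 < Re (log_deriv_quotient f z)" and z: "z \<in> \<D>"
  shows "f z = z * exp (G z)"
proof -
  have hf: "f holomorphic_on \<D>" "f 0 = 0" "deriv f 0 = 1" using f by (auto simp: class_A_def)
  obtain h where h: "h holomorphic_on \<D>" "\<And>z. cmod z < 1 \<Longrightarrow> f z = z * h z" "deriv f 0 = h 0"
    using Schwarz3[OF hf(1,2)] by blast
  define y where "y z = h z * exp (- G z)" for z
  have dy: "(y has_derivative (\<lambda>_. 0)) (at x within \<D>)" if "x \<in> \<D> - {0}" for x
  proof -
    from that have x: "x \<in> \<D>" "x \<noteq> 0" by auto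
    have dh: "(h has_field_derivative deriv h x) (at x)" and dG: "(G has_field_derivative deriv G x) (at x)"
      using holomorphic_derivI[OF h(1)] holomorphic_derivI[OF G(1)] x by auto
    have "((\<lambda>z. z * h z) has_field_derivative h x + x * deriv h x) (at x)"
      using dh by (auto intro!: derivative_eq_intros)
    then have "(f has_field_derivative h x + x * deriv h x) (at x)"
      by (rule has_field_derivative_transform_within_open[of _ _ _ \<D>]) (use x h in auto)
    then have "deriv f x = h x + x * deriv h x" by (rule DERIV_imp_deriv)
    moreover have "f x \<noteq> 0" using pos[OF x(1)] x by (auto simp: log_deriv_quotient_def)
    moreover have "x * deriv f x / f x = 1 + x * deriv G x"
      using l[OF x(1)] x by (simp add: log_deriv_quotient_def)
    ultimately have "x * (h x + x * deriv h x) = (1 + x * deriv G x) * (x * h x)"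
      using h(2)[of x] x by (simp add: field_simps)
    then have "deriv h x = deriv G x * h x"
      using x by (simp add: algebra_simps)
    then have "(y has_field_derivative 0) (at x)"
      unfolding y_def using dh dG by (auto intro!: derivative_eq_intros)
    then show ?thesis
      by (simp add: has_field_derivative_def has_derivative_at_withinI lambda_zero)
  qed
  have y: "continuous_on \<D> y" "y 0 = 1"
    unfolding y_def by (intro continuous_intros holomorphic_on_imp_continuous_on h G) (use h hf G in simp)
  have "y z = 1"
    by (rule has_derivative_zero_unique_strong_convex[OF convex_ball _ y(1) _ y(2) dy z, where K = "{0}"]) auto
  then have "h z = exp (G z)" by (simp add: y_def exp_minus field_simps)
  then show ?thesis using h(2)[of z] z by simp
qed

context ma_minda_function
begin

text \<open>The logarithm of \<open>f\<^sub>0 z / z\<close>, obtained from \<psi> alone so that it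
  is available before any \<open>f\<^sub>0\<close> is fixed. On the disk it is uniquely
  determined.\<close>

definition F :: "complex \<Rightarrow> complex"
  where "F = (SOME F. F holomorphic_on \<D> \<and> F 0 = 0 \<and> (\<forall>z\<in>\<D>. z * deriv F z = Psi z))"

lemma hol_F: "F holomorphic_on \<D>" and F_0: "F 0 = 0"
  and deriv_F: "z \<in> \<D> \<Longrightarrow> z * deriv F z = Psi z"
  using someI_ex[OF primitive_over_z[OF hol_Psi Psi_0], folded F_def] by auto

lemma hol_Psi_schwarz:
  assumes "schwarz_function w"
  shows "(\<lambda>z. Psi (w z)) holomorphic_on \<D>"
  using assms holomorphic_on_compose_gen[of w \<D> Psi \<D>] hol_Psi by (auto simp: o_def schwarz_function_def)

lemma starlike_representation:
  assumes f: "f \<in> starlike_class \<psi>"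
  obtains w G where "schwarz_function w" "G holomorphic_on \<D>" "G 0 = 0"
    "\<And>z. z \<in> \<D> \<Longrightarrow> z * deriv G z = Psi (w z)" "\<And>z. z \<in> \<D> \<Longrightarrow> f z = z * exp (G z)"
proof -
  obtain w where w: "schwarz_function w" "\<And>z. z \<in> \<D> \<Longrightarrow> log_deriv_quotient f z = \<psi> (w z)"
    using f by (auto simp: starlike_class_def subordinate_def)
  have w0: "w 0 = 0" and wD: "\<And>z. z \<in> \<D> \<Longrightarrow> w z \<in> \<D>"
    using schwarz_functionD[OF w(1)] by auto
  obtain G where G: "G holomorphic_on \<D>" "G 0 = 0" "\<And>z. z \<in> \<D> \<Longrightarrow> z * deriv G z = Psi (w z)"
    using primitive_over_z[OF hol_Psi_schwarz[OF w(1)]] w0 Psi_0 by auto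
  have "f z = z * exp (G z)" if "z \<in> \<D>" for z
  proof (rule exp_representation[OF _ G(1,2) _ _ that])
    show "f \<in> class_A" using f by (simp add: starlike_class_def)
  qed (use w G wD pos in \<open>auto simp: Psi_def\<close>)
  then show thesis using that w(1) G by blast
qed

text \<open>The integral over [0, t] of (1 - s)^2 / (1 + s)^4, which is the factor (1 - s) / (1 + s)
  from \<open>schwarz_bound\<close> times the slope (1 - s) / (1 + s)^3 from
  \<open>R_diff_ge\<close>. Its value at 1 is the constant 1/6.\<close>

definition J :: "real \<Rightarrow> real" where "J t = (1 - ((1 - t) / (1 + t)) ^ 3) / 6"

lemma J_has_derivative:
  assumes "0 \<le> t"
  shows "(J has_real_derivative (1 - t)\<^sup>2 / (1 + t) ^ 4) (at t)"
proof -
  have "((\<lambda>t. (1 - t) / (1 + t)) has_real_derivative ((0 - 1) * (1 + t) - (1 - t) * (0 + 1)) / ((1 + t) * (1 + t))) (at t)"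
    using assms by (intro DERIV_divide DERIV_diff DERIV_add DERIV_const DERIV_ident) auto
  from DERIV_power[OF this, of 3]
  have "(J has_real_derivative (0 - real 3 * (((0 - 1) * (1 + t) - (1 - t) * (0 + 1)) / ((1 + t) * (1 + t))
      * ((1 - t) / (1 + t)) ^ (3 - Suc 0))) / 6) (at t)"
    unfolding J_def by (intro DERIV_cdivide DERIV_diff DERIV_const)
  moreover have "(0 - 1) * (1 + t) - (1 - t) * (0 + 1) = - 2" by simp
  moreover have "(0 - real 3 * (- 2 / (p * p) * ((1 - t) / p) ^ (3 - Suc 0))) / 6 = (1 - t)\<^sup>2 / p ^ 4" for p
    by (simp add: power_divide power4_eq_xxxx power2_eq_square mult.assoc)
  ultimately show ?thesis by (simp only:)
qed

text \<open>
  \<open>growth_bound a t\<close> bounds \<open>log (\<bar>f z\<bar> / \<bar>z\<bar>)\<close> from below when \<open>\<bar>z\<bar> = t\<close> and \<open>z f'(z) / f(z) = \<psi> (w z)\<close>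
  with \<open>\<bar>w'(0)\<bar> = a\<close>. The extremal function itself has \<open>a = 1\<close>.
\<close>
definition growth_bound :: "real \<Rightarrow> real \<Rightarrow> real"
  where "growth_bound a t = Re (F (- of_real t)) + (1 - a) * B * J t"

lemma Re_F_has_derivative:
  assumes "0 < t" "t < 1"
  shows "((\<lambda>t. Re (F (- of_real t))) has_real_derivative R (- t) / t) (at t)"
proof -
  have D: "- of_real t \<in> \<D>" using assms by simp
  have "((\<lambda>t. Re (F (- of_real t))) has_real_derivative Re (deriv F (- of_real t) * (- 1))) (at t)"
    by (rule Re_has_derivative_along[where f = F and \<gamma> = "\<lambda>t. - of_real t"])
      (use D in \<open>auto intro!: holomorphic_derivI[OF hol_F] derivative_eq_intros
        simp: has_vector_derivative_def scaleR_conv_of_real\<close>)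
  moreover have "Re (- of_real t * deriv F (- of_real t)) = R (- t)"
    using deriv_F[OF D] by (simp add: R_def)
  then have "Re (deriv F (- of_real t) * (- 1)) = R (- t) / t"
    using assms by (simp add: field_simps)
  ultimately show ?thesis by simp
qed

text \<open>
  At a minimum point \<open>z0\<close> of \<open>Re G\<close> on a circle, \<open>z0 G'(z0) = Psi (w z0)\<close> is real, so \<open>w z0\<close> is real
  and only the values of \<open>Psi\<close> on the real axis matter.
\<close>
lemma growth:
  assumes w: "schwarz_function w" and G: "G holomorphic_on \<D>" "G 0 = 0"
    "\<And>z. z \<in> \<D> \<Longrightarrow> z * deriv G z = Psi (w z)" and z: "z \<in> \<D>"
  shows "growth_bound (cmod (deriv w 0)) (cmod z) \<le> Re (G z)"
proof (rule field_le_epsilon)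
  define a where "a = cmod (deriv w 0)"
  have wD: "\<And>z. z \<in> \<D> \<Longrightarrow> w z \<in> \<D>"
    using schwarz_functionD[OF w] by auto
  have a: "a \<le> 1"
    using Schwarz_Lemma(2)[OF schwarz_functionD(1,2,4)[OF w], of 0] by (simp add: a_def)
  fix \<epsilon> :: real assume \<epsilon>: "0 < \<epsilon>"
  \<comment> \<open>The term \<epsilon> |z| makes the radial derivative of E strictly positive at a
    minimum off the origin, which is contradictory; then \<epsilon> tends to 0.\<close>
  define E where "E z = Re (G z) - growth_bound a (cmod z) + \<epsilon> * cmod z" for z
  define r where "r = cmod z"
  have r: "0 \<le> r" "r < 1" using z by (auto simp: r_def)
  have cont: "continuous_on (cball 0 r) E"
  proof -
    have "continuous_on (cball 0 r) G"
      by (rule holomorphic_on_imp_continuous_on[OF holomorphic_on_subset[OF G(1)]]) (use r in auto)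
    moreover have "continuous_on (cball 0 r) (\<lambda>z. F (- of_real (cmod z)))"
      by (rule continuous_on_compose2[OF holomorphic_on_imp_continuous_on[OF hol_F]])
        (use r in \<open>auto intro!: continuous_intros\<close>)
    moreover have "1 + cmod z \<noteq> 0" for z :: complex using norm_ge_zero[of z] by linarith
    ultimately show ?thesis
      unfolding E_def growth_bound_def J_def by (intro continuous_intros) auto
  qed
  obtain z0 where z0: "z0 \<in> cball 0 r" "\<And>y. y \<in> cball 0 r \<Longrightarrow> E z0 \<le> E y"
    using continuous_attains_inf[OF compact_cball _ cont] r by auto
  have "0 \<le> E z0"
  proof (rule ccontr)
    assume "\<not> 0 \<le> E z0"
    moreover have "E 0 = 0" by (simp add: E_def growth_bound_def F_0 G(2) J_def)
    ultimately have nz: "z0 \<noteq> 0" by auto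
    define t where "t = cmod z0"
    have t: "0 < t" "t < 1" "t \<le> r" using nz z0(1) r by (auto simp: t_def)
    have z0D: "z0 \<in> \<D>" using t by (simp add: t_def)
    have dG: "(G has_field_derivative deriv G z0) (at z0)"
      using holomorphic_derivI[OF G(1)] z0D by auto
    \<comment> \<open>Rotation keeps |z0| fixed, so along the circle E changes only through Re G,
      and the tangential derivative vanishes at the minimum.\<close>
    have "((\<lambda>s. Re (G (z0 * cis s))) has_real_derivative Re (deriv G z0 * (z0 * \<i>))) (at 0)"
    proof (rule Re_has_derivative_along[where f = G and \<gamma> = "\<lambda>s. z0 * cis s"])
      show "((\<lambda>s. z0 * cis s) has_vector_derivative z0 * \<i>) (at 0)"
        by (auto intro!: derivative_eq_intros simp: has_vector_derivative_def scaleR_conv_of_real)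
    qed (use dG in simp)
    then have "Re (deriv G z0 * (z0 * \<i>)) = 0"
    proof (rule DERIV_local_min[of _ _ _ 1])
      show "\<forall>y. \<bar>0 - y\<bar> < 1 \<longrightarrow> Re (G (z0 * cis 0)) \<le> Re (G (z0 * cis y))"
      proof (intro allI impI)
        fix y :: real
        have "E z0 \<le> E (z0 * cis y)" using z0(1) by (intro z0(2)) (simp add: norm_mult)
        then show "Re (G (z0 * cis 0)) \<le> Re (G (z0 * cis y))" by (simp add: E_def norm_mult)
      qed
    qed simp
    then have "Im (z0 * deriv G z0) = 0" by (simp add: algebra_simps)
    then have "Im (Psi (w z0)) = 0" unfolding G(3)[OF z0D] .
    then have "Im (w z0) = 0"
      using real_of_psi_real[OF wD[OF z0D]] by (simp add: Psi_def)
    then obtain x where x: "w z0 = of_real x" using complex_is_Real_iff by (auto elim: Reals_cases)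
    \<comment> \<open>This compares the radial derivatives of \<open>growth_bound\<close> and Re G.
      For x <= 0 it is \<open>R_diff_ge\<close> with u = - x; for x > 0 it is the case u = 0,
      because R x is nonnegative there.\<close>
    have radial: "t * (R (- t) / t + (1 - a) * B * ((1 - t)\<^sup>2 / (1 + t) ^ 4)) \<le> R x"
    proof -
      have xt: "\<bar>x\<bar> \<le> t * (1 - (1 - a) * ((1 - t) / (1 + t)))"
        using schwarz_bound[OF w z0D] by (simp add: x t_def a_def)
      have q: "0 \<le> (1 - t) / (1 + t)" "(1 - t) / (1 + t) \<le> 1" using t by (auto simp: field_simps)
      have a0: "0 \<le> (1 - a) * ((1 - t) / (1 + t))" using a q by (intro mult_nonneg_nonneg) auto
      have R_ge: "R (- t) + B * ((1 - t) / (1 + t) ^ 3) * (t * ((1 - a) * ((1 - t) / (1 + t)))) \<le> R (- u)"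
        if u: "0 \<le> u" "u \<le> t * (1 - (1 - a) * ((1 - t) / (1 + t)))" for u
      proof -
        have "u \<le> t * 1" using u(2) a0 t by (elim order_trans) (intro mult_left_mono; simp)
        then have "R (- t) + B * (t - u) * ((1 - t) / (1 + t) ^ 3) \<le> R (- u)"
          using u t by (intro R_diff_ge) auto
        moreover have "B * ((1 - t) / (1 + t) ^ 3) * (t * ((1 - a) * ((1 - t) / (1 + t))))
            \<le> B * ((1 - t) / (1 + t) ^ 3) * (t - u)"
          using u t B_pos by (intro mult_left_mono) (auto simp: algebra_simps)
        ultimately show ?thesis by (simp add: mult_ac)
      qed
      have "R (- t) + B * ((1 - t) / (1 + t) ^ 3) * (t * ((1 - a) * ((1 - t) / (1 + t)))) \<le> R x"
      proof (cases "x \<le> 0")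
        case True
        then show ?thesis using R_ge[of "- x"] xt by simp
      next
        case False
        have "(1 - a) * ((1 - t) / (1 + t)) \<le> 1 * 1"
          using a q by (intro mult_mono) (auto simp: a_def)
        then have "R (- t) + B * ((1 - t) / (1 + t) ^ 3) * (t * ((1 - a) * ((1 - t) / (1 + t)))) \<le> R (- 0)"
          using t by (intro R_ge) auto
        also have "\<dots> = 0" by (simp add: R_def Psi_0)
        also have "0 \<le> R x"
          using False wD[OF z0D] x by (intro R_nonneg) auto
        finally show ?thesis .
      qed
      moreover have "t * (R (- t) / t + (1 - a) * B * ((1 - t)\<^sup>2 / (1 + t) ^ 4))
          = R (- t) + B * ((1 - t) / (1 + t) ^ 3) * (t * ((1 - a) * ((1 - t) / (1 + t))))"
        using t by (simp add: distrib_left power2_eq_square power3_eq_cube power4_eq_xxxx mult_ac)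
      ultimately show ?thesis by simp
    qed
    \<comment> \<open>E along the ray through z0, which corresponds to s = 1; a positive derivative
      there yields smaller values slightly closer to the origin.\<close>
    define \<phi> where "\<phi> s = Re (G (of_real s * z0)) - growth_bound a (s * t) + \<epsilon> * (s * t)" for s :: real
    define D where "D = R x - t * (R (- t) / t + (1 - a) * B * ((1 - t)\<^sup>2 / (1 + t) ^ 4)) + \<epsilon> * t"
    have "((\<lambda>s. Re (G (of_real s * z0))) has_real_derivative Re (deriv G z0 * z0)) (at 1)"
    proof (rule Re_has_derivative_along[where f = G and \<gamma> = "\<lambda>s. of_real s * z0"])
      show "((\<lambda>s. of_real s * z0) has_vector_derivative z0) (at 1)"
        by (auto intro!: derivative_eq_intros simp: has_vector_derivative_def scaleR_conv_of_real)
    qed (use dG in simp)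
    moreover have "deriv G z0 * z0 = Psi (of_real x)" using G(3)[OF z0D] x by (simp add: mult.commute)
    ultimately have d1: "((\<lambda>s. Re (G (of_real s * z0))) has_real_derivative R x) (at 1)"
      by (simp add: R_def)
    have "(growth_bound a has_real_derivative
        R (- t) / t + (1 - a) * B * ((1 - t)\<^sup>2 / (1 + t) ^ 4)) (at t)"
      unfolding growth_bound_def using t
      by (intro DERIV_add DERIV_cmult Re_F_has_derivative J_has_derivative) auto
    moreover have "((\<lambda>s. s * t) has_real_derivative t) (at 1)"
      by (auto intro!: derivative_eq_intros)
    ultimately have d2: "((\<lambda>s. growth_bound a (s * t)) has_real_derivative
        (R (- t) / t + (1 - a) * B * ((1 - t)\<^sup>2 / (1 + t) ^ 4)) * t) (at 1)"
      using DERIV_chain2[of "growth_bound a" _ "\<lambda>s. s * t" 1] by simp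
    have d3: "((\<lambda>s. \<epsilon> * (s * t)) has_real_derivative \<epsilon> * t) (at 1)"
      by (auto intro!: derivative_eq_intros)
    have d\<phi>: "(\<phi> has_real_derivative D) (at 1)"
      using DERIV_add[OF DERIV_diff[OF d1 d2] d3] unfolding \<phi>_def D_def
      by (simp only: mult.commute[of t])
    have D0: "0 < D"
      using radial mult_pos_pos[OF \<epsilon> t(1)] unfolding D_def by linarith
    obtain d where d: "0 < d" "\<And>h. 0 < h \<Longrightarrow> h < d \<Longrightarrow> \<phi> (1 - h) < \<phi> 1"
      using DERIV_pos_inc_left[OF d\<phi> D0] by auto
    define h where "h = min (d / 2) (1 / 2)"
    have h: "0 < h" "h < d" "h < 1" using d by (auto simp: h_def)
    have "\<phi> s = E (of_real s * z0)" if "0 \<le> s" for s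
      using that by (simp add: \<phi>_def E_def norm_mult t_def)
    moreover have "E (of_real 1 * z0) \<le> E (of_real (1 - h) * z0)"
    proof -
      have "(1 - h) * cmod z0 \<le> 1 * cmod z0" using h by (intro mult_right_mono) auto
      then have "of_real (1 - h) * z0 \<in> cball 0 r"
        using z0(1) h by (simp add: norm_mult del: of_real_diff)
      then show ?thesis using z0(2) by simp
    qed
    ultimately show False using d(2)[of h] h by simp
  qed
  also have "E z0 \<le> E z" by (rule z0(2)) (simp add: r_def)
  finally have "growth_bound a (cmod z) \<le> Re (G z) + \<epsilon> * cmod z" by (simp add: E_def)
  also have "\<dots> \<le> Re (G z) + \<epsilon> * 1" using z \<epsilon> by (intro add_left_mono mult_left_mono) auto
  finally show "growth_bound (cmod (deriv w 0)) (cmod z) \<le> Re (G z) + \<epsilon>" by (simp add: a_def)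
qed

end

section \<open>Univalence and the distance to the boundary\<close>

text \<open>On the segment from x to y, the real part of f / (y - x) has derivative Re f' > 0, so it
  cannot return to its initial value.\<close>

lemma noshiro_warschawski:
  assumes f: "f holomorphic_on S" "open S" "convex S" and re: "\<And>z. z \<in> S \<Longrightarrow> 0 < Re (deriv f z)"
  shows "inj_on f S"
proof (rule inj_onI, rule ccontr)
  fix x y assume xy: "x \<in> S" "y \<in> S" "f x = f y" "x \<noteq> y"
  define \<gamma> where "\<gamma> t = x + of_real t * (y - x)" for t
  have "Re (f (\<gamma> 0) / (y - x)) < Re (f (\<gamma> 1) / (y - x))"
  proof (rule DERIV_pos_imp_increasing[of 0 1 "\<lambda>t. Re (f (\<gamma> t) / (y - x))"])
    fix t :: real assume t: "0 \<le> t" "t \<le> 1"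
    have "\<gamma> t = (1 - t) *\<^sub>R x + t *\<^sub>R y" by (simp add: \<gamma>_def scaleR_conv_of_real algebra_simps)
    then have S: "\<gamma> t \<in> S" using f(3) xy t by (simp add: convexD_alt)
    have "((\<lambda>t. Re ((\<lambda>z. f z / (y - x)) (\<gamma> t))) has_real_derivative Re (deriv f (\<gamma> t) / (y - x) * (y - x))) (at t)"
    proof (rule Re_has_derivative_along[where f = "\<lambda>z. f z / (y - x)" and \<gamma> = \<gamma>])
      show "((\<lambda>z. f z / (y - x)) has_field_derivative deriv f (\<gamma> t) / (y - x)) (at (\<gamma> t))"
        using holomorphic_derivI[OF f(1,2) S] by (rule DERIV_cdivide)
      show "(\<gamma> has_vector_derivative y - x) (at t)"
        unfolding \<gamma>_def by (auto intro!: derivative_eq_intros simp: has_vector_derivative_def scaleR_conv_of_real)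
    qed
    then show "\<exists>d. ((\<lambda>t. Re (f (\<gamma> t) / (y - x))) has_real_derivative d) (at t) \<and> 0 < d"
      using re[OF S] xy(4) by (intro exI[of _ "Re (deriv f (\<gamma> t))"]) simp
  qed simp
  then show False using xy(3) by (simp add: \<gamma>_def)
qed

text \<open>
  In the coordinate \<open>\<zeta> = log z\<close> the map becomes \<open>\<zeta> + G (exp \<zeta>)\<close>, whose derivative has positive
  real part on the left half-plane.
\<close>
lemma starlike_inj:
  assumes G: "G holomorphic_on \<D>" and f: "\<And>z. z \<in> \<D> \<Longrightarrow> f z = z * exp (G z)"
    and re: "\<And>z. z \<in> \<D> \<Longrightarrow> 0 < Re (1 + z * deriv G z)"
  shows "inj_on f \<D>"
proof (rule inj_onI)
  fix z1 z2 assume z: "z1 \<in> \<D>" "z2 \<in> \<D>" "f z1 = f z2"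
  define H where "H = {z. Re z < 0}"
  define \<Lambda> where "\<Lambda> \<zeta> = \<zeta> + G (exp \<zeta>)" for \<zeta>
  have eD: "exp \<zeta> \<in> \<D>" if "\<zeta> \<in> H" for \<zeta> using that by (simp add: H_def)
  have d: "(\<Lambda> has_field_derivative 1 + exp \<zeta> * deriv G (exp \<zeta>)) (at \<zeta>)" if "\<zeta> \<in> H" for \<zeta>
  proof -
    have "((\<lambda>\<zeta>. G (exp \<zeta>)) has_field_derivative deriv G (exp \<zeta>) * exp \<zeta>) (at \<zeta>)"
      by (rule DERIV_chain2[OF holomorphic_derivI[OF G open_ball eD[OF that]] DERIV_exp])
    from DERIV_add[OF DERIV_ident this] show ?thesis
      by (simp add: \<Lambda>_def[abs_def] mult.commute)
  qed
  have inj: "inj_on \<Lambda> H"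
  proof (rule noshiro_warschawski)
    show "open H" "convex H" by (auto simp: H_def open_halfspace_Re_lt convex_halfspace_Re_lt)
    then show "\<Lambda> holomorphic_on H" using d holomorphic_on_open by blast
    show "0 < Re (deriv \<Lambda> \<zeta>)" if "\<zeta> \<in> H" for \<zeta>
      using DERIV_imp_deriv[OF d[OF that]] re[OF eD[OF that]] by simp
  qed
  show "z1 = z2"
  proof (cases "z1 = 0 \<or> z2 = 0")
    case True
    then show ?thesis using z f[of z1] f[of z2] by auto
  next
    case False
    have L: "exp (Ln z) = z" "Ln z \<in> H" if "z \<noteq> 0" "z \<in> \<D>" for z
      using that by (auto simp: H_def Re_Ln)
    have "exp (\<Lambda> (Ln z1)) = exp (\<Lambda> (Ln z2))"
      using False z L f by (simp add: \<Lambda>_def exp_add)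
    then obtain n :: int where n: "\<Lambda> (Ln z1) = \<Lambda> (Ln z2) + of_int (2 * n) * pi * \<i>"
      unfolding exp_eq by blast
    \<comment> \<open>The ambiguity of the logarithm moves into the argument: the shift is a period
      of exp, hence leaves the term with G unchanged.\<close>
    define \<zeta> where "\<zeta> = Ln z2 + of_int (2 * n) * pi * \<i>"
    have e: "exp \<zeta> = z2" unfolding \<zeta>_def using exp_eq[of "Ln z2 + of_int (2 * n) * pi * \<i>" "Ln z2"] L False z by auto
    note n
    also have "\<Lambda> (Ln z2) + of_int (2 * n) * pi * \<i> = \<Lambda> \<zeta>"
      unfolding \<Lambda>_def e using L(1)[of z2] False z by (simp add: \<zeta>_def)
    finally have "\<Lambda> (Ln z1) = \<Lambda> \<zeta>" .
    moreover have "\<zeta> \<in> H" using L(2)[of z2] False z by (simp add: \<zeta>_def H_def)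
    ultimately have "Ln z1 = \<zeta>" using inj L(2)[of z1] False z by (auto simp: inj_on_def)
    then show ?thesis using e L(1)[of z1] False z by auto
  qed
qed

text \<open>A smaller closed disk has a compact image inside the open image of f, so frontier points
  are limits of values with |z| near 1 only. A radial lower bound g for |f| thus passes to the
  frontier through its limit c.\<close>

lemma boundary_dist_ge:
  assumes f: "f holomorphic_on \<D>" "inj_on f \<D>" "f 0 = 0"
    and g: "(g \<longlongrightarrow> c) (at_left 1)" "\<And>z. z \<in> \<D> \<Longrightarrow> z \<noteq> 0 \<Longrightarrow> g (cmod z) \<le> cmod (f z)"
  shows "c \<le> boundary_dist f"
proof -
  have opn: "open (f ` \<D>)" by (rule open_mapping_thm3[OF f(1) open_ball f(2)])
  \<comment> \<open>\<open>infdist\<close> to the empty set is 0, so the frontier has to be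
    nonempty; were the image the whole plane, the inverse of f would contradict Liouville's
    theorem.\<close>
  have "f ` \<D> \<noteq> UNIV"
  proof
    assume U: "f ` \<D> = UNIV"
    obtain h where h: "h holomorphic_on f ` \<D>" "\<And>z. z \<in> \<D> \<Longrightarrow> h (f z) = z"
      using holomorphic_has_inverse[OF f(1) open_ball f(2)] by blast
    have "range h \<subseteq> \<D>"
    proof
      fix y assume "y \<in> range h"
      then obtain x where "y = h x" by auto
      moreover have "x \<in> f ` \<D>" using U by simp
      then obtain z where "z \<in> \<D>" "x = f z" by blast
      ultimately show "y \<in> \<D>" using h(2) by simp
    qed
    then have "bounded (range h)" using bounded_ball bounded_subset by blast
    then obtain c where "\<And>x. h x = c"
      using Liouville_theorem[of h] h(1) U by (auto simp: constant_on_def)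
    then show False using h(2)[of 0] h(2)[of "1/2"] by simp
  qed
  then have ne: "frontier (f ` \<D>) \<noteq> {}" by (auto simp: frontier_eq_empty)
  have "c \<le> dist (f 0) y" if y: "y \<in> frontier (f ` \<D>)" for y
  proof (rule ccontr)
    assume "\<not> c \<le> dist (f 0) y"
    then have "cmod y < c" by (simp add: f(3))
    then obtain \<delta> where \<delta>: "cmod y < \<delta>" "\<delta> < c" using dense by blast
    have "\<forall>\<^sub>F t in at_left 1. \<delta> < g t" using g(1) \<delta>(2) by (rule order_tendstoD)
    then obtain \<rho> where \<rho>: "\<rho> < 1" "\<And>t. \<rho> < t \<Longrightarrow> t < 1 \<Longrightarrow> \<delta> < g t"
      using eventually_at_left[of 0 1] by (auto simp: eventually_at_left[of 0 1])
    let ?C = "f ` (\<D> - cball 0 (max 0 \<rho>))"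
    let ?A = "f ` cball 0 (max 0 \<rho>)"
    have sub: "cball 0 (max 0 \<rho>) \<subseteq> \<D>" using \<rho>(1) by auto
    have "compact ?A"
      by (rule compact_continuous_image[OF holomorphic_on_imp_continuous_on[OF holomorphic_on_subset[OF f(1) sub]] compact_cball])
    then have "closed ?A" by (rule compact_imp_closed)
    moreover have "f ` \<D> = ?A \<union> ?C" using sub by blast
    ultimately have "closure (f ` \<D>) = ?A \<union> closure ?C" by (metis closure_Un closure_closed)
    moreover have "y \<in> closure (f ` \<D>)" "y \<notin> f ` \<D>"
      using y opn by (auto simp: frontier_def interior_open)
    ultimately have "y \<in> closure ?C" using sub by blast
    moreover have "?C \<subseteq> {x. \<delta> \<le> cmod x}"
    proof
      fix x assume "x \<in> ?C"
      then obtain z where z: "x = f z" "z \<in> \<D>" "\<not> cmod z \<le> max 0 \<rho>" by auto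
      then have "\<delta> < g (cmod z)" "z \<noteq> 0" using \<rho>(2) by auto
      then show "x \<in> {x. \<delta> \<le> cmod x}" using g(2)[OF z(2)] z(1) by simp
    qed
    then have "closure ?C \<subseteq> {x. \<delta> \<le> cmod x}"
      by (rule closure_minimal) (intro closed_Collect_le continuous_intros)
    ultimately show False using \<delta>(1) by auto
  qed
  then show ?thesis
    unfolding boundary_dist_def infdist_def using ne by (auto intro!: cINF_greatest)
qed

context ma_minda_function
begin

section \<open>The extremal function on the negative axis\<close>

definition extremal_modulus :: "real \<Rightarrow> real" where "extremal_modulus t = t * exp (Re (F (- of_real t)))"

text \<open>This is \<open>- f\<^sub>0(-1)\<close>: \<open>extremal_modulus t\<close> is the modulus
  of \<open>f\<^sub>0 (- t)\<close> and increases with t, so its limit at 1 is the supremum.\<close>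

definition L :: real where "L = (SUP t\<in>{0<..<1}. extremal_modulus t)"

lemma R_nonpos:
  assumes "0 \<le> t" "t < 1"
  shows "R (- t) \<le> 0"
proof -
  have "R (- t) + B * (t - 0) * ((1 - t) / (1 + t) ^ 3) \<le> R (- 0)"
    using assms by (intro R_diff_ge) auto
  moreover have "0 \<le> B * (t - 0) * ((1 - t) / (1 + t) ^ 3)" using assms B_pos by simp
  ultimately show ?thesis by (simp add: R_def Psi_0)
qed

lemma continuous_Re_F: "continuous_on {0..<1} (\<lambda>t. F (- of_real t))"
  by (rule continuous_on_compose2[OF holomorphic_on_imp_continuous_on[OF hol_F]])
    (auto intro!: continuous_intros)

lemma Re_F_nonpos:
  assumes "0 \<le> t" "t < 1"
  shows "Re (F (- of_real t)) \<le> 0"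
proof -
  have "Re (F (- of_real t)) \<le> Re (F (- of_real 0))"
  proof (rule DERIV_nonpos_imp_decreasing_open[OF assms(1), where f = "\<lambda>t. Re (F (- of_real t))"])
    fix x assume x: "0 < x" "x < t"
    then have "R (- x) / x \<le> 0" using R_nonpos[of x] assms by (simp add: divide_nonpos_pos)
    then show "\<exists>y. ((\<lambda>t. Re (F (- of_real t))) has_real_derivative y) (at x) \<and> y \<le> 0"
      using Re_F_has_derivative[of x] x assms by auto
  next
    show "continuous_on {0..t} (\<lambda>t. Re (F (- of_real t)))"
      by (intro continuous_intros continuous_on_subset[OF continuous_Re_F]) (use assms in auto)
  qed
  then show ?thesis by (simp add: F_0)
qed

text \<open>On the negative axis z F'(z) = \<open>Psi z\<close> is real, so Im F stays constant
  there, and it starts at 0.\<close>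

lemma F_real:
  assumes "0 \<le> t" "t < 1"
  shows "F (- of_real t) = of_real (Re (F (- of_real t)))"
proof (cases "t = 0")
  case True
  then show ?thesis by (simp add: F_0)
next
  case False
  define g where "g t = Re (- \<i> * F (- of_real t))" for t :: real
  have "g t = g 0"
  proof (rule DERIV_isconst_end[where f = g])
    show "continuous_on {0..t} g"
      unfolding g_def by (intro continuous_intros continuous_on_subset[OF continuous_Re_F]) (use assms in auto)
    fix x assume x: "0 < x" "x < t"
    then have D: "- of_real x \<in> \<D>" using assms by simp
    have "(g has_real_derivative Re (- \<i> * deriv F (- of_real x) * (- 1))) (at x)"
      unfolding g_def
    proof (rule Re_has_derivative_along[where f = "\<lambda>z. - \<i> * F z" and \<gamma> = "\<lambda>t. - of_real t"])
      show "((\<lambda>z. - \<i> * F z) has_field_derivative - \<i> * deriv F (- of_real x)) (at (- of_real x))"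
        by (rule DERIV_cmult[OF holomorphic_derivI[OF hol_F open_ball D]])
      show "((\<lambda>t. - of_real t) has_vector_derivative - 1) (at x)"
        by (auto intro!: derivative_eq_intros simp: has_vector_derivative_def scaleR_conv_of_real)
    qed
    moreover have "Im (Psi (- of_real x)) = 0"
      using psi_cnj[OF D] by (simp add: Psi_def complex_eq_iff)
    then have "Im (- of_real x * deriv F (- of_real x)) = 0" by (simp only: deriv_F[OF D])
    then have "Im (deriv F (- of_real x)) = 0" using x by simp
    ultimately show "(g has_real_derivative 0) (at x)" by simp
  qed (use assms False in auto)
  then show ?thesis by (simp add: g_def F_0 complex_eq_iff)
qed

text \<open>The logarithmic derivative, multiplied by t, is 1 + R (- t) = Re (\<psi> (- t)) >
  0.\<close>

lemma extremal_modulus_mono: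
  assumes "0 < s" "s \<le> t" "t < 1"
  shows "extremal_modulus s \<le> extremal_modulus t"
proof (rule DERIV_nonneg_imp_nondecreasing[OF assms(2)])
  fix x assume x: "s \<le> x" "x \<le> t"
  then have x': "0 < x" "x < 1" using assms by auto
  have "(extremal_modulus has_real_derivative 1 * exp (Re (F (- of_real x))) +
      exp (Re (F (- of_real x))) * (R (- x) / x) * x) (at x)"
    unfolding extremal_modulus_def
    by (intro DERIV_mult DERIV_ident DERIV_chain2[OF DERIV_exp] Re_F_has_derivative x')
  moreover have "0 \<le> exp (Re (F (- of_real x))) * (1 + R (- x))"
    using pos[of "- of_real x"] x' by (simp add: R_def Psi_def less_imp_le)
  ultimately show "\<exists>y. (extremal_modulus has_real_derivative y) (at x) \<and> 0 \<le> y"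
    using x' by (intro exI conjI) (assumption, simp add: algebra_simps)
qed

lemma extremal_modulus_le_1:
  assumes "0 < t" "t < 1"
  shows "extremal_modulus t \<le> 1"
proof -
  have "extremal_modulus t \<le> 1 * 1"
    unfolding extremal_modulus_def using Re_F_nonpos[of t] assms by (intro mult_mono) auto
  then show ?thesis by simp
qed

lemma bdd: "bdd_above (extremal_modulus ` {0<..<1})"
  using extremal_modulus_le_1 by (intro bdd_aboveI[of _ 1]) auto

lemma L_le_1: "L \<le> 1"
  unfolding L_def using extremal_modulus_le_1 by (intro cSUP_least) auto

lemma L_pos: "0 < L"
proof -
  have "0 < extremal_modulus (1/2)" by (simp add: extremal_modulus_def)
  also have "\<dots> \<le> L" unfolding L_def by (intro cSUP_upper bdd) auto
  finally show ?thesis .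
qed

lemma extremal_modulus_tendsto: "(extremal_modulus \<longlongrightarrow> L) (at_left 1)"
proof (rule order_tendstoI)
  fix a assume "a < L"
  then obtain s where s: "0 < s" "s < 1" "a < extremal_modulus s"
    unfolding L_def by (subst (asm) less_cSUP_iff) (auto intro: bdd)
  show "\<forall>\<^sub>F t in at_left 1. a < extremal_modulus t"
    by (rule eventually_mono[OF eventually_at_left_real[OF s(2)]])
      (use s extremal_modulus_mono[of s] in \<open>force intro: less_le_trans\<close>)
next
  fix a assume a: "L < a"
  show "\<forall>\<^sub>F t in at_left 1. extremal_modulus t < a"
    by (rule eventually_mono[OF eventually_at_left_real[OF zero_less_one]])
      (use a in \<open>auto intro!: le_less_trans[OF _ a] cSUP_upper bdd simp: L_def\<close>)
qed

lemma J_tendsto: "(J \<longlongrightarrow> 1 / 6) (at_left 1)"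
proof -
  have "isCont J 1" unfolding J_def by (intro continuous_intros) auto
  then have "(J \<longlongrightarrow> J 1) (at_left 1)"
    using isCont_def filterlim_at_split by blast
  then show ?thesis by (simp add: J_def)
qed

lemma starlike_boundary_dist:
  assumes w: "schwarz_function w" and G: "G holomorphic_on \<D>" "G 0 = 0"
    "\<And>z. z \<in> \<D> \<Longrightarrow> z * deriv G z = Psi (w z)" and f: "\<And>z. z \<in> \<D> \<Longrightarrow> f z = z * exp (G z)"
  shows "inj_on f \<D>" and "L * exp ((1 - cmod (deriv w 0)) * B / 6) \<le> boundary_dist f"
proof -
  show inj: "inj_on f \<D>"
  proof (rule starlike_inj[OF G(1) f])
    fix z assume z: "z \<in> \<D>"
    have "0 < Re (\<psi> (w z))" using pos schwarz_functionD(3)[OF w z] by blast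
    then show "0 < Re (1 + z * deriv G z)" unfolding G(3)[OF z] by (simp add: Psi_def)
  qed
  define a where "a = cmod (deriv w 0)"
  define g where "g t = extremal_modulus t * exp ((1 - a) * B * J t)" for t
  have "L * exp ((1 - a) * B / 6) \<le> boundary_dist f"
  proof (rule boundary_dist_ge[OF _ inj, of g])
    have "f holomorphic_on \<D> \<longleftrightarrow> (\<lambda>z. z * exp (G z)) holomorphic_on \<D>"
      using f by (intro holomorphic_cong) auto
    then show "f holomorphic_on \<D>" by (auto intro!: holomorphic_intros G)
    show "f 0 = 0" using f[of 0] by simp
    have "(g \<longlongrightarrow> L * exp ((1 - a) * B * (1 / 6))) (at_left 1)"
      unfolding g_def by (intro tendsto_intros extremal_modulus_tendsto J_tendsto)
    then show "(g \<longlongrightarrow> L * exp ((1 - a) * B / 6)) (at_left 1)" by simp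
    fix z assume z: "z \<in> \<D>" "z \<noteq> 0"
    have "g (cmod z) = cmod z * exp (growth_bound a (cmod z))"
      by (simp add: g_def extremal_modulus_def growth_bound_def exp_add)
    also have "\<dots> \<le> cmod z * exp (Re (G z))"
      using growth[OF w G z(1)] by (intro mult_left_mono) (auto simp: a_def)
    also have "\<dots> = cmod (f z)" using f[OF z(1)] by (simp add: norm_mult)
    finally show "g (cmod z) \<le> cmod (f z)" .
  qed
  then show "L * exp ((1 - cmod (deriv w 0)) * B / 6) \<le> boundary_dist f" by (simp add: a_def)
qed

lemma schwarz_id: "schwarz_function (\<lambda>z. z)"
  by (auto simp: schwarz_function_def)

lemma extremal_exp:
  assumes "is_extremal \<psi> f\<^sub>0" "z \<in> \<D>"
  shows "f\<^sub>0 z = z * exp (F z)"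
proof (rule exp_representation[OF _ hol_F F_0 _ _ assms(2)])
  show "f\<^sub>0 \<in> class_A" using assms by (simp add: is_extremal_def)
qed (use assms deriv_F pos in \<open>auto simp: is_extremal_def Psi_def\<close>)

lemma extremal_inj:
  assumes "is_extremal \<psi> f\<^sub>0"
  shows "inj_on f\<^sub>0 \<D>"
  using starlike_boundary_dist(1)[OF schwarz_id hol_F F_0 deriv_F extremal_exp[OF assms]] .

lemma extremal_at_minus:
  assumes "is_extremal \<psi> f\<^sub>0" "0 \<le> t" "t < 1"
  shows "f\<^sub>0 (- of_real t) = - of_real (extremal_modulus t)"
proof -
  have "f\<^sub>0 (- of_real t) = - of_real t * exp (of_real (Re (F (- of_real t))))"
    using extremal_exp[OF assms(1), of "- of_real t"] F_real[OF assms(2,3)] assms by simp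
  then show ?thesis by (simp add: extremal_modulus_def exp_of_real)
qed

lemma extremal_tendsto:
  assumes "is_extremal \<psi> f\<^sub>0"
  shows "((\<lambda>t. f\<^sub>0 (- of_real t)) \<longlongrightarrow> - of_real L) (at_left 1)"
proof -
  have "((\<lambda>t. - of_real (extremal_modulus t) :: complex) \<longlongrightarrow> - of_real L) (at_left 1)"
    by (intro tendsto_intros extremal_modulus_tendsto)
  then show ?thesis
  proof (rule Lim_transform_eventually)
    show "\<forall>\<^sub>F t in at_left 1. - of_real (extremal_modulus t) = f\<^sub>0 (- of_real t)"
      by (rule eventually_mono[OF eventually_at_left_real[OF zero_less_one]])
        (simp add: extremal_at_minus[OF assms])
  qed
qed

lemma value_at_minus_one: "is_extremal \<psi> f\<^sub>0 \<Longrightarrow> value_at_minus_one f\<^sub>0 = - of_real L"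
  unfolding value_at_minus_one_def by (intro tendsto_Lim extremal_tendsto) auto

text \<open>For the upper bound, - L is a limit of values \<open>f\<^sub>0 (- t)\<close> but not
  itself a value: the continuous inverse would send it to -1, outside the disk. So it lies on the
  frontier, at distance L from 0.\<close>

lemma extremal_boundary_dist:
  assumes f0: "is_extremal \<psi> f\<^sub>0"
  shows "boundary_dist f\<^sub>0 = L"
proof (rule antisym)
  have hol: "f\<^sub>0 holomorphic_on \<D>" "f\<^sub>0 0 = 0" using f0 by (auto simp: is_extremal_def class_A_def)
  note inj = extremal_inj[OF f0]
  have opn: "open (f\<^sub>0 ` \<D>)" by (rule open_mapping_thm3[OF hol(1) open_ball inj])
  show "L \<le> boundary_dist f\<^sub>0"
    using starlike_boundary_dist(2)[OF schwarz_id hol_F F_0 deriv_F extremal_exp[OF f0]] by simp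
  have ev: "\<forall>\<^sub>F t in at_left 1. - of_real t \<in> \<D>"
    by (rule eventually_mono[OF eventually_at_left_real[OF zero_less_one]]) simp
  have "- of_real L \<in> closure (f\<^sub>0 ` \<D>)"
    by (rule Lim_in_closed_set[OF closed_closure _ _ extremal_tendsto[OF f0]])
      (use ev in \<open>auto elim!: eventually_mono intro!: closure_subset[THEN subsetD]\<close>)
  moreover have "- of_real L \<notin> f\<^sub>0 ` \<D>"
  proof
    assume "- of_real L \<in> f\<^sub>0 ` \<D>"
    obtain h where h: "h holomorphic_on f\<^sub>0 ` \<D>" "\<And>z. z \<in> \<D> \<Longrightarrow> h (f\<^sub>0 z) = z"
      using holomorphic_has_inverse[OF hol(1) open_ball inj] by blast
    have "isCont h (- of_real L)"
      using holomorphic_on_imp_continuous_on[OF h(1)] \<open>- of_real L \<in> f\<^sub>0 ` \<D>\<close>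
      unfolding continuous_on_eq_continuous_at[OF opn] by blast
    then have "((\<lambda>t. h (f\<^sub>0 (- of_real t))) \<longlongrightarrow> h (- of_real L)) (at_left 1)"
      by (rule isCont_tendsto_compose) (rule extremal_tendsto[OF f0])
    then have "((\<lambda>t. - of_real t) \<longlongrightarrow> h (- of_real L)) (at_left 1)"
      by (rule Lim_transform_eventually) (use ev h(2) in \<open>auto elim!: eventually_mono\<close>)
    moreover have "((\<lambda>t. - of_real t :: complex) \<longlongrightarrow> - of_real 1) (at_left 1)"
      by (intro tendsto_intros)
    ultimately have "h (- of_real L) = - 1"
      using tendsto_unique[of "at_left (1::real)"] by fastforce
    then show False using h(2) \<open>- of_real L \<in> f\<^sub>0 ` \<D>\<close> by auto
  qed
  ultimately have "- of_real L \<in> frontier (f\<^sub>0 ` \<D>)"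
    using opn by (simp add: frontier_def interior_open)
  then have "boundary_dist f\<^sub>0 \<le> dist (f\<^sub>0 0) (- of_real L)"
    unfolding boundary_dist_def by (rule infdist_le)
  then show "boundary_dist f\<^sub>0 \<le> L" using hol(2) L_pos by simp
qed

end

section \<open>Coefficient bounds\<close>

text \<open>The differentiated Koebe series: x / (1 - x)^2 is the sum of n x^n.\<close>

lemma square_sums:
  fixes x :: real
  assumes "\<bar>x\<bar> < 1"
  shows "(\<lambda>n. (real (Suc n))\<^sup>2 * x ^ n) sums ((1 + x) / (1 - x) ^ 3)"
proof -
  have "(\<lambda>n. diffs real n * x ^ n) sums ((1 + x) / (1 - x) ^ 3)"
  proof (rule termdiffs_sums_strong[where K = 1])
    fix y :: real assume y: "norm y < 1"
    have "(\<lambda>n. y * (of_nat (Suc n) * y ^ n)) sums (y * (1 / (1 - y)\<^sup>2))"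
      by (intro sums_mult geometric_deriv_sums y)
    then have "(\<lambda>n. real (Suc n) * y ^ Suc n) sums (y / (1 - y)\<^sup>2)"
      by (simp add: mult_ac)
    then show "(\<lambda>n. real n * y ^ n) sums (y / (1 - y)\<^sup>2)"
      by (subst (asm) sums_Suc_iff) simp
  qed (use assms koebe_has_derivative[of x] in auto)
  then show ?thesis by (simp add: diffs_def power2_eq_square)
qed

lemma majorant_le_sums:
  assumes f: "f holomorphic_on \<D>" and s: "0 \<le> s" "s < 1"
    and le: "\<And>n. cmod (coeff0 f n) * s ^ n \<le> b n" and b: "b sums c"
  shows "majorant f s \<le> c"
  unfolding majorant_def using suminf_le[OF le summable_majorant[OF f, of s] sums_summable[OF b]] s b
  by (simp add: sums_iff)

text \<open>Bohr's theorem and the tail estimate behind it, for \<phi> = w / z with \<phi> 0 =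
  w'(0). The first part is a Schwarz lemma for majorants.\<close>

lemma majorant_schwarz:
  assumes w: "schwarz_function w" and s: "0 \<le> s" "s \<le> 1/3"
  shows "majorant w s \<le> s"
    and "majorant (\<lambda>z. w z - deriv w 0 * z) s \<le> s * (2 * (1 - cmod (deriv w 0)) * (s / (1 - s)))"
proof -
  obtain \<phi> where \<phi>: "\<phi> holomorphic_on \<D>" "\<And>z. z \<in> \<D> \<Longrightarrow> w z = z * \<phi> z" "\<phi> 0 = deriv w 0"
    "\<And>z. z \<in> \<D> \<Longrightarrow> cmod (\<phi> z) \<le> 1"
    using schwarz_factor[OF w] by blast
  have "majorant w s = majorant (\<lambda>z. z * \<phi> z) s" using \<phi>(2) by (rule majorant_cong)
  also have "\<dots> = s * majorant \<phi> s" using \<phi>(1) s by (intro majorant_times_z) auto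
  also have "\<dots> \<le> s * 1" using bohr_bounded[OF \<phi>(1,4) s] s by (intro mult_left_mono) auto
  finally show "majorant w s \<le> s" by simp
  have "majorant (\<lambda>z. w z - deriv w 0 * z) s = majorant (\<lambda>z. z * (\<phi> z - \<phi> 0)) s"
    using \<phi>(2,3) by (intro majorant_cong) (auto simp: algebra_simps)
  also have "\<dots> = s * majorant (\<lambda>z. \<phi> z - \<phi> 0) s"
    using s by (intro majorant_times_z holomorphic_intros \<phi>) auto
  also have "\<dots> \<le> s * (2 * (1 - cmod (\<phi> 0)) * (s / (1 - s)))"
    using majorant_minus_const_le[OF \<phi>(1,4), of s] s by (intro mult_left_mono) auto
  finally show "majorant (\<lambda>z. w z - deriv w 0 * z) s \<le> s * (2 * (1 - cmod (deriv w 0)) * (s / (1 - s)))"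
    by (simp add: \<phi>(3))
qed

text \<open>At radii up to 1/3 Bohr's theorem bounds the majorant of g' / f' by k, so the majorant
  of g' is at most k times that of f'; integration from 0, where g vanishes, gives the
  claim.\<close>

lemma majorant_le_of_dilatation:
  assumes f: "f holomorphic_on \<D>" and g: "g holomorphic_on \<D>" "g 0 = 0"
    and nz: "\<And>z. z \<in> \<D> \<Longrightarrow> deriv f z \<noteq> 0"
    and k: "\<And>z. z \<in> \<D> \<Longrightarrow> cmod (deriv g z / deriv f z) \<le> k" and r: "0 \<le> r" "r \<le> 1/3"
  shows "majorant g r \<le> k * majorant f r"
proof -
  have df: "deriv f holomorphic_on \<D>" and dg: "deriv g holomorphic_on \<D>"
    by (auto intro!: holomorphic_intros f g)
  have k0: "0 \<le> k" using k[of 0] norm_ge_zero order_trans by (metis centre_in_ball zero_less_one)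
  let ?q = "\<lambda>z. deriv g z / deriv f z"
  have q: "?q holomorphic_on \<D>" using nz by (intro holomorphic_intros df dg) auto
  have le: "majorant (deriv g) s \<le> k * majorant (deriv f) s" if s: "0 \<le> s" "s \<le> 1/3" for s
  proof -
    have "majorant (deriv g) s = majorant (\<lambda>z. ?q z * deriv f z) s"
      using nz by (intro majorant_cong) auto
    also have "\<dots> \<le> majorant ?q s * majorant (deriv f) s"
      using s by (intro majorant_mult q df) auto
    also have "\<dots> \<le> k * majorant (deriv f) s"
      using s bohr_bounded[OF q k s] by (intro mult_right_mono majorant_nonneg df) auto
    finally show ?thesis .
  qed
  have "k * majorant f 0 - majorant g 0 \<le> k * majorant f r - majorant g r"
  proof (rule DERIV_nonneg_imp_nondecreasing[OF r(1)])
    fix s assume s: "0 \<le> s" "s \<le> r"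
    have "((\<lambda>s. k * majorant f s - majorant g s) has_real_derivative
        k * majorant (deriv f) s - majorant (deriv g) s) (at s)"
      using s r by (intro DERIV_diff DERIV_cmult majorant_has_derivative f g) auto
    then show "\<exists>y. ((\<lambda>s. k * majorant f s - majorant g s) has_real_derivative y) (at s) \<and> 0 \<le> y"
      using le[of s] s r by force
  qed
  moreover have "0 \<le> k * majorant f 0 - majorant g 0" using k0 by (simp add: majorant_0 g)
  ultimately show ?thesis by simp
qed

text \<open>
  The left-hand sides come from integrating the two available coefficient bounds \<open>\<bar>Psi\<^sub>n\<bar> \<le> n B\<close> and
  \<open>\<bar>Psi\<^sub>n\<bar> \<le> 2\<close>. Neither bound suffices for all \<open>B\<close>: the first inequality is already an equality for
  \<open>b = 1\<close>, \<open>r = 1/3\<close>.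
\<close>
lemma koebe_range_inequality:
  fixes b r :: real
  assumes "0 < b" "b \<le> 1" "0 \<le> r" "r \<le> 1/3"
  shows "2 * (b * ((r / (1 - r))\<^sup>2 / 2 + 2 * (r / (1 - r)) ^ 3 / 3)) \<le> b * r / (1 + b * r) + b / 6"
proof -
  \<comment> \<open>In terms of v the bound on r is v <= 1/2, and r / (1 + r) = v / (1 + 2
    v).\<close>
  define v where "v = r / (1 - r)"
  have v: "0 \<le> v" "v \<le> 1/2" using assms by (auto simp: v_def field_simps)
  have v2: "1 + 2 * v = (1 + r) / (1 - r)" using assms by (simp add: v_def field_simps)
  have "v\<^sup>2 + 4 * v ^ 3 / 3 \<le> v / (1 + 2 * v) + 1 / 6"
  proof -
    \<comment> \<open>The second factor is largest at v = 1/2, where it is 10, and 10 v <= 1 + 8 v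
      holds exactly for v <= 1/2.\<close>
    have "v * (6 * v + 20 * v\<^sup>2 + 16 * v ^ 3) \<le> v * (6 * (1/2) + 20 * (1/2)\<^sup>2 + 16 * (1/2) ^ 3)"
      using v by (intro mult_left_mono add_mono power_mono) auto
    also have "\<dots> \<le> 1 + 8 * v" using v by (simp add: power2_eq_square power3_eq_cube)
    finally have "(6 * v\<^sup>2 + 8 * v ^ 3) * (1 + 2 * v) \<le> 6 * v + (1 + 2 * v)"
      by (simp add: algebra_simps power2_eq_square power3_eq_cube)
    then have "6 * v\<^sup>2 + 8 * v ^ 3 \<le> (6 * v + (1 + 2 * v)) / (1 + 2 * v)"
      using v by (simp add: pos_le_divide_eq)
    also have "\<dots> = 6 * (v / (1 + 2 * v)) + 1" using v by (subst add_divide_distrib) simp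
    finally show ?thesis by simp
  qed
  also have "v / (1 + 2 * v) = r / (1 + r)" unfolding v2 unfolding v_def using assms by simp
  also have "r / (1 + r) \<le> r / (1 + b * r)"
    using assms mult_right_mono[of b 1 r] by (intro divide_left_mono mult_pos_pos add_pos_nonneg) auto
  finally have "b * (v\<^sup>2 + 4 * v ^ 3 / 3) \<le> b * (r / (1 + b * r) + 1 / 6)"
    using assms by (intro mult_left_mono) auto
  then show ?thesis by (simp add: v_def algebra_simps)
qed

lemma half_plane_range_inequality:
  fixes b r :: real
  assumes "1 \<le> b" "b \<le> 2" "0 \<le> r" "r \<le> 1/3"
  shows "2 * ((r / (1 - r))\<^sup>2 - (2 - b) * (r\<^sup>2 / 2)) \<le> b * r / (1 + b * r) + b / 6"
proof -
  have "r / (1 - r) \<le> 3/2 * r" using assms mult_left_mono[of r "1/3" r] by (simp add: field_simps)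
  then have "(r / (1 - r))\<^sup>2 \<le> (3/2 * r)\<^sup>2" using assms by (intro power_mono) auto
  moreover have "2 * (V - (2 - b) * (r\<^sup>2 / 2)) \<le> (5/2 + b) * (r * r)" if "V \<le> (3/2 * r)\<^sup>2" for V
  proof -
    have "2 * (V - (2 - b) * (r\<^sup>2 / 2)) = 2 * V - 2 * (r * r) + b * (r * r)"
      by (simp add: field_simps power2_eq_square)
    moreover have "V \<le> 9/4 * (r * r)" using that by (simp add: power2_eq_square)
    ultimately show ?thesis unfolding distrib_right by linarith
  qed
  ultimately have "2 * ((r / (1 - r))\<^sup>2 - (2 - b) * (r\<^sup>2 / 2)) \<le> (5/2 + b) * (r * r)" by blast
  \<comment> \<open>Here one factor r, and in the next step the denominator 1 + b r, are frozen at r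
    = 1/3. What remains is affine in r and is reduced to r = 1/3, where it reads 15 - 7 b + 2 b^2 <=
    9 b + 3 b^2.\<close>
  also have "\<dots> \<le> (5/2 + b) * (1/3 * r)" using assms by (intro mult_left_mono mult_right_mono) auto
  also have "\<dots> \<le> b * r / (1 + b * (1/3)) + b / 6"
  proof -
    have "(5/2 + b) * (1/3 * r) * (18 * (3 + b)) \<le> 54 * b * r + 3 * b * (3 + b)"
    proof -
      have "(45 - 21 * b + 6 * b\<^sup>2) * r \<le> (45 - 21 * b + 6 * b\<^sup>2) * (1/3)"
      proof (rule mult_left_mono)
        have "0 \<le> 6 * (b - 7/4)\<^sup>2 + 45 - 6 * 49/16" by (simp add: add_nonneg_nonneg)
        then show "0 \<le> 45 - 21 * b + 6 * b\<^sup>2" by (simp add: power2_eq_square algebra_simps)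
      qed (use assms in auto)
      also have "\<dots> \<le> 9 * b + 3 * b\<^sup>2"
        using assms mult_mono[of 1 b 1 b] by (simp add: power2_eq_square algebra_simps)
      finally show ?thesis by (simp add: algebra_simps power2_eq_square)
    qed
    then have "(5/2 + b) * (1/3 * r) \<le> (54 * b * r + 3 * b * (3 + b)) / (18 * (3 + b))"
      using assms by (simp add: pos_le_divide_eq)
    also have "\<dots> = b * r / (1 + b * (1/3)) + b / 6"
      using assms by (simp add: field_simps)
    finally show ?thesis .
  qed
  also have "b * r / (1 + b * (1/3)) \<le> b * r / (1 + b * r)"
    using assms by (intro divide_left_mono mult_pos_pos add_left_mono mult_left_mono) (auto simp: add_pos_nonneg)
  finally show ?thesis by simp
qed

context ma_minda_function
begin

section \<open>Majorants of \<open>Psi'\<close> and of the logarithmic perturbation\<close>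

lemma majorant_deriv_Psi_le_koebe:
  assumes s: "0 \<le> s" "s < 1"
  shows "majorant (deriv Psi) s \<le> B * ((1 + s) / (1 - s) ^ 3)"
proof (rule majorant_le_sums[OF _ s])
  show "deriv Psi holomorphic_on \<D>" by (intro holomorphic_intros hol_Psi) auto
  show "(\<lambda>n. B * ((real (Suc n))\<^sup>2 * s ^ n)) sums (B * ((1 + s) / (1 - s) ^ 3))"
    using s by (intro sums_mult square_sums) auto
  fix n
  have "cmod (coeff0 (deriv Psi) n) = real (Suc n) * cmod (coeff0 Psi (Suc n))"
    by (simp add: coeff_deriv[OF hol_Psi] norm_mult del: of_nat_Suc)
  also have "\<dots> \<le> real (Suc n) * (real (Suc n) * B)"
    by (intro mult_left_mono coeff_Psi_le) auto
  finally have "cmod (coeff0 (deriv Psi) n) * s ^ n \<le> real (Suc n) * (real (Suc n) * B) * s ^ n"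
    using s by (intro mult_right_mono) auto
  then show "cmod (coeff0 (deriv Psi) n) * s ^ n \<le> B * ((real (Suc n))\<^sup>2 * s ^ n)"
    by (simp add: power2_eq_square mult_ac)
qed

text \<open>Every coefficient of \<open>Psi\<close> is bounded by 2, but the first one has modulus
  B: hence the correction B - 2.\<close>

lemma majorant_deriv_Psi_le_half_plane:
  assumes s: "0 \<le> s" "s < 1"
  shows "majorant (deriv Psi) s \<le> B - 2 + 2 / (1 - s)\<^sup>2"
proof (rule majorant_le_sums[OF _ s])
  show "deriv Psi holomorphic_on \<D>" by (intro holomorphic_intros hol_Psi) auto
  have "(\<lambda>n. (if n = 0 then B - 2 else 0) + 2 * (of_nat (Suc n) * s ^ n)) sums ((B - 2) + 2 * (1 / (1 - s)\<^sup>2))"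
    using s by (intro sums_add sums_mult geometric_deriv_sums sums_single) auto
  then show "(\<lambda>n. (if n = 0 then B - 2 else 0) + 2 * (of_nat (Suc n) * s ^ n)) sums (B - 2 + 2 / (1 - s)\<^sup>2)"
    by simp
  fix n
  have c: "cmod (coeff0 (deriv Psi) n) = real (Suc n) * cmod (coeff0 Psi (Suc n))"
    by (simp add: coeff_deriv[OF hol_Psi] norm_mult del: of_nat_Suc)
  show "cmod (coeff0 (deriv Psi) n) * s ^ n \<le> (if n = 0 then B - 2 else 0) + 2 * (of_nat (Suc n) * s ^ n)"
  proof (cases "n = 0")
    case True
    then show ?thesis using c coeff_Psi_1 by simp
  next
    case False
    have "real (Suc n) * cmod (coeff0 Psi (Suc n)) * s ^ n \<le> real (Suc n) * 2 * s ^ n"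
      using s by (intro mult_right_mono mult_left_mono coeff_Psi_le_2) auto
    then show ?thesis using False c by (simp add: mult_ac del: of_nat_Suc)
  qed
qed

text \<open>T is an antiderivative of a bound for the majorant of \<open>Psi'\<close> times s / (1 -
  s), with coefficient bounds n B for B <= 1 and 2 for B > 1. In the conclusion,
  \<open>majorant_H_scale\<close> gains back the part B r / (1 + B r), and B / 6 is what the
  boundary distance allows; the application has c = 2 (1 - a).\<close>

lemma majorant_log_perturbation:
  assumes D: "D holomorphic_on \<D>" "D 0 = 0"
    and le: "\<And>s. 0 < s \<Longrightarrow> s \<le> 1/3 \<Longrightarrow> majorant (deriv D) s \<le> majorant (deriv Psi) s * (c * (s / (1 - s)))"
    and c: "0 \<le> c" and r: "0 \<le> r" "r \<le> 1/3"
  shows "2 * majorant D r \<le> c * (B * r / (1 + B * r) + B / 6)"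
proof -
  have main: "majorant D r \<le> c * T r"
    if T: "T 0 = 0" "\<And>s. 0 \<le> s \<Longrightarrow> s < 1 \<Longrightarrow> (T has_real_derivative T' s) (at s)"
      "\<And>s. 0 \<le> s \<Longrightarrow> s < 1 \<Longrightarrow> majorant (deriv Psi) s * (s / (1 - s)) \<le> T' s" for T T'
  proof -
    have d: "((\<lambda>s. c * T s - majorant D s) has_real_derivative c * T' s - majorant (deriv D) s) (at s)"
      if "0 \<le> s" "s \<le> r" for s
      using that r by (intro DERIV_diff DERIV_cmult T(2) majorant_has_derivative D) auto
    \<comment> \<open>The hypothesis speaks of s > 0, so monotonicity is derived from the open
      interval and continuity.\<close>
    have "c * T 0 - majorant D 0 \<le> c * T r - majorant D r"
    proof (rule DERIV_nonneg_imp_increasing_open[OF r(1)])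
      fix s assume s: "0 < s" "s < r"
      have "majorant (deriv D) s \<le> c * (majorant (deriv Psi) s * (s / (1 - s)))"
        using le[of s] s r by (simp add: mult_ac)
      also have "\<dots> \<le> c * T' s" using s r c by (intro mult_left_mono T(3)) auto
      finally show "\<exists>y. ((\<lambda>s. c * T s - majorant D s) has_real_derivative y) (at s) \<and> 0 \<le> y"
        using d[of s] s by force
    next
      show "continuous_on {0..r} (\<lambda>s. c * T s - majorant D s)"
        using d by (intro DERIV_atLeastAtMost_imp_continuous_on) blast
    qed
    then show ?thesis by (simp add: T(1) majorant_0 D(2))
  qed
  have v: "((\<lambda>s. s / (1 - s)) has_real_derivative 1 / (1 - s)\<^sup>2) (at s)" if "s < 1" for s :: real
    using that by (auto intro!: derivative_eq_intros simp: power2_eq_square)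
  have "\<exists>T. majorant D r \<le> c * T \<and> 2 * T \<le> B * r / (1 + B * r) + B / 6"
  proof (cases "B \<le> 1")
    case True
    define T where "T s = B * ((s / (1 - s))\<^sup>2 / 2 + 2 * (s / (1 - s)) ^ 3 / 3)" for s
    have "majorant D r \<le> c * T r"
    proof (rule main)
      show "T 0 = 0" by (simp add: T_def)
      fix s :: real assume s: "0 \<le> s" "s < 1"
      show "(T has_real_derivative B * ((1 + s) / (1 - s) ^ 3) * (s / (1 - s))) (at s)"
      proof -
        have "(T has_real_derivative B * ((real 2 * (1 / (1 - s)\<^sup>2 * (s / (1 - s)) ^ (2 - Suc 0))) / 2
            + 2 * (real 3 * (1 / (1 - s)\<^sup>2 * (s / (1 - s)) ^ (3 - Suc 0))) / 3)) (at s)"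
          unfolding T_def
          by (intro DERIV_cmult DERIV_add DERIV_cdivide DERIV_power v s)
        moreover have "B * ((real 2 * (1 / (1 - s)\<^sup>2 * (s / (1 - s)) ^ (2 - Suc 0))) / 2
            + 2 * (real 3 * (1 / (1 - s)\<^sup>2 * (s / (1 - s)) ^ (3 - Suc 0))) / 3) =
            B * ((1 + s) / (1 - s) ^ 3) * (s / (1 - s))"
        proof -
          have "1 + 2 * (s / (1 - s)) = (1 + s) / (1 - s)" using s by (simp add: field_simps)
          moreover have "u + 2 * u\<^sup>2 = (1 + 2 * u) * u" for u :: real
            by (simp add: algebra_simps power2_eq_square)
          ultimately have e1: "s / (1 - s) + 2 * (s / (1 - s))\<^sup>2 = (1 + s) / (1 - s) * (s / (1 - s))"
            by presburger
          have e2: "B * ((real 2 * (p * u ^ (2 - Suc 0))) / 2 + 2 * (real 3 * (p * u ^ (3 - Suc 0))) / 3)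
              = B * (p * (u + 2 * u\<^sup>2))" for p u
            by (simp add: algebra_simps power2_eq_square)
          show ?thesis unfolding e2 e1 by (simp add: power2_eq_square power3_eq_cube mult_ac)
        qed
        ultimately show ?thesis by simp
      qed
      show "majorant (deriv Psi) s * (s / (1 - s)) \<le> B * ((1 + s) / (1 - s) ^ 3) * (s / (1 - s))"
        using s by (intro mult_right_mono majorant_deriv_Psi_le_koebe) auto
    qed
    then show ?thesis
      using koebe_range_inequality[OF B_pos True r] by (intro exI[of _ "T r"]) (simp add: T_def)
  next
    case False
    define T where "T s = (s / (1 - s))\<^sup>2 - (2 - B) * (s\<^sup>2 / 2)" for s
    have "majorant D r \<le> c * T r"
    proof (rule main)
      show "T 0 = 0" by (simp add: T_def)
      fix s :: real assume s: "0 \<le> s" "s < 1"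
      show "(T has_real_derivative 2 * (s / (1 - s)) / (1 - s)\<^sup>2 - (2 - B) * s) (at s)"
      proof -
        have "(T has_real_derivative real 2 * (1 / (1 - s)\<^sup>2 * (s / (1 - s)) ^ (2 - Suc 0))
            - (2 - B) * (real 2 * (1 * s ^ (2 - Suc 0)) / 2)) (at s)"
          unfolding T_def
          by (intro DERIV_cmult DERIV_diff DERIV_cdivide DERIV_power DERIV_ident v s)
        then show ?thesis by (simp add: mult.commute)
      qed
      have "majorant (deriv Psi) s * (s / (1 - s)) \<le> (B - 2 + 2 / (1 - s)\<^sup>2) * (s / (1 - s))"
        using s by (intro mult_right_mono majorant_deriv_Psi_le_half_plane) auto
      also have "\<dots> = 2 * (s / (1 - s)) / (1 - s)\<^sup>2 - (2 - B) * (s / (1 - s))"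
        by (simp add: algebra_simps)
      \<comment> \<open>Weakening s / (1 - s) to s keeps logarithms out of the
        antiderivative.\<close>
      also have "\<dots> \<le> 2 * (s / (1 - s)) / (1 - s)\<^sup>2 - (2 - B) * s"
        using s B_le_2 mult_left_mono[of "1 - s" 1 s]
        by (intro diff_left_mono mult_left_mono) (auto simp: field_simps)
      finally show "majorant (deriv Psi) s * (s / (1 - s)) \<le> 2 * (s / (1 - s)) / (1 - s)\<^sup>2 - (2 - B) * s" .
    qed
    then show ?thesis
      using half_plane_range_inequality[of B r] False B_le_2 r by (intro exI[of _ "T r"]) (simp add: T_def)
  qed
  then obtain T where "majorant D r \<le> c * T" "2 * T \<le> B * r / (1 + B * r) + B / 6" by blast
  then show ?thesis using mult_left_mono[of "2 * T" _ c] c by fastforce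
qed

text \<open>On the disk this is \<open>f\<^sub>0 z / z\<close>.\<close>

definition H :: "complex \<Rightarrow> complex" where "H z = exp (F z)"

lemma hol_H: "H holomorphic_on \<D>"
  unfolding H_def by (intro holomorphic_intros hol_F)

lemma coeff_H: "cmod (coeff0 H 0) = 1" "cmod (coeff0 H (Suc 0)) = B"
proof -
  show "cmod (coeff0 H 0) = 1" by (simp add: coeff_0 H_def F_0)
  have dF: "deriv F holomorphic_on \<D>" by (intro holomorphic_intros hol_F) auto
  have "coeff0 (\<lambda>z. z * deriv F z) (Suc 0) = coeff0 Psi (Suc 0)"
    using deriv_F by (intro coeff_cong) auto
  then have "deriv F 0 = deriv Psi 0" by (simp add: coeff_times_z[OF dF] coeff_0 coeff_1)
  then have "(F has_field_derivative of_real B) (at 0)"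
    using holomorphic_derivI[OF hol_F, of 0] by (simp add: deriv_Psi deriv_psi_0)
  then have "(H has_field_derivative exp (F 0) * of_real B) (at 0)"
    unfolding H_def by (intro DERIV_chain2[OF DERIV_exp])
  then have "deriv H 0 = of_real B" by (simp add: DERIV_imp_deriv F_0)
  then show "cmod (coeff0 H (Suc 0)) = B" using B_pos by (simp add: coeff_1)
qed

text \<open>The terms of order 0 and 1 give 1 + a B r exactly; the tail starts at order 2 and
  shrinks at least by the factor a, which is at most (1 + a B r) / (1 + B r).\<close>

lemma majorant_H_scale:
  assumes a: "0 \<le> a" "a \<le> 1" and r: "0 \<le> r" "r < 1"
  shows "(1 + B * r) * majorant H (a * r) \<le> (1 + a * B * r) * majorant H r"
proof -
  define S where "S x = (\<Sum>n. cmod (coeff0 H (n + 2)) * x ^ (n + 2))" for x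
  have ar: "0 \<le> a * r" "a * r < 1" using a r mult_right_mono[of a 1 r] by auto
  have sm: "summable (\<lambda>n. cmod (coeff0 H (n + 2)) * x ^ (n + 2))" if "0 \<le> x" "x < 1" for x
    using summable_ignore_initial_segment[OF summable_majorant[OF hol_H], of x 2] that by simp
  have maj: "majorant H x = 1 + B * x + S x" if "0 \<le> x" "x < 1" for x
    using suminf_split_initial_segment[OF summable_majorant[OF hol_H], of x 2] that coeff_H
    by (simp add: majorant_def S_def numeral_2_eq_2)
  have S0: "0 \<le> S r" unfolding S_def by (rule suminf_nonneg) (use sm r in auto)
  have "S (a * r) \<le> (\<Sum>n. a * (cmod (coeff0 H (n + 2)) * r ^ (n + 2)))"
    unfolding S_def
  proof (rule suminf_le)
    fix n
    have "a ^ (n + 2) \<le> a ^ 1" using a by (intro power_decreasing) auto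
    then have "(cmod (coeff0 H (n + 2)) * r ^ (n + 2)) * a ^ (n + 2) \<le> (cmod (coeff0 H (n + 2)) * r ^ (n + 2)) * a"
      using r by (intro mult_left_mono) auto
    then show "cmod (coeff0 H (n + 2)) * (a * r) ^ (n + 2) \<le> a * (cmod (coeff0 H (n + 2)) * r ^ (n + 2))"
      by (simp only: power_mult_distrib mult_ac)
  qed (use sm ar r in \<open>auto intro!: summable_mult\<close>)
  also have "\<dots> = a * S r" unfolding S_def by (rule suminf_mult) (use sm r in auto)
  finally have Sa: "S (a * r) \<le> a * S r" .
  have "(1 + B * r) * S (a * r) \<le> (1 + B * r) * (a * S r)"
    using Sa B_pos r by (intro mult_left_mono) (auto simp: add_nonneg_nonneg)
  also have "\<dots> = (a + a * B * r) * S r" by (simp add: algebra_simps)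
  also have "\<dots> \<le> (1 + a * B * r) * S r" using a S0 by (intro mult_right_mono) auto
  finally show ?thesis
    unfolding maj[OF r] maj[OF ar] by (simp add: algebra_simps)
qed

text \<open>In exponents: the majorant of H (w'(0) z) lies below that of H by (1 - a) B r / (1 + B
  r), from 1 - x <= exp (- x), and the factor exp D costs (1 - a) (B r / (1 + B r) + B / 6). Only (1
  - a) B / 6 remains.\<close>

lemma starlike_majorant:
  assumes w: "schwarz_function w" and G: "G holomorphic_on \<D>" "G 0 = 0"
    "\<And>z. z \<in> \<D> \<Longrightarrow> z * deriv G z = Psi (w z)" and f: "\<And>z. z \<in> \<D> \<Longrightarrow> f z = z * exp (G z)"
    and r: "0 \<le> r" "r \<le> 1/3"
  shows "majorant f r \<le> r * majorant H r * exp ((1 - cmod (deriv w 0)) * B / 6)"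
proof -
  define a where "a = cmod (deriv w 0)"
  have a: "0 \<le> a" "a \<le> 1"
    using Schwarz_Lemma(2)[OF schwarz_functionD(1,2,4)[OF w], of 0] by (auto simp: a_def)
  have scaleD: "deriv w 0 * z \<in> \<D>" if "z \<in> \<D>" for z
    using that a mult_left_le_one_le[of "cmod z" a] by (simp add: norm_mult a_def)
  have scale: "(\<lambda>z. h (deriv w 0 * z)) holomorphic_on \<D>" if "h holomorphic_on \<D>" for h
  proof -
    have "h \<circ> (\<lambda>z. deriv w 0 * z) holomorphic_on \<D>"
      using scaleD by (intro holomorphic_on_compose_gen[OF _ that] holomorphic_intros) blast
    then show ?thesis by (simp add: o_def)
  qed
  \<comment> \<open>D collects what separates w from its linear part w'(0) z; z D' is a difference
    of two values of \<open>Psi\<close>, so \<open>majorant_compose_diff\<close> applies.\<close>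
  define D where "D z = G z - F (deriv w 0 * z)" for z
  have D: "D holomorphic_on \<D>" "D 0 = 0"
    unfolding D_def by (auto intro!: holomorphic_on_diff scale hol_F G simp: F_0)
  have dD: "deriv D holomorphic_on \<D>" by (intro holomorphic_intros D) auto
  have zdD: "z * deriv D z = Psi (w z) - Psi (deriv w 0 * z)" if z: "z \<in> \<D>" for z
  proof -
    have "((\<lambda>z. F (deriv w 0 * z)) has_field_derivative deriv F (deriv w 0 * z) * deriv w 0) (at z)"
      by (rule DERIV_chain2[where g = "\<lambda>z. deriv w 0 * z", OF holomorphic_derivI[OF hol_F open_ball scaleD[OF z]]])
        (auto intro!: derivative_eq_intros)
    from DERIV_diff[OF holomorphic_derivI[OF G(1) open_ball z] this]
    have dDz: "deriv D z = deriv G z - deriv F (deriv w 0 * z) * deriv w 0"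
      unfolding D_def by (rule DERIV_imp_deriv)
    have "z * deriv D z = z * deriv G z - (deriv w 0 * z) * deriv F (deriv w 0 * z)"
      unfolding dDz by (simp add: algebra_simps)
    then show ?thesis unfolding G(3)[OF z] deriv_F[OF scaleD[OF z]] .
  qed
  have le: "majorant (deriv D) s \<le> majorant (deriv Psi) s * (2 * (1 - a) * (s / (1 - s)))"
    if s: "0 < s" "s \<le> 1/3" for s
  proof -
    have s1: "0 \<le> s" "s < 1" using s by auto
    have "s * majorant (deriv D) s = majorant (\<lambda>z. z * deriv D z) s"
      using majorant_times_z[OF dD s1] by simp
    also have "\<dots> = majorant (\<lambda>z. Psi (w z) - Psi (deriv w 0 * z)) s"
      using zdD by (rule majorant_cong)
    also have "\<dots> \<le> majorant (deriv Psi) s * (s * (2 * (1 - a) * (s / (1 - s))))"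
    proof (rule majorant_compose_diff[OF hol_Psi _ _ _ _ _ _ s1])
      show "majorant w s \<le> s" by (rule majorant_schwarz(1)[OF w s1(1) s(2)])
      show "majorant (\<lambda>z. w z - deriv w 0 * z) s \<le> s * (2 * (1 - a) * (s / (1 - s)))"
        unfolding a_def by (rule majorant_schwarz(2)[OF w s1(1) s(2)])
      have "majorant (\<lambda>z. deriv w 0 * z) s = majorant (\<lambda>z. z * deriv w 0) s" by (simp add: mult.commute)
      also have "\<dots> = s * a"
        using majorant_times_z[of "\<lambda>z. deriv w 0" s] s1 by (simp add: majorant_const a_def)
      finally show "majorant (\<lambda>z. deriv w 0 * z) s \<le> s" using a s mult_left_le[of a s] by simp
    qed (use schwarz_functionD[OF w] scaleD in \<open>auto intro!: holomorphic_intros\<close>)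
    finally have "s * majorant (deriv D) s \<le> s * (majorant (deriv Psi) s * (2 * (1 - a) * (s / (1 - s))))"
      by (simp add: mult_ac)
    then show ?thesis using s(1) by (rule mult_left_le_imp_le)
  qed
  have r1: "r < 1" using r by simp
  have ar: "0 \<le> a * r" "a * r < 1" using a r mult_right_mono[of a 1 r] by auto
  have mD: "majorant D r \<le> (1 - a) * (B * r / (1 + B * r) + B / 6)"
  proof -
    have "2 * majorant D r \<le> 2 * (1 - a) * (B * r / (1 + B * r) + B / 6)"
      using a by (intro majorant_log_perturbation[OF D le _ r]) auto
    then show ?thesis unfolding mult.assoc by simp
  qed
  have "majorant f r = majorant (\<lambda>z. z * (H (deriv w 0 * z) * exp (D z))) r"
    using f by (intro majorant_cong) (simp add: H_def D_def flip: exp_add)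
  also have "\<dots> = r * majorant (\<lambda>z. H (deriv w 0 * z) * exp (D z)) r"
    by (intro majorant_times_z r r1 holomorphic_intros scale hol_H D)
  also have "\<dots> \<le> r * (majorant (\<lambda>z. H (deriv w 0 * z)) r * majorant (\<lambda>z. exp (D z)) r)"
    using r by (intro mult_left_mono majorant_mult r r1 holomorphic_intros scale hol_H D)
  also have "majorant (\<lambda>z. H (deriv w 0 * z)) r = majorant H (a * r)"
    unfolding majorant_def coeff_scale[OF hol_H a(2)[unfolded a_def]]
    by (simp add: norm_mult norm_power a_def power_mult_distrib mult_ac)
  also have "r * (majorant H (a * r) * majorant (\<lambda>z. exp (D z)) r) \<le>
      r * ((majorant H r * exp (- ((1 - a) * (B * r / (1 + B * r))))) * exp ((1 - a) * (B * r / (1 + B * r) + B / 6)))"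
  proof (intro mult_left_mono mult_mono)
    have Br: "0 < 1 + B * r" using B_pos r by (simp add: add_pos_nonneg)
    have "majorant H (a * r) \<le> majorant H r * ((1 + a * B * r) / (1 + B * r))"
      using majorant_H_scale[OF a r(1) r1] Br by (simp add: field_simps)
    also have "(1 + a * B * r) / (1 + B * r) = 1 + - ((1 - a) * (B * r / (1 + B * r)))"
      using Br by (simp add: field_simps)
    also have "majorant H r * \<dots> \<le> majorant H r * exp (- ((1 - a) * (B * r / (1 + B * r))))"
      by (intro mult_left_mono exp_ge_add_one_self majorant_nonneg hol_H r r1)
    finally show "majorant H (a * r) \<le> majorant H r * exp (- ((1 - a) * (B * r / (1 + B * r))))" .
    show "majorant (\<lambda>z. exp (D z)) r \<le> exp ((1 - a) * (B * r / (1 + B * r) + B / 6))"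
      using majorant_exp[OF D r(1) r1] mD by (meson exp_le_cancel_iff order_trans)
    show "0 \<le> majorant H r * exp (- ((1 - a) * (B * r / (1 + B * r))))"
      by (intro mult_nonneg_nonneg majorant_nonneg hol_H r r1) auto
    show "0 \<le> majorant (\<lambda>z. exp (D z)) r" by (intro majorant_nonneg holomorphic_intros D r r1)
  qed (use r in auto)
  also have "\<dots> = r * majorant H r * exp ((1 - a) * B / 6)"
    by (simp add: distrib_left mult.assoc flip: exp_add)
  finally show ?thesis by (simp add: a_def)
qed

end

section \<open>The Bohr radius\<close>

text \<open>Caratheodory's inequality with Re (h 0) = 0 makes every coefficient of positive order
  vanish.\<close>

lemma imaginary_holomorphic_constant:
  assumes h: "h holomorphic_on \<D>" and re: "\<And>z. z \<in> \<D> \<Longrightarrow> Re (h z) = 0" and z: "z \<in> \<D>"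
  shows "h z = h 0"
proof -
  have "coeff0 h n = 0" if "0 < n" for n
    using caratheodory_coeff[OF h _ that] re by simp
  then have "(\<lambda>n. coeff0 h n * z ^ n) = (\<lambda>n. if n = 0 then h 0 else 0)"
    by (auto simp: coeff_0)
  then have "(\<lambda>n. if n = 0 then h 0 else 0) sums h z"
    using power_series_disk[OF h z] by simp
  then show ?thesis using sums_unique2[OF _ sums_single[of 0 "\<lambda>_. h 0"]] by simp
qed

text \<open>
  Both maps are normalised by \<open>f'(0) = 1\<close>, so the Schwarz function of the subordination has
  derivative 1 at 0 and is the identity.
\<close>
lemma normalised_subordinate_eq:
  assumes f: "f \<in> class_A" "g holomorphic_on \<D>" "g 0 = 0"
    and f1: "f\<^sub>1 \<in> class_A" "harmonic_parts f\<^sub>1 g\<^sub>1"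
    and sub: "harmonic_map f\<^sub>1 g\<^sub>1 \<prec>\<^sub>s harmonic_map f g" and z: "z \<in> \<D>"
  shows "f\<^sub>1 z = f z" "g\<^sub>1 z = g z"
proof -
  have hf: "f holomorphic_on \<D>" "f 0 = 0" "deriv f 0 = 1" using f(1) by (auto simp: class_A_def)
  have hf1: "f\<^sub>1 holomorphic_on \<D>" "f\<^sub>1 0 = 0" "deriv f\<^sub>1 0 = 1" using f1(1) by (auto simp: class_A_def)
  have hg1: "g\<^sub>1 holomorphic_on \<D>" "g\<^sub>1 0 = 0" using f1(2) by (auto simp: harmonic_parts_def)
  obtain w where w: "schwarz_function w"
    and eq: "\<And>z. z \<in> \<D> \<Longrightarrow> f\<^sub>1 z + cnj (g\<^sub>1 z) = f (w z) + cnj (g (w z))"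
    using sub by (auto simp: subordinate_def harmonic_map_def)
  have comp: "(\<lambda>z. h (w z)) holomorphic_on \<D>" if "h holomorphic_on \<D>" for h
    using holomorphic_on_compose_gen[OF schwarz_functionD(1)[OF w] that] w
    by (simp add: o_def schwarz_function_def)
  define u where "u z = f\<^sub>1 z - f (w z)" for z
  define v where "v z = g (w z) - g\<^sub>1 z" for z
  have hu: "u holomorphic_on \<D>" and hv: "v holomorphic_on \<D>"
    unfolding u_def v_def by (intro holomorphic_intros hf1 hg1 comp hf f)+
  \<comment> \<open>A holomorphic function equals the conjugate of another one: u - v is purely
    imaginary and u + v is real, so both are constant.\<close>
  have uv: "u z = cnj (v z)" if "z \<in> \<D>" for z
    using eq[OF that] by (simp add: u_def v_def algebra_simps)
  have 0: "u 0 = 0" "v 0 = 0" using hf hf1 hg1 f(3) schwarz_functionD(2)[OF w] by (simp_all add: u_def v_def)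
  have uv0: "u z = 0 \<and> v z = 0" if z: "z \<in> \<D>" for z
  proof -
    have "u z - v z = u 0 - v 0"
      by (rule imaginary_holomorphic_constant[OF _ _ z]) (use uv in \<open>auto intro!: holomorphic_intros hu hv\<close>)
    moreover have "\<i> * (u z + v z) = \<i> * (u 0 + v 0)"
      by (rule imaginary_holomorphic_constant[OF _ _ z]) (use uv in \<open>auto intro!: holomorphic_intros hu hv\<close>)
    ultimately show ?thesis using 0 by (simp add: algebra_simps)
  qed
  have "deriv w 0 = 1"
  proof -
    have "(w has_field_derivative deriv w 0) (at 0)"
      using holomorphic_derivI[OF schwarz_functionD(1)[OF w] open_ball] by simp
    moreover have "(f has_field_derivative 1) (at (w 0))"
      using holomorphic_derivI[OF hf(1) open_ball, of 0] hf(3) schwarz_functionD(2)[OF w] by simp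
    ultimately have "((\<lambda>z. f (w z)) has_field_derivative 1 * deriv w 0) (at 0)"
      using DERIV_chain2 by blast
    then have "(f\<^sub>1 has_field_derivative 1 * deriv w 0) (at 0)"
      by (rule has_field_derivative_transform_within_open[of _ _ _ \<D>]) (use uv0 in \<open>auto simp: u_def\<close>)
    then show ?thesis using hf1(3) by (simp add: DERIV_imp_deriv)
  qed
  then have "w z = z" by (rule schwarz_rigid[OF w _ z])
  then show "f\<^sub>1 z = f z" "g\<^sub>1 z = g z" using uv0[OF z] by (simp_all add: u_def v_def)
qed

lemma bohr_sum_majorant:
  assumes "f holomorphic_on \<D>" "f 0 = 0" "g holomorphic_on \<D>" "g 0 = 0" "0 \<le> r" "r < 1"
  shows "bohr_sum f g r = majorant f r + majorant g r"
proof -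
  have sm: "summable (\<lambda>n. cmod (coeff0 h n) * r ^ n)" if "h holomorphic_on \<D>" for h
    using summable_majorant[OF that] assms by simp
  have "majorant h r = (\<Sum>m. cmod (coeff0 h (Suc m)) * r ^ Suc m)"
    if "h holomorphic_on \<D>" "h 0 = 0" for h
    unfolding majorant_def using suminf_split_head[OF sm[OF that(1)]] that(2) by (simp add: coeff_0)
  moreover have "summable (\<lambda>m. cmod (coeff0 h (Suc m)) * r ^ Suc m)" if "h holomorphic_on \<D>" for h
    using sm[OF that] by (subst summable_Suc_iff)
  ultimately show ?thesis
    using assms by (simp add: bohr_sum_def suminf_add distrib_right)
qed

lemma hat_eq_majorant:
  assumes f: "f \<in> class_A" and r: "0 \<le> r" "r < 1"
  shows "hat f r = majorant f r"
proof -
  have h: "f holomorphic_on \<D>" "f 0 = 0" "deriv f 0 = 1" using f by (auto simp: class_A_def)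
  show ?thesis
    using suminf_split_initial_segment[OF summable_majorant[OF h(1)], of r 2] r h
    by (simp add: majorant_def hat_def numeral_2_eq_2 coeff_0 coeff_1)
qed

lemma hat_strict_mono:
  assumes f: "f \<in> class_A" and r: "0 \<le> r" "r < s" "s < 1"
  shows "hat f r < hat f s"
proof -
  have h: "f holomorphic_on \<D>" using f by (auto simp: class_A_def)
  have sm: "summable (\<lambda>n. cmod (coeff0 f (n + 2)) * x ^ (n + 2))" if "0 \<le> x" "x < 1" for x
    using summable_ignore_initial_segment[OF summable_majorant[OF h], of x 2] that by simp
  have "(\<Sum>n. cmod (coeff0 f (n + 2)) * r ^ (n + 2)) \<le> (\<Sum>n. cmod (coeff0 f (n + 2)) * s ^ (n + 2))"
  proof (rule suminf_le)
    show "cmod (coeff0 f (n + 2)) * r ^ (n + 2) \<le> cmod (coeff0 f (n + 2)) * s ^ (n + 2)" for n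
      using r by (intro mult_left_mono power_mono) auto
  qed (use r in \<open>auto intro!: sm simp del: add_2_eq_Suc'\<close>)
  then show ?thesis using r by (simp add: hat_def)
qed

text \<open>The map is f followed by the real-linear map y + k cnj y, which S inverts because k <
  1.\<close>

lemma affine_harmonic_homeomorphism:
  assumes f: "f holomorphic_on \<D>" "inj_on f \<D>" and k: "0 \<le> k" "k < 1"
  shows "\<exists>h'. homeomorphism \<D> (harmonic_map f (\<lambda>z. of_real k * f z) ` \<D>)
    (harmonic_map f (\<lambda>z. of_real k * f z)) h'"
proof -
  obtain p where p: "p holomorphic_on f ` \<D>" "\<And>z. z \<in> \<D> \<Longrightarrow> p (f z) = z"
    using holomorphic_has_inverse[OF f(1) open_ball f(2)] by blast
  define S :: "complex \<Rightarrow> complex" where "S y = (y - of_real k * cnj y) / of_real (1 - k\<^sup>2)" for y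
  let ?h = "harmonic_map f (\<lambda>z. of_real k * f z)"
  have "k\<^sup>2 < 1" using k by (simp add: power_less_one_iff)
  then have "(1 - (of_real k)\<^sup>2 :: complex) \<noteq> 0"
    by (metis less_irrefl of_real_1 of_real_eq_iff of_real_power right_minus_eq)
  then have S: "S (?h z) = f z" for z
    by (simp add: S_def harmonic_map_def field_simps power2_eq_square)
  have "homeomorphism \<D> (?h ` \<D>) ?h (\<lambda>y. p (S y))"
  proof (rule homeomorphismI)
    show "continuous_on \<D> ?h"
      unfolding harmonic_map_def by (intro continuous_intros holomorphic_on_imp_continuous_on f)
    show "continuous_on (?h ` \<D>) (\<lambda>y. p (S y))"
      by (rule continuous_on_compose2[OF holomorphic_on_imp_continuous_on[OF p(1)]])
        (auto simp: S, auto simp: S_def[abs_def] divide_inverse intro!: continuous_intros)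
  qed (use S p in auto)
  then show ?thesis by blast
qed

context ma_minda_function
begin

lemma extremal_majorant:
  assumes f0: "is_extremal \<psi> f\<^sub>0" and r: "0 \<le> r" "r < 1"
  shows "hat f\<^sub>0 r = r * majorant H r"
proof -
  have "hat f\<^sub>0 r = majorant f\<^sub>0 r" using f0 r by (intro hat_eq_majorant) (simp add: is_extremal_def)
  also have "\<dots> = majorant (\<lambda>z. z * H z) r"
    using extremal_exp[OF f0] by (intro majorant_cong) (simp add: H_def)
  also have "\<dots> = r * majorant H r" using hol_H r by (rule majorant_times_z)
  finally show ?thesis .
qed

lemma radius_exists:
  assumes f0: "is_extremal \<psi> f\<^sub>0" and c: "1 \<le> c"
  obtains r\<^sub>0 where "0 < r\<^sub>0" "r\<^sub>0 < 1" "c * hat f\<^sub>0 r\<^sub>0 = L"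
proof -
  \<comment> \<open>A radius for the intermediate value theorem: the terms \<rho> + B \<rho>^2 of
    \<open>hat f\<^sub>0\<close> already reach 1 >= L here. The check amounts to B^2 / 9 <= 2 B / 3,
    which follows from B <= 2.\<close>
  define \<rho> where "\<rho> = 1 / (1 + B / 3)"
  have \<rho>: "0 < \<rho>" "\<rho> < 1" using B_pos by (auto simp: \<rho>_def field_simps)
  have A: "f\<^sub>0 \<in> class_A" using f0 by (simp add: is_extremal_def)
  have "1 \<le> \<rho> * (1 + B * \<rho>)"
  proof -
    have "(1 + B / 3)\<^sup>2 \<le> 1 + B / 3 + B"
      using mult_left_mono[OF B_le_2, of B] B_pos by (simp add: power2_eq_square field_simps)
    moreover have "\<rho> * (1 + B * \<rho>) = (1 + B / 3 + B) / (1 + B / 3)\<^sup>2"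
      using B_pos by (simp add: \<rho>_def power2_eq_square divide_simps) (simp add: algebra_simps)
    ultimately show ?thesis using B_pos by (simp add: pos_le_divide_eq)
  qed
  also have "\<dots> \<le> \<rho> * majorant H \<rho>"
  proof (rule mult_left_mono)
    have "(\<Sum>n<2. cmod (coeff0 H n) * \<rho> ^ n) \<le> majorant H \<rho>"
      using \<rho> by (intro sum_le_majorant hol_H) auto
    then show "1 + B * \<rho> \<le> majorant H \<rho>" using coeff_H by (simp add: numeral_2_eq_2)
  qed (use \<rho> in auto)
  also have "\<dots> = hat f\<^sub>0 \<rho>" using extremal_majorant[OF f0, of \<rho>] \<rho> by simp
  also have "\<dots> \<le> c * hat f\<^sub>0 \<rho>"
    using c mult_right_mono[of 1 c "hat f\<^sub>0 \<rho>"] calculation by auto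
  finally have top: "L \<le> c * hat f\<^sub>0 \<rho>" using L_le_1 by simp
  have zero: "hat f\<^sub>0 0 = 0" using extremal_majorant[OF f0, of 0] by simp
  have hol: "f\<^sub>0 holomorphic_on \<D>" using A by (simp add: class_A_def)
  have "continuous_on {0..\<rho>} (\<lambda>r. c * majorant f\<^sub>0 r)"
    using \<rho> by (intro continuous_intros DERIV_atLeastAtMost_imp_continuous_on)
      (use majorant_has_derivative[OF hol] in force)
  then have "continuous_on {0..\<rho>} (\<lambda>r. c * hat f\<^sub>0 r)"
    by (rule continuous_on_eq) (use \<rho> hat_eq_majorant[OF A] in auto)
  then obtain r where r: "0 \<le> r" "r \<le> \<rho>" "c * hat f\<^sub>0 r = L"
    using IVT'[of "\<lambda>r. c * hat f\<^sub>0 r" 0 L \<rho>] zero top \<rho> L_pos by auto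
  have "r \<noteq> 0" using r zero L_pos by auto
  then show thesis using that[of r] r \<rho> by auto
qed

lemma bohr_inequality:
  assumes f0: "is_extremal \<psi> f\<^sub>0" and K: "1 \<le> K" and r: "0 \<le> r" "r \<le> 1/3"
    and r0: "2 * K / (K + 1) * hat f\<^sub>0 r \<le> L"
    and f: "f \<in> starlike_class \<psi>" and h: "qc_harmonic_mapping K f g"
    and f1: "f\<^sub>1 \<in> class_A" "harmonic_parts f\<^sub>1 g\<^sub>1"
    and sub: "harmonic_map f\<^sub>1 g\<^sub>1 \<prec>\<^sub>s harmonic_map f g"
  shows "bohr_sum f\<^sub>1 g\<^sub>1 r \<le> boundary_dist f"
proof -
  define k where "k = (K - 1) / (K + 1)"
  have k: "0 \<le> k" "1 + k = 2 * K / (K + 1)" using K by (auto simp: k_def field_simps)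
  have A: "f \<in> class_A" using f by (simp add: starlike_class_def)
  have hf: "f holomorphic_on \<D>" "f 0 = 0" using A by (auto simp: class_A_def)
  have hg: "g holomorphic_on \<D>" "g 0 = 0" using h by (auto simp: qc_harmonic_mapping_def harmonic_parts_def)
  have nz: "deriv f z \<noteq> 0" if "z \<in> \<D>" for z
    using h that by (force simp: qc_harmonic_mapping_def sense_preserving_def)
  have dil: "cmod (deriv g z / deriv f z) \<le> k" if "z \<in> \<D>" for z
    using h that by (auto simp: qc_harmonic_mapping_def k_def)
  obtain w G where w: "schwarz_function w" and G: "G holomorphic_on \<D>" "G 0 = 0"
    "\<And>z. z \<in> \<D> \<Longrightarrow> z * deriv G z = Psi (w z)" and fG: "\<And>z. z \<in> \<D> \<Longrightarrow> f z = z * exp (G z)"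
    using starlike_representation[OF f] by blast
  define e where "e = exp ((1 - cmod (deriv w 0)) * B / 6)"
  have r1: "r < 1" using r by simp
  have "bohr_sum f\<^sub>1 g\<^sub>1 r = majorant f\<^sub>1 r + majorant g\<^sub>1 r"
    using f1 r r1 by (intro bohr_sum_majorant) (auto simp: class_A_def harmonic_parts_def)
  also have "\<dots> = majorant f r + majorant g r"
    using normalised_subordinate_eq[OF A hg f1 sub] majorant_cong[of f\<^sub>1 f] majorant_cong[of g\<^sub>1 g] by simp
  also have "\<dots> \<le> majorant f r + k * majorant f r"
    using majorant_le_of_dilatation[OF hf(1) hg nz dil r] by simp
  also have "\<dots> = 2 * K / (K + 1) * majorant f r" unfolding k(2)[symmetric] by (simp add: distrib_right)
  also have "\<dots> \<le> 2 * K / (K + 1) * (hat f\<^sub>0 r * e)"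
    unfolding extremal_majorant[OF f0 r(1) r1] e_def
    using K by (intro mult_left_mono starlike_majorant[OF w G fG r]) auto
  also have "\<dots> \<le> L * e"
    using mult_right_mono[OF r0, of e] by (simp add: e_def mult.assoc)
  also have "\<dots> \<le> boundary_dist f"
    unfolding e_def by (rule starlike_boundary_dist(2)[OF w G fG])
  finally show ?thesis .
qed

lemma extremal_starlike:
  assumes "is_extremal \<psi> f\<^sub>0"
  shows "f\<^sub>0 \<in> starlike_class \<psi>"
  using assms schwarz_id by (auto simp: is_extremal_def starlike_class_def subordinate_def)

lemma extremal_qc:
  assumes f0: "is_extremal \<psi> f\<^sub>0" and K: "1 \<le> K" and k: "k = (K - 1) / (K + 1)"
  shows "qc_harmonic_mapping K f\<^sub>0 (\<lambda>z. complex_of_real k * f\<^sub>0 z)"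
proof -
  have hol: "f\<^sub>0 holomorphic_on \<D>" "f\<^sub>0 0 = 0" using f0 by (auto simp: is_extremal_def class_A_def)
  have k': "0 \<le> k" "k < 1" using K by (auto simp: k field_simps)
  have d: "deriv (\<lambda>z. complex_of_real k * f\<^sub>0 z) z = of_real k * deriv f\<^sub>0 z" if "z \<in> \<D>" for z
    by (rule DERIV_imp_deriv[OF DERIV_cmult[OF holomorphic_derivI[OF hol(1) open_ball that]]])
  have nz: "deriv f\<^sub>0 z \<noteq> 0" if "z \<in> \<D>" for z
    using holomorphic_injective_imp_regular[OF hol(1) open_ball extremal_inj[OF f0] that] .
  have "sense_preserving f\<^sub>0 (\<lambda>z. complex_of_real k * f\<^sub>0 z)"
    unfolding sense_preserving_def
  proof
    fix z :: complex assume z: "z \<in> \<D>"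
    have "k\<^sup>2 < 1" using k' by (simp add: power_less_one_iff)
    then have "0 < (1 - k\<^sup>2) * (cmod (deriv f\<^sub>0 z))\<^sup>2" using nz[OF z] by simp
    then show "0 < (cmod (deriv f\<^sub>0 z))\<^sup>2 - (cmod (deriv (\<lambda>z. complex_of_real k * f\<^sub>0 z) z))\<^sup>2"
      unfolding d[OF z] by (simp add: norm_mult power_mult_distrib left_diff_distrib)
  qed
  moreover have "cmod (deriv (\<lambda>z. complex_of_real k * f\<^sub>0 z) z / deriv f\<^sub>0 z) \<le> (K - 1) / (K + 1)"
    if "z \<in> \<D>" for z
    unfolding d[OF that] k[symmetric] using nz[OF that] k'(1) by (simp add: norm_mult norm_divide)
  moreover have "harmonic_parts f\<^sub>0 (\<lambda>z. complex_of_real k * f\<^sub>0 z)"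
    using hol by (auto simp: harmonic_parts_def intro!: holomorphic_intros)
  ultimately show ?thesis
    unfolding qc_harmonic_mapping_def
    using affine_harmonic_homeomorphism[OF hol(1) extremal_inj[OF f0] k'] by blast
qed

lemma extremal_bohr_sum:
  assumes f0: "is_extremal \<psi> f\<^sub>0" and k: "0 \<le> k" and r: "0 \<le> r" "r < 1"
  shows "bohr_sum f\<^sub>0 (\<lambda>z. complex_of_real k * f\<^sub>0 z) r = (1 + k) * hat f\<^sub>0 r"
proof -
  have A: "f\<^sub>0 \<in> class_A" using f0 by (simp add: is_extremal_def)
  then have hol: "f\<^sub>0 holomorphic_on \<D>" "f\<^sub>0 0 = 0" by (auto simp: class_A_def)
  have "bohr_sum f\<^sub>0 (\<lambda>z. complex_of_real k * f\<^sub>0 z) r =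
      majorant f\<^sub>0 r + majorant (\<lambda>z. complex_of_real k * f\<^sub>0 z) r"
    using hol r by (intro bohr_sum_majorant holomorphic_intros) auto
  also have "majorant (\<lambda>z. complex_of_real k * f\<^sub>0 z) r = k * majorant f\<^sub>0 r"
    using majorant_cmult[OF hol(1) r, of "of_real k"] k by simp
  finally show ?thesis using hat_eq_majorant[OF A r] by (simp add: distrib_right)
qed

end

theorem theorem2p1:
  fixes \<psi> f\<^sub>0 :: "complex \<Rightarrow> complex" and K k :: real
  assumes "ma_minda \<psi>"
    and "K \<ge> 1" and "k = (K - 1) / (K + 1)"
    and "is_extremal \<psi> f\<^sub>0"
  shows "\<exists>r\<^sub>0\<in>{0<..<1}.
    (\<forall>r\<in>{0<..<1}.
       complex_of_real (2 * K / (K + 1) * hat f\<^sub>0 r) = - value_at_minus_one f\<^sub>0 \<longleftrightarrow> r = r\<^sub>0) \<and>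
    (let r' = min r\<^sub>0 (1/3) in
      (\<forall>f g f\<^sub>1 g\<^sub>1.
         f \<in> starlike_class \<psi> \<longrightarrow> qc_harmonic_mapping K f g \<longrightarrow>
         f\<^sub>1 \<in> class_A \<longrightarrow> harmonic_parts f\<^sub>1 g\<^sub>1 \<longrightarrow> harmonic_map f\<^sub>1 g\<^sub>1 \<prec>\<^sub>s harmonic_map f g \<longrightarrow>
         (\<forall>r\<in>{0..r'}. bohr_sum f\<^sub>1 g\<^sub>1 r \<le> boundary_dist f)) \<and>
      ((\<forall>r\<in>{0..<1}. complex_of_real (hat f\<^sub>0 r) = f\<^sub>0 (complex_of_real r)) \<longrightarrow> r' = r\<^sub>0 \<longrightarrow>
         (let g\<^sub>0 = (\<lambda>z. complex_of_real k * f\<^sub>0 z) in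
            f\<^sub>0 \<in> starlike_class \<psi> \<and> qc_harmonic_mapping K f\<^sub>0 g\<^sub>0 \<and>
            harmonic_map f\<^sub>0 g\<^sub>0 \<prec>\<^sub>s harmonic_map f\<^sub>0 g\<^sub>0 \<and>
            bohr_sum f\<^sub>0 g\<^sub>0 r\<^sub>0 = boundary_dist f\<^sub>0 \<and>
            (\<forall>r\<in>{r\<^sub>0<..<1}. bohr_sum f\<^sub>0 g\<^sub>0 r > boundary_dist f\<^sub>0))))"
proof -
  interpret ma_minda_function \<psi> by standard (rule assms(1))
  note f0 = assms(4)
  have A: "f\<^sub>0 \<in> class_A" using f0 by (simp add: is_extremal_def)
  define c where "c = 2 * K / (K + 1)"
  have c: "1 \<le> c" "0 \<le> k" "1 + k = c" using assms(2) unfolding assms(3) by (auto simp: c_def field_simps)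
  obtain r\<^sub>0 where r0: "0 < r\<^sub>0" "r\<^sub>0 < 1" "c * hat f\<^sub>0 r\<^sub>0 = L"
    using radius_exists[OF f0 c(1)] by blast
  have mono: "c * hat f\<^sub>0 r < c * hat f\<^sub>0 s" if "0 \<le> r" "r < s" "s < 1" for r s
    using hat_strict_mono[OF A that] c(1) by simp
  have root: "complex_of_real (c * hat f\<^sub>0 r) = - value_at_minus_one f\<^sub>0 \<longleftrightarrow> r = r\<^sub>0"
    if r: "r \<in> {0<..<1}" for r
  proof -
    have "complex_of_real (c * hat f\<^sub>0 r) = - value_at_minus_one f\<^sub>0 \<longleftrightarrow> c * hat f\<^sub>0 r = c * hat f\<^sub>0 r\<^sub>0"
      unfolding value_at_minus_one[OF f0] minus_minus of_real_eq_iff r0(3) ..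
    also have "\<dots> \<longleftrightarrow> r = r\<^sub>0"
      using mono[of r r\<^sub>0] mono[of r\<^sub>0 r] r r0 by (cases r r\<^sub>0 rule: linorder_cases) auto
    finally show ?thesis .
  qed
  have main: "bohr_sum f\<^sub>1 g\<^sub>1 r \<le> boundary_dist f"
    if "f \<in> starlike_class \<psi>" "qc_harmonic_mapping K f g" "f\<^sub>1 \<in> class_A" "harmonic_parts f\<^sub>1 g\<^sub>1"
      "harmonic_map f\<^sub>1 g\<^sub>1 \<prec>\<^sub>s harmonic_map f g" and r: "r \<in> {0..min r\<^sub>0 (1/3)}" for f g f\<^sub>1 g\<^sub>1 r
  proof (rule bohr_inequality[OF f0 assms(2) _ _ _ that(1-5)])
    show "2 * K / (K + 1) * hat f\<^sub>0 r \<le> L"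
      using mono[of r r\<^sub>0] r r0 unfolding c_def[symmetric] by (cases "r = r\<^sub>0") auto
  qed (use r in auto)
  have sharp: "bohr_sum f\<^sub>0 (\<lambda>z. complex_of_real k * f\<^sub>0 z) r\<^sub>0 = boundary_dist f\<^sub>0"
    "\<And>r. r \<in> {r\<^sub>0<..<1} \<Longrightarrow> boundary_dist f\<^sub>0 < bohr_sum f\<^sub>0 (\<lambda>z. complex_of_real k * f\<^sub>0 z) r"
    using extremal_bohr_sum[OF f0 c(2)] extremal_boundary_dist[OF f0] r0 mono[of r\<^sub>0] unfolding c(3) by auto
  have refl: "harmonic_map f\<^sub>0 g \<prec>\<^sub>s harmonic_map f\<^sub>0 g" for g
    using schwarz_id by (auto simp: subordinate_def)
  show ?thesis
    unfolding Let_def c_def[symmetric]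
    using r0(1,2) root main extremal_starlike[OF f0] extremal_qc[OF f0 assms(2,3)] refl sharp
    by (intro bexI[of _ r\<^sub>0]) auto
qed

end
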